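(* Let $(E,\mathcal F,\mu)$, $L$, $\Gamma$ be a Markov setting as described in the context. Let $\nu$ be a Pearson distribution, i.e. the invariant distribution of the diffusion $$dX_t=-\theta(X_t-m)\,dt+\sqrt{2\theta\, b(X_t)}\,dB_t,\qquad \theta=\tfrac12,$$ with mean $m\in\mathbb R$ and squared diffusion coefficient $\sigma^2(x)=b(x)=b_2x^2+b_1x+b_0$, where $b_0,b_1,b_2\in\mathbb R$, and assume that $\nu$ has a finite fourth moment (equivalently $b_2<\tfrac13$). Let $F$ be a chaotic eigenfunction of $L$ with respect to the eigenvalue $-\lambda$ ($\lambda>0$), with chaos grade $\eta$ and with finite moments up to order $4$. Set $G=F+m$. Define the polynomials $$Q(x)=x^2+\frac{2(b_1+m)}{2b_2-1}\,x+\frac{1}{b_2-1}\left(b_0+\frac{m(b_1+m)}{2b_2-1}\right),$$ $$U(x)=(1-b_2)\,Q(x)^2-\frac1{12}\,\bigl(Q'(x)\bigr)^3(x-m).$$ Then: (a) if $\eta\le 2(1-b_2)$, one has $$\int_E\bigl(\Gamma(G,-L^{-1}G)-b(G)\bigr)^2\,d\mu\;\le\;2\Bigl(1-b_2-\frac{\eta}{4}\Bigr)\int_E U(G)\,d\mu;$$ (b) if $\eta>2(1-b_2)$, then with $\xi=\eta-2(1-b_2)>0$ one has $$\int_E\bigl(\Gamma(G,-L^{-1}G)-b(G)\bigr)^2\,d\mu\;\le\;2\Bigl(1-b_2-\frac{\eta}{4}\Bigr)\int_E U(G)\,d\mu+\frac{\xi(1-b_2)}{2}\int_E Q(G)^2\,d\mu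 .$$
   Context: **Markov setting.** $(E,\mathcal F,\mu)$ is a probability space with $L^2(E,\mu)$ separable and norm $\|\cdot\|_2$. The following is assumed. (1) $\mathcal A$ is a vector space of real-valued measurable functions on $E$, stable under products and under the action $(F_1,\dots,F_k)\mapsto\Psi(F_1,\dots,F_k)$ of $C^\infty$ functions $\Psi:\mathbb R^k\to\mathbb R$. (2) $\mathcal A_0\subseteq\mathcal A$ is a subalgebra of bounded functions, dense in $L^p(E,\mu)$ for every $p\in[1,\infty)$, stable under the action of $C^\infty$ functions $\Psi$ with $\Psi(0)=0$, and an ideal in $\mathcal A$. (3) $\Gamma:\mathcal A_0\times\mathcal A_0\to\mathcal A_0$ (carré du champ) is bilinear, symmetric, with $\Gamma(F,F)\ge0$; for every $F\in\mathcal A_0$ there is a finite $c_F$ with $|\int_E\Gamma(F,G)\,d\mu|\le c_F\|G\|_2$ for all $G\in\mathcal A_0$. Put $\mathcal E(F,G)=\int_E\Gamma(F,G)\,d\mu$. (4) $\mathcal D(\mathcal E)\subseteq L^2(E,\mu)$ is the completion of $\mathcal A_0$ for the norm $(\|F\|_2^2+\mathcal E(F,F))^{1/2}$; $\mathcal E$ and $\Gamma$ are extended to $\mathcal D(\mathcal E)\times\mathcal D(\mathcal E)$ by continuity and polarization, so $\Gamma:\mathcal D(\mathcal E)\times\mathcal D(\mathcal E)\to L^1(E,\mu)$. (5) $L$ is the linear operator defined on $\mathcal A_0$ by $\int_E G\,LF\,d\mu=-\int_E\Gamma(F,G)\,d\mu$ for $F,G\in\mathcal A_0$, and $L(\mathcal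 A_0)\subseteq\mathcal A_0$. (6) $\mathcal D(L)$ is the set of $F\in\mathcal D(\mathcal E)$ for which there is a finite $c_F$ with $|\mathcal E(F,G)|\le c_F\|G\|_2$ for all $G\in\mathcal D(\mathcal E)$; $L$ is extended to $\mathcal D(L)$ by the same integration by parts formula and is self-adjoint there. It is assumed that $L1=0$ and that $LF=0$ with $F\in\mathcal D(L)$ implies $F$ constant. (7) $L$ also has an extension $L:\mathcal A\to\mathcal A$, and on $\mathcal A\times\mathcal A$ one sets $\Gamma(F,G)=\frac12(L(FG)-F\,LG-G\,LF)$; $\Gamma(F,F)\ge0$ for all $F\in\mathcal A$, with equality iff $F$ is constant. (8) Diffusion property: for $C^\infty$ $\Psi:\mathbb R^p\to\mathbb R$ and $F_1,\dots,F_p,G\in\mathcal A$, $\Gamma(\Psi(F_1,\dots,F_p),G)=\sum_j\partial_j\Psi(F_1,\dots,F_p)\Gamma(F_j,G)$ and $L\Psi(F_1,\dots,F_p)=\sum_i\partial_i\Psi(F_1,\dots,F_p)LF_i+\sum_{i,j}\partial_{ij}\Psi(F_1,\dots,F_p)\Gamma(F_i,F_j)$. (9) The integration by parts formula in (5) also holds if one of $F,G$ is in $\mathcal A$ and the other in $\mathcal A_0$. **Pseudo-inverse.** $\mathcal D(L)=\ker(L)\oplus(\operatorname{ran}(L)\cap\mathcal D(L))$; $L^{-1}$ is the inverse of $L$ on $\operatorname{ran}(L)\cap\mathcal D(L)$ and $L^{-1}X=0$ for $X\in\ker(L)$, so that $LL^{-1}X=L^{-1}LX=X-\int_EX\,d\mu$.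 In particular for an eigenfunction $F$ with $LF=-\lambda F$, $\lambda>0$, and $G=F+m$, one has $L^{-1}G=-\frac1\lambda F$. **Chaotic eigenfunctions.** Let $\Lambda\subseteq(-\infty,0]$ be the set of eigenvalues of $L$ (on $\mathcal D(L)$). An eigenfunction $F$ with respect to an eigenvalue $-\lambda$ of $L$, $\lambda>0$, is *chaotic* if there exists $\eta>1$ such that $-\eta\lambda$ is an eigenvalue of $L$ and $$F^2\in\bigoplus_{-\kappa\in\Lambda,\ \kappa\le\eta\lambda}\ker(L+\kappa\,\mathrm{Id})$$ (orthogonal direct sum in $L^2(E,\mu)$). The smallest such $\eta$ is the *chaos grade* of $F$. Eigenfunctions with $\lambda>0$ are automatically centered. *)

theory Defs
  imports "HOL-Probability.Probability" "HOL-Computational_Algebra.Polynomial"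
begin

section \<open>Smooth functions of finitely many real variables\<close>

text \<open>
  The arity \<open>k\<close> has to be quantified inside the axioms below, so a function on \<open>\<real>\<^sup>k\<close> is a function on
  sequences that only looks at the coordinates \<open>0, \<dots>, k - 1\<close>. For such a function, continuity in the
  product topology on \<open>nat \<Rightarrow> real\<close> is joint continuity in the first \<open>k\<close> variables.
\<close>

definition partial_deriv :: "nat \<Rightarrow> ((nat \<Rightarrow> real) \<Rightarrow> real) \<Rightarrow> (nat \<Rightarrow> real) \<Rightarrow> real" where
  "partial_deriv i \<Psi> v = deriv (\<lambda>t. \<Psi> (v(i := t))) (v i)"

definition smooth_fun :: "nat \<Rightarrow> ((nat \<Rightarrow> real) \<Rightarrow> real) \<Rightarrow> bool" where
  "smooth_fun k \<Psi> \<longleftrightarrow>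
     (\<forall>v w. (\<forall>i<k. v i = w i) \<longrightarrow> \<Psi> v = \<Psi> w) \<and>
     (\<forall>is. set is \<subseteq> {..<k} \<longrightarrow>
        continuous_on UNIV (foldr partial_deriv is \<Psi>) \<and>
        (\<forall>i<k. \<forall>v. (\<lambda>t. foldr partial_deriv is \<Psi> (v(i := t))) differentiable at (v i)))"


section \<open>Function spaces\<close>

text \<open>
  Elements of \<open>L\<^sup>p\<close> are represented by functions; all identities between them are required only
  almost everywhere.
\<close>

definition Lp :: "'a measure \<Rightarrow> real \<Rightarrow> ('a \<Rightarrow> real) set" where
  "Lp M p = {f \<in> borel_measurable M. integrable M (\<lambda>x. \<bar>f x\<bar> powr p)}"

definition L2 :: "'a measure \<Rightarrow> ('a \<Rightarrow> real) set" where
  "L2 M = {f \<in> borel_measurable M. integrable M (\<lambda>x. (f x)\<^sup>2)}"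

definition L2_norm :: "'a measure \<Rightarrow> ('a \<Rightarrow> real) \<Rightarrow> real" where
  "L2_norm M f = sqrt (\<integral>x. (f x)\<^sup>2 \<partial>M)"

definition ae_const :: "'a measure \<Rightarrow> ('a \<Rightarrow> real) \<Rightarrow> bool" where
  "ae_const M f \<longleftrightarrow> (\<exists>c. AE x in M. f x = c)"

definition fun_subalgebra :: "('a \<Rightarrow> real) set \<Rightarrow> bool" where
  "fun_subalgebra V \<longleftrightarrow> (\<lambda>_. 0) \<in> V \<and>
     (\<forall>F\<in>V. \<forall>G\<in>V. (\<lambda>x. F x + G x) \<in> V \<and> (\<lambda>x. F x * G x) \<in> V) \<and>
     (\<forall>F\<in>V. \<forall>c. (\<lambda>x. c * F x) \<in> V)"


section \<open>Dirichlet form and generator\<close>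

definition dform :: "'a measure \<Rightarrow> (('a \<Rightarrow> real) \<Rightarrow> ('a \<Rightarrow> real) \<Rightarrow> 'a \<Rightarrow> real)
    \<Rightarrow> ('a \<Rightarrow> real) \<Rightarrow> ('a \<Rightarrow> real) \<Rightarrow> real" where
  "dform M \<Gamma> F G = (\<integral>x. \<Gamma> F G x \<partial>M)"

text \<open>
  \<open>F\<close> is the \<open>L\<^sup>2\<close>-limit of a sequence in \<open>A0\<close> that is Cauchy for the form. The form is closable, so
  the abstract completion of \<open>A0\<close> is realised inside \<open>L\<^sup>2\<close> by these limits.
\<close>

definition form_approx :: "'a measure \<Rightarrow> ('a \<Rightarrow> real) set
    \<Rightarrow> (('a \<Rightarrow> real) \<Rightarrow> ('a \<Rightarrow> real) \<Rightarrow> 'a \<Rightarrow> real)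
    \<Rightarrow> (nat \<Rightarrow> 'a \<Rightarrow> real) \<Rightarrow> ('a \<Rightarrow> real) \<Rightarrow> bool" where
  "form_approx M A0 \<Gamma> Fs F \<longleftrightarrow>
     (\<forall>n. Fs n \<in> A0) \<and>
     (\<lambda>n. L2_norm M (\<lambda>x. Fs n x - F x)) \<longlonglongrightarrow> 0 \<and>
     (\<forall>\<epsilon>>0. \<exists>N. \<forall>i\<ge>N. \<forall>j\<ge>N.
        dform M \<Gamma> (\<lambda>x. Fs i x - Fs j x) (\<lambda>x. Fs i x - Fs j x) < \<epsilon>)"

definition dom_form :: "'a measure \<Rightarrow> ('a \<Rightarrow> real) set
    \<Rightarrow> (('a \<Rightarrow> real) \<Rightarrow> ('a \<Rightarrow> real) \<Rightarrow> 'a \<Rightarrow> real) \<Rightarrow> ('a \<Rightarrow> real) set" where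
  "dom_form M A0 \<Gamma> = {F \<in> L2 M. \<exists>Fs. form_approx M A0 \<Gamma> Fs F}"

definition dom_gen :: "'a measure \<Rightarrow> ('a \<Rightarrow> real) set
    \<Rightarrow> (('a \<Rightarrow> real) \<Rightarrow> ('a \<Rightarrow> real) \<Rightarrow> 'a \<Rightarrow> real) \<Rightarrow> ('a \<Rightarrow> real) set" where
  "dom_gen M A0 \<Gamma> =
     {F \<in> dom_form M A0 \<Gamma>. \<exists>c. \<forall>G\<in>dom_form M A0 \<Gamma>. \<bar>dform M \<Gamma> F G\<bar> \<le> c * L2_norm M G}"

text \<open>The graph of \<open>T\<close> coincides with the graph of its adjoint.\<close>

definition self_adjoint_op :: "'a measure \<Rightarrow> ('a \<Rightarrow> real) set
    \<Rightarrow> (('a \<Rightarrow> real) \<Rightarrow> 'a \<Rightarrow> real) \<Rightarrow> bool" where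
  "self_adjoint_op M D T \<longleftrightarrow>
     (\<forall>F\<in>L2 M. \<forall>H\<in>L2 M.
        (F \<in> D \<and> (AE x in M. T F x = H x)) \<longleftrightarrow>
        (\<forall>G\<in>D. (\<integral>x. F x * T G x \<partial>M) = (\<integral>x. H x * G x \<partial>M)))"

text \<open>
  As in the literature, one symbol \<open>\<Gamma>\<close> serves for the carre du champ on \<open>A\<close> and for its extension to
  the form domain, and one symbol \<open>L\<close> for the generator on \<open>A\<close> and on its \<open>L\<^sup>2\<close>-domain. Where two of
  the domains overlap, the integration by parts and diffusion axioms force the versions to agree
  almost everywhere.
\<close>

locale markov_setting = prob_space M for M :: "'a measure" +
  fixes A A0 :: "('a \<Rightarrow> real) set"
    and \<Gamma> :: "('a \<Rightarrow> real) \<Rightarrow> ('a \<Rightarrow> real) \<Rightarrow> 'a \<Rightarrow> real"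
    and L :: "('a \<Rightarrow> real) \<Rightarrow> 'a \<Rightarrow> real"
  assumes L2_separable:
      "\<exists>D\<subseteq>L2 M. countable D \<and> (\<forall>f\<in>L2 M. \<forall>\<epsilon>>0. \<exists>g\<in>D. L2_norm M (\<lambda>x. f x - g x) < \<epsilon>)"

    and A_measurable: "A \<subseteq> borel_measurable M"
    and A_algebra: "fun_subalgebra A"
    and A_smooth: "\<And>k \<Psi> F. smooth_fun k \<Psi> \<Longrightarrow> (\<And>i. i < k \<Longrightarrow> F i \<in> A)
        \<Longrightarrow> (\<lambda>x. \<Psi> (\<lambda>i. F i x)) \<in> A"

    and A0_subset: "A0 \<subseteq> A"
    and A0_algebra: "fun_subalgebra A0"
    and A0_bounded: "\<And>F. F \<in> A0 \<Longrightarrow> \<exists>c. AE x in M. \<bar>F x\<bar> \<le> c"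
    and A0_dense: "\<And>p f \<epsilon>. 1 \<le> p \<Longrightarrow> f \<in> Lp M p \<Longrightarrow> 0 < \<epsilon>
        \<Longrightarrow> \<exists>g\<in>A0. (\<integral>x. \<bar>f x - g x\<bar> powr p \<partial>M) powr (1 / p) < \<epsilon>"
    and A0_smooth: "\<And>k \<Psi> F. smooth_fun k \<Psi> \<Longrightarrow> \<Psi> (\<lambda>_. 0) = 0 \<Longrightarrow> (\<And>i. i < k \<Longrightarrow> F i \<in> A0)
        \<Longrightarrow> (\<lambda>x. \<Psi> (\<lambda>i. F i x)) \<in> A0"
    and A0_ideal: "\<And>F G. F \<in> A0 \<Longrightarrow> G \<in> A \<Longrightarrow> (\<lambda>x. F x * G x) \<in> A0"

    and \<Gamma>_A0: "\<And>F G. F \<in> A0 \<Longrightarrow> G \<in> A0 \<Longrightarrow> \<Gamma> F G \<in> A0"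
    and \<Gamma>_sym: "\<And>F G. F \<in> A0 \<Longrightarrow> G \<in> A0 \<Longrightarrow> AE x in M. \<Gamma> F G x = \<Gamma> G F x"
    and \<Gamma>_linear: "\<And>F G H c d. F \<in> A0 \<Longrightarrow> G \<in> A0 \<Longrightarrow> H \<in> A0
        \<Longrightarrow> AE x in M. \<Gamma> (\<lambda>y. c * F y + d * G y) H x = c * \<Gamma> F H x + d * \<Gamma> G H x"
    and \<Gamma>_nonneg_A0: "\<And>F. F \<in> A0 \<Longrightarrow> AE x in M. 0 \<le> \<Gamma> F F x"
    and form_bounded_A0: "\<And>F. F \<in> A0 \<Longrightarrow> \<exists>c. \<forall>G\<in>A0. \<bar>dform M \<Gamma> F G\<bar> \<le> c * L2_norm M G"

    \<comment> \<open>extension of \<open>\<Gamma>\<close>, hence also of the form \<open>\<integral>\<Gamma>\<close>, to the form domain by continuity\<close>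
    and \<Gamma>_integrable: "\<And>F G. F \<in> dom_form M A0 \<Gamma> \<Longrightarrow> G \<in> dom_form M A0 \<Gamma> \<Longrightarrow> integrable M (\<Gamma> F G)"
    and \<Gamma>_continuous: "\<And>F G Fs Gs. F \<in> dom_form M A0 \<Gamma> \<Longrightarrow> G \<in> dom_form M A0 \<Gamma>
        \<Longrightarrow> form_approx M A0 \<Gamma> Fs F \<Longrightarrow> form_approx M A0 \<Gamma> Gs G
        \<Longrightarrow> (\<lambda>n. \<integral>x. \<bar>\<Gamma> (Fs n) (Gs n) x - \<Gamma> F G x\<bar> \<partial>M) \<longlonglongrightarrow> 0"

    and L_A0: "\<And>F. F \<in> A0 \<Longrightarrow> L F \<in> A0"
    and L_linear: "\<And>F G c d. F \<in> A0 \<Longrightarrow> G \<in> A0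
        \<Longrightarrow> AE x in M. L (\<lambda>y. c * F y + d * G y) x = c * L F x + d * L G x"
    and L_by_parts_A0: "\<And>F G. F \<in> A0 \<Longrightarrow> G \<in> A0
        \<Longrightarrow> (\<integral>x. G x * L F x \<partial>M) = - (\<integral>x. \<Gamma> F G x \<partial>M)"

    and L_L2: "\<And>F. F \<in> dom_gen M A0 \<Gamma> \<Longrightarrow> L F \<in> L2 M"
    and L_by_parts: "\<And>F G. F \<in> dom_gen M A0 \<Gamma> \<Longrightarrow> G \<in> dom_form M A0 \<Gamma>
        \<Longrightarrow> (\<integral>x. G x * L F x \<partial>M) = - dform M \<Gamma> F G"
    and L_self_adjoint: "self_adjoint_op M (dom_gen M A0 \<Gamma>) L"
    and one_in_dom: "(\<lambda>_. 1) \<in> dom_gen M A0 \<Gamma>"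
    and L_one: "AE x in M. L (\<lambda>_. 1) x = 0"
    and L_ker_const: "\<And>F. F \<in> dom_gen M A0 \<Gamma> \<Longrightarrow> (AE x in M. L F x = 0) \<Longrightarrow> ae_const M F"

    and L_A: "\<And>F. F \<in> A \<Longrightarrow> L F \<in> A"
    and \<Gamma>_A: "\<And>F G. F \<in> A \<Longrightarrow> G \<in> A
        \<Longrightarrow> AE x in M. \<Gamma> F G x = (L (\<lambda>y. F y * G y) x - F x * L G x - G x * L F x) / 2"
    and \<Gamma>_nonneg_A: "\<And>F. F \<in> A \<Longrightarrow> AE x in M. 0 \<le> \<Gamma> F F x"
    and \<Gamma>_zero_iff: "\<And>F. F \<in> A \<Longrightarrow> (AE x in M. \<Gamma> F F x = 0) \<longleftrightarrow> ae_const M F"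

    and diffusion_\<Gamma>: "\<And>p \<Psi> F G. smooth_fun p \<Psi> \<Longrightarrow> (\<And>i. i < p \<Longrightarrow> F i \<in> A) \<Longrightarrow> G \<in> A
        \<Longrightarrow> AE x in M. \<Gamma> (\<lambda>y. \<Psi> (\<lambda>i. F i y)) G x =
              (\<Sum>j<p. partial_deriv j \<Psi> (\<lambda>i. F i x) * \<Gamma> (F j) G x)"
    and diffusion_L: "\<And>p \<Psi> F. smooth_fun p \<Psi> \<Longrightarrow> (\<And>i. i < p \<Longrightarrow> F i \<in> A)
        \<Longrightarrow> AE x in M. L (\<lambda>y. \<Psi> (\<lambda>i. F i y)) x =
              (\<Sum>i<p. partial_deriv i \<Psi> (\<lambda>i. F i x) * L (F i) x) +
              (\<Sum>i<p. \<Sum>j<p. partial_deriv i (partial_deriv j \<Psi>) (\<lambda>i. F i x) * \<Gamma> (F i) (F j) x)"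

    and L_by_parts_A: "\<And>F G. F \<in> A \<and> G \<in> A0 \<or> F \<in> A0 \<and> G \<in> A
        \<Longrightarrow> (\<integral>x. G x * L F x \<partial>M) = - (\<integral>x. \<Gamma> F G x \<partial>M)"


section \<open>Eigenspaces, chaotic eigenfunctions, pseudo-inverse\<close>

text \<open>The kernel of \<open>L + \<kappa> Id\<close> on the domain of the generator.\<close>

definition eigenspace :: "'a measure \<Rightarrow> ('a \<Rightarrow> real) set
    \<Rightarrow> (('a \<Rightarrow> real) \<Rightarrow> ('a \<Rightarrow> real) \<Rightarrow> 'a \<Rightarrow> real) \<Rightarrow> (('a \<Rightarrow> real) \<Rightarrow> 'a \<Rightarrow> real)
    \<Rightarrow> real \<Rightarrow> ('a \<Rightarrow> real) set" where
  "eigenspace M A0 \<Gamma> L \<kappa> = {F \<in> dom_gen M A0 \<Gamma>. AE x in M. L F x + \<kappa> * F x = 0}"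

text \<open>\<open>F\<close> is an eigenfunction with eigenvalue \<open>-\<kappa>\<close>.\<close>

definition eigenfunction :: "'a measure \<Rightarrow> ('a \<Rightarrow> real) set
    \<Rightarrow> (('a \<Rightarrow> real) \<Rightarrow> ('a \<Rightarrow> real) \<Rightarrow> 'a \<Rightarrow> real) \<Rightarrow> (('a \<Rightarrow> real) \<Rightarrow> 'a \<Rightarrow> real)
    \<Rightarrow> ('a \<Rightarrow> real) \<Rightarrow> real \<Rightarrow> bool" where
  "eigenfunction M A0 \<Gamma> L F \<kappa> \<longleftrightarrow> F \<in> eigenspace M A0 \<Gamma> L \<kappa> \<and> \<not> (AE x in M. F x = 0)"

definition eigenvalues :: "'a measure \<Rightarrow> ('a \<Rightarrow> real) set
    \<Rightarrow> (('a \<Rightarrow> real) \<Rightarrow> ('a \<Rightarrow> real) \<Rightarrow> 'a \<Rightarrow> real) \<Rightarrow> (('a \<Rightarrow> real) \<Rightarrow> 'a \<Rightarrow> real)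
    \<Rightarrow> real set" where
  "eigenvalues M A0 \<Gamma> L = {- \<kappa> | \<kappa>. \<exists>F. eigenfunction M A0 \<Gamma> L F \<kappa>}"

text \<open>
  The Hilbert space direct sum of a family of pairwise orthogonal subspaces: all unconditional
  \<open>L\<^sup>2\<close>-limits of sums with one summand from each subspace.
\<close>

definition hilbert_sum :: "'a measure \<Rightarrow> 'i set \<Rightarrow> ('i \<Rightarrow> ('a \<Rightarrow> real) set) \<Rightarrow> ('a \<Rightarrow> real) set" where
  "hilbert_sum M I V = {H \<in> L2 M. \<exists>f. (\<forall>i\<in>I. f i \<in> V i) \<and>
     ((\<lambda>J. L2_norm M (\<lambda>x. H x - (\<Sum>i\<in>J. f i x))) \<longlongrightarrow> 0) (finite_subsets_at_top I)}"

definition chaotic_with :: "'a measure \<Rightarrow> ('a \<Rightarrow> real) set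
    \<Rightarrow> (('a \<Rightarrow> real) \<Rightarrow> ('a \<Rightarrow> real) \<Rightarrow> 'a \<Rightarrow> real) \<Rightarrow> (('a \<Rightarrow> real) \<Rightarrow> 'a \<Rightarrow> real)
    \<Rightarrow> ('a \<Rightarrow> real) \<Rightarrow> real \<Rightarrow> real \<Rightarrow> bool" where
  "chaotic_with M A0 \<Gamma> L F lam \<eta> \<longleftrightarrow>
     1 < \<eta> \<and> - (\<eta> * lam) \<in> eigenvalues M A0 \<Gamma> L \<and>
     (\<lambda>x. (F x)\<^sup>2) \<in> hilbert_sum M {\<kappa>. - \<kappa> \<in> eigenvalues M A0 \<Gamma> L \<and> \<kappa> \<le> \<eta> * lam}
                       (eigenspace M A0 \<Gamma> L)"

definition chaotic_eigenfunction :: "'a measure \<Rightarrow> ('a \<Rightarrow> real) set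
    \<Rightarrow> (('a \<Rightarrow> real) \<Rightarrow> ('a \<Rightarrow> real) \<Rightarrow> 'a \<Rightarrow> real) \<Rightarrow> (('a \<Rightarrow> real) \<Rightarrow> 'a \<Rightarrow> real)
    \<Rightarrow> ('a \<Rightarrow> real) \<Rightarrow> real \<Rightarrow> bool" where
  "chaotic_eigenfunction M A0 \<Gamma> L F lam \<longleftrightarrow>
     0 < lam \<and> eigenfunction M A0 \<Gamma> L F lam \<and> (\<exists>\<eta>. chaotic_with M A0 \<Gamma> L F lam \<eta>)"

text \<open>A relation rather than a function, since a least \<open>\<eta>\<close> need not exist in general.\<close>

definition chaos_grade :: "'a measure \<Rightarrow> ('a \<Rightarrow> real) set
    \<Rightarrow> (('a \<Rightarrow> real) \<Rightarrow> ('a \<Rightarrow> real) \<Rightarrow> 'a \<Rightarrow> real) \<Rightarrow> (('a \<Rightarrow> real) \<Rightarrow> 'a \<Rightarrow> real)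
    \<Rightarrow> ('a \<Rightarrow> real) \<Rightarrow> real \<Rightarrow> real \<Rightarrow> bool" where
  "chaos_grade M A0 \<Gamma> L F lam \<eta> \<longleftrightarrow>
     chaotic_with M A0 \<Gamma> L F lam \<eta> \<and> (\<forall>\<eta>'. chaotic_with M A0 \<Gamma> L F lam \<eta>' \<longrightarrow> \<eta> \<le> \<eta>')"

definition gen_range :: "'a measure \<Rightarrow> ('a \<Rightarrow> real) set
    \<Rightarrow> (('a \<Rightarrow> real) \<Rightarrow> ('a \<Rightarrow> real) \<Rightarrow> 'a \<Rightarrow> real) \<Rightarrow> (('a \<Rightarrow> real) \<Rightarrow> 'a \<Rightarrow> real)
    \<Rightarrow> ('a \<Rightarrow> real) set" where
  "gen_range M A0 \<Gamma> L = {H \<in> L2 M. \<exists>F\<in>dom_gen M A0 \<Gamma>. AE x in M. L F x = H x}"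

text \<open>
  For \<open>X = K + R\<close> with \<open>K\<close> in the kernel and \<open>R\<close> in the range of \<open>L\<close> (and in its domain), this is the
  solution \<open>Y\<close> of \<open>L Y = R\<close> lying in the range of \<open>L\<close>; it is unique up to null sets because the
  kernel consists of the constants and the range of centered functions.
\<close>

definition pseudo_inverse :: "'a measure \<Rightarrow> ('a \<Rightarrow> real) set
    \<Rightarrow> (('a \<Rightarrow> real) \<Rightarrow> ('a \<Rightarrow> real) \<Rightarrow> 'a \<Rightarrow> real) \<Rightarrow> (('a \<Rightarrow> real) \<Rightarrow> 'a \<Rightarrow> real)
    \<Rightarrow> ('a \<Rightarrow> real) \<Rightarrow> 'a \<Rightarrow> real" where
  "pseudo_inverse M A0 \<Gamma> L X =
     (SOME Y. Y \<in> gen_range M A0 \<Gamma> L \<inter> dom_gen M A0 \<Gamma> \<and>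
        (\<exists>K R. K \<in> eigenspace M A0 \<Gamma> L 0 \<and> R \<in> gen_range M A0 \<Gamma> L \<inter> dom_gen M A0 \<Gamma> \<and>
               (AE x in M. X x = K x + R x) \<and> (AE x in M. L Y x = R x)))"


section \<open>Pearson diffusions and Pearson distributions\<close>

definition brownian_motion :: "'w measure \<Rightarrow> (real \<Rightarrow> 'w measure) \<Rightarrow> (real \<Rightarrow> 'w \<Rightarrow> real) \<Rightarrow> bool" where
  "brownian_motion P \<F> B \<longleftrightarrow>
     (\<forall>t\<ge>0. B t \<in> borel_measurable (\<F> t)) \<and>
     (AE \<omega> in P. B 0 \<omega> = 0) \<and>
     (AE \<omega> in P. continuous_on {0..} (\<lambda>t. B t \<omega>)) \<and>
     (\<forall>s\<ge>0. \<forall>t>s.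
        distributed P lborel (\<lambda>\<omega>. B t \<omega> - B s \<omega>) (\<lambda>x. ennreal (normal_density 0 (sqrt (t - s)) x)) \<and>
        prob_space.indep_set P (sets (\<F> s))
          {(\<lambda>\<omega>. B t \<omega> - B s \<omega>) -` C \<inter> space P | C. C \<in> sets borel})"

text \<open>
  The Ito integral over \<open>[0, t]\<close> of an adapted process with continuous paths: the limit in
  probability of the left-endpoint Riemann sums.
\<close>

definition has_ito_integral :: "'w measure \<Rightarrow> (real \<Rightarrow> 'w \<Rightarrow> real) \<Rightarrow> (real \<Rightarrow> 'w \<Rightarrow> real)
    \<Rightarrow> real \<Rightarrow> ('w \<Rightarrow> real) \<Rightarrow> bool" where
  "has_ito_integral P B H t J \<longleftrightarrow>
     J \<in> borel_measurable P \<and>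
     (\<forall>\<epsilon>>0. (\<lambda>n. measure P {\<omega> \<in> space P.
        \<epsilon> < \<bar>(\<Sum>i<Suc n. H (t * real i / real (Suc n)) \<omega> *
               (B (t * real (Suc i) / real (Suc n)) \<omega> - B (t * real i / real (Suc n)) \<omega>)) - J \<omega>\<bar>})
      \<longlonglongrightarrow> 0)"

text \<open>\<open>X\<close> is a (weak) solution of \<open>dX = - \<theta> (X - m) dt + sqrt (2 \<theta> b(X)) dB\<close>.\<close>

definition pearson_diffusion :: "'w measure \<Rightarrow> (real \<Rightarrow> 'w measure) \<Rightarrow> (real \<Rightarrow> 'w \<Rightarrow> real)
    \<Rightarrow> (real \<Rightarrow> 'w \<Rightarrow> real) \<Rightarrow> real \<Rightarrow> real \<Rightarrow> real poly \<Rightarrow> bool" where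
  "pearson_diffusion P \<F> B X \<theta> m b \<longleftrightarrow>
     prob_space P \<and>
     (\<forall>t\<ge>0. subalgebra P (\<F> t)) \<and> (\<forall>s\<ge>0. \<forall>t\<ge>s. subalgebra (\<F> t) (\<F> s)) \<and>
     brownian_motion P \<F> B \<and>
     (\<forall>t\<ge>0. X t \<in> borel_measurable (\<F> t)) \<and>
     (AE \<omega> in P. continuous_on {0..} (\<lambda>t. X t \<omega>)) \<and>
     (AE \<omega> in P. \<forall>t\<ge>0. 0 \<le> poly b (X t \<omega>)) \<and>
     (\<forall>t\<ge>0. \<exists>J. has_ito_integral P B (\<lambda>s \<omega>. sqrt (2 * \<theta> * poly b (X s \<omega>))) t J \<and>
        (AE \<omega> in P. X t \<omega> = X 0 \<omega> + integral {0..t} (\<lambda>s. - \<theta> * (X s \<omega> - m)) + J \<omega>))"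

text \<open>
  \<open>\<nu>\<close> is the invariant law of the diffusion, has mean \<open>m\<close> and is carried by the region where the
  diffusion is nondegenerate; the last condition excludes the point mass at \<open>m\<close>, which is trivially
  invariant when \<open>b(m) = 0\<close>.
\<close>

definition pearson_distribution :: "'w measure \<Rightarrow> (real \<Rightarrow> 'w measure) \<Rightarrow> (real \<Rightarrow> 'w \<Rightarrow> real)
    \<Rightarrow> (real \<Rightarrow> 'w \<Rightarrow> real) \<Rightarrow> real \<Rightarrow> real \<Rightarrow> real poly \<Rightarrow> real measure \<Rightarrow> bool" where
  "pearson_distribution P \<F> B X \<theta> m b \<nu> \<longleftrightarrow>
     pearson_diffusion P \<F> B X \<theta> m b \<and>
     (\<forall>t\<ge>0. distr P borel (X t) = \<nu>) \<and>
     integrable \<nu> (\<lambda>x. x) \<and> (\<integral>x. x \<partial>\<nu>) = m \<and>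
     (AE x in \<nu>. 0 < poly b x)"

definition quad_b :: "real \<Rightarrow> real \<Rightarrow> real \<Rightarrow> real poly" where
  "quad_b b0 b1 b2 = [:b0, b1, b2:]"

definition poly_Q :: "real \<Rightarrow> real \<Rightarrow> real \<Rightarrow> real \<Rightarrow> real poly" where
  "poly_Q m b0 b1 b2 =
     [: 1 / (b2 - 1) * (b0 + m * (b1 + m) / (2 * b2 - 1)), 2 * (b1 + m) / (2 * b2 - 1), 1 :]"

definition poly_U :: "real \<Rightarrow> real \<Rightarrow> real \<Rightarrow> real \<Rightarrow> real poly" where
  "poly_U m b0 b1 b2 =
     smult (1 - b2) ((poly_Q m b0 b1 b2)\<^sup>2)
     - smult (1 / 12) ((pderiv (poly_Q m b0 b1 b2)) ^ 3 * [:- m, 1:])"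

end

theory Submission
  imports Defs
begin

text \<open>
  Since \<open>L\<^sup>-\<^sup>1 G = - F / \<lambda>\<close>, the integrand is the square of
  \<open>W = \<Gamma>(F, F) / \<lambda> - b(G)\<close>, and \<open>2 \<Gamma>(F, F) = (L + 2 \<lambda>) F\<^sup>2\<close> turns this into
  \<open>2 \<lambda> W = (L + 2 (1 - b\<^sub>2) \<lambda>) Q(G)\<close>; the polynomial \<open>Q\<close> is chosen exactly so that the terms of
  degree at most one match. As \<open>Q(G)\<close> only has components in eigenspaces with \<open>0 \<le> \<kappa> \<le> \<eta> \<lambda>\<close>,
  one has \<open>\<integral> (L Q)\<^sup>2 \<le> - \<eta> \<lambda> \<integral> Q L Q\<close>, which bounds \<open>\<integral> W\<^sup>2\<close> by a combination of \<open>\<integral> Q L Q\<close> and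
  \<open>\<integral> Q\<^sup>2\<close>. Finally \<open>\<integral> F\<^sup>2 \<Gamma>(F, F) = \<lambda> / 3 \<integral> F\<^sup>4\<close>, integration by parts against \<open>F\<^sup>3\<close>, expresses
  \<open>\<integral> Q L Q\<close> through moments of \<open>F\<close>, and \<open>U\<close> collects the result.

  The analytic point is that \<open>F\<^sup>2\<close> lies in the domain of \<open>L\<close>. The identity for \<open>L F\<^sup>2\<close> is first proved
  against test functions in \<open>A0\<close>. The images under \<open>L\<close> of the finite eigenfunction sums approximating
  \<open>F\<^sup>2\<close> are bounded in \<open>L\<^sup>2\<close>, so this identifies their weak limit, and self-adjointness does the rest.
\<close>

section \<open>Square integrable functions\<close>

text \<open>\<open>F\<close> lies in the domain of \<open>L\<close> but is not assumed to lie in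
  \<open>A\<close>, so the product and chain rules do not apply to it directly: each identity is
  proved for approximants in \<open>A0\<close> and passed to the limit. Expanding about
  \<open>m\<close> turns \<open>Q(G)\<close> into \<open>h + q\<close> with
  \<open>h = F^2 + c F\<close>. Matching with \<open>b\<close> forces
  \<open>c = Q'(m) = - b'(m) / (1/2 - b2)\<close> and \<open>q = Q(m) = - b(m) / (1 - b2)\<close>,
  hence the denominators of \<open>Q\<close>. The cubic term of \<open>U\<close> has a formal
  origin: \<open>\<integral> h L h = - \<integral> h'(F)^2 \<Gamma>(F, F)\<close>, and as
  \<open>h'' = 2\<close>, \<open>h'^2\<close> is the derivative of \<open>h'^3 / 6\<close>, so by
  parts this is \<open>- lam / 6 \<integral> h'(F)^3 F\<close>. Division by \<open>2 lam\<close>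
  leaves the factor \<open>1 / 12\<close>. The two cases share one estimate: for every
  \<open>\<eta>\<close> the bound obtained equals the right-hand side of (b), and (a) drops a term
  that is then nonpositive.\<close>

lemma discriminant_bound:
  fixes a b c :: real
  assumes "\<And>t. 0 \<le> a + 2 * t * b + t\<^sup>2 * c"
  shows "b\<^sup>2 \<le> a * c"
proof -
  have a: "0 \<le> a" using assms[of 0] by simp
  show ?thesis
  proof (cases "c = 0")
    case True
    have "b = 0"
    proof (rule ccontr)
      assume "b \<noteq> 0"
      \<comment> \<open>At this point the expression, affine in \<open>t\<close> when
        \<open>c = 0\<close>, takes the value \<open>- 1\<close>.\<close>
      then have "2 * (- (a + 1) / (2 * b)) * b = - (a + 1)" by simp
      then show False using assms[of "- (a + 1) / (2 * b)"] True by simp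
    qed
    then show ?thesis using True by simp
  next
    case False
    have "0 \<le> c"
    proof (rule ccontr)
      assume "\<not> 0 \<le> c"
      then have c: "c < 0" by simp
      \<comment> \<open>The values at \<open>t\<close> and at \<open>- t\<close> add up to
        \<open>- 2\<close>, so one of them is negative.\<close>
      define t where "t = sqrt ((a + 1) / - c)"
      have "t\<^sup>2 * c = - (a + 1)" using a c by (simp add: t_def field_simps)
      then show False using assms[of t] assms[of "- t"] by simp
    qed
    then have c: "0 < c" using False by simp
    have "a + 2 * (- b / c) * b + (- b / c)\<^sup>2 * c = a - b\<^sup>2 / c"
      using c by (simp add: field_simps power2_eq_square)
    then have "b\<^sup>2 / c \<le> a" using assms[of "- b / c"] by simp
    then show ?thesis using c by (simp add: field_simps)
  qed
qed

lemma L2_measurable: "f \<in> L2 M \<Longrightarrow> f \<in> borel_measurable M"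
  by (simp add: L2_def)

lemma L2_integrable_mult:
  assumes "f \<in> L2 M" "g \<in> L2 M"
  shows "integrable M (\<lambda>x. f x * g x)"
proof (rule Bochner_Integration.integrable_bound)
  show "integrable M (\<lambda>x. (f x)\<^sup>2 + (g x)\<^sup>2)" using assms by (simp add: L2_def)
  show "(\<lambda>x. f x * g x) \<in> borel_measurable M"
    using assms[THEN L2_measurable] by simp
  have "\<bar>a * b\<bar> \<le> a\<^sup>2 + b\<^sup>2" for a b :: real
  proof -
    have "2 * \<bar>a * b\<bar> \<le> a\<^sup>2 + b\<^sup>2"
      using sum_squares_bound[of "\<bar>a\<bar>" "\<bar>b\<bar>"] by (simp add: abs_mult)
    moreover have "0 \<le> \<bar>a * b\<bar>" by simp
    ultimately show ?thesis by linarith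
  qed
  then show "AE x in M. norm (f x * g x) \<le> norm ((f x)\<^sup>2 + (g x)\<^sup>2)" by simp
qed

lemma L2_lincomb:
  assumes "f \<in> L2 M" "g \<in> L2 M"
  shows "(\<lambda>x. c * f x + d * g x) \<in> L2 M"
proof -
  have "integrable M (\<lambda>x. c\<^sup>2 * (f x)\<^sup>2 + 2 * c * d * (f x * g x) + d\<^sup>2 * (g x)\<^sup>2)"
    using assms L2_integrable_mult[OF assms] by (simp add: L2_def)
  moreover have "(c * f x + d * g x)\<^sup>2 = c\<^sup>2 * (f x)\<^sup>2 + 2 * c * d * (f x * g x) + d\<^sup>2 * (g x)\<^sup>2" for x
    by (simp add: algebra_simps power2_eq_square)
  moreover have "(\<lambda>x. c * f x + d * g x) \<in> borel_measurable M"
    using assms[THEN L2_measurable] by simp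
  ultimately show ?thesis by (simp add: L2_def)
qed

lemma L2_add: "f \<in> L2 M \<Longrightarrow> g \<in> L2 M \<Longrightarrow> (\<lambda>x. f x + g x) \<in> L2 M"
  using L2_lincomb[of f M g 1 1] by simp

lemma L2_diff: "f \<in> L2 M \<Longrightarrow> g \<in> L2 M \<Longrightarrow> (\<lambda>x. f x - g x) \<in> L2 M"
  using L2_lincomb[of f M g 1 "- 1"] by simp

lemma L2_cmult: "f \<in> L2 M \<Longrightarrow> (\<lambda>x. c * f x) \<in> L2 M"
  using L2_lincomb[of f M f c 0] by simp

lemma L2_sum:
  assumes "finite J" "\<And>i. i \<in> J \<Longrightarrow> f i \<in> L2 M"
  shows "(\<lambda>x. \<Sum>i\<in>J. f i x) \<in> L2 M"
  using assms
proof (induction J rule: finite_induct)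
  case empty
  then show ?case by (simp add: L2_def)
next
  case (insert i J)
  then show ?case by (simp add: L2_add)
qed

lemma L2_mult_bounded:
  assumes f: "f \<in> L2 M" and g: "g \<in> borel_measurable M" "AE x in M. \<bar>g x\<bar> \<le> c"
  shows "(\<lambda>x. f x * g x) \<in> L2 M"
proof -
  have fg: "(\<lambda>x. f x * g x) \<in> borel_measurable M"
    using L2_measurable[OF f] g by simp
  have "integrable M (\<lambda>x. (f x * g x)\<^sup>2)"
  proof (rule Bochner_Integration.integrable_bound)
    show "integrable M (\<lambda>x. c\<^sup>2 * (f x)\<^sup>2)" using f by (simp add: L2_def)
    show "(\<lambda>x. (f x * g x)\<^sup>2) \<in> borel_measurable M" using fg by simp
    show "AE x in M. norm ((f x * g x)\<^sup>2) \<le> norm (c\<^sup>2 * (f x)\<^sup>2)"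
      using g(2)
    proof eventually_elim
      case (elim x)
      then have "(g x)\<^sup>2 \<le> c\<^sup>2" by (metis abs_ge_zero power2_abs power_mono)
      then have "(f x)\<^sup>2 * (g x)\<^sup>2 \<le> (f x)\<^sup>2 * c\<^sup>2" by (simp add: mult_left_mono)
      then show ?case by (simp add: power_mult_distrib mult.commute)
    qed
  qed
  then show ?thesis using fg by (simp add: L2_def)
qed

lemma L2_norm_nonneg: "0 \<le> L2_norm M f"
  by (simp add: L2_norm_def)

lemma L2_norm_sq: "(L2_norm M f)\<^sup>2 = (\<integral>x. (f x)\<^sup>2 \<partial>M)"
  by (simp add: L2_norm_def)

lemma L2_norm_cmult: "L2_norm M (\<lambda>x. c * f x) = \<bar>c\<bar> * L2_norm M f"
  by (simp add: L2_norm_def power_mult_distrib real_sqrt_mult)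

lemma L2_norm_minus_commute: "L2_norm M (\<lambda>x. f x - g x) = L2_norm M (\<lambda>x. g x - f x)"
  by (simp add: L2_norm_def power2_commute)

lemma L2_Cauchy_Schwarz:
  assumes "f \<in> L2 M" "g \<in> L2 M"
  shows "\<bar>\<integral>x. f x * g x \<partial>M\<bar> \<le> L2_norm M f * L2_norm M g"
proof -
  have "(\<integral>x. f x * g x \<partial>M)\<^sup>2 \<le> (\<integral>x. (f x)\<^sup>2 \<partial>M) * (\<integral>x. (g x)\<^sup>2 \<partial>M)"
  proof (rule discriminant_bound)
    fix t
    have "0 \<le> (\<integral>x. (f x + t * g x)\<^sup>2 \<partial>M)" by simp
    also have "\<dots> = (\<integral>x. (f x)\<^sup>2 + 2 * t * (f x * g x) + t\<^sup>2 * (g x)\<^sup>2 \<partial>M)"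
      by (rule Bochner_Integration.integral_cong) (auto simp: algebra_simps power2_eq_square)
    also have "\<dots> = (\<integral>x. (f x)\<^sup>2 \<partial>M) + 2 * t * (\<integral>x. f x * g x \<partial>M) + t\<^sup>2 * (\<integral>x. (g x)\<^sup>2 \<partial>M)"
      using assms L2_integrable_mult[OF assms] by (simp add: L2_def)
    finally show "0 \<le> \<dots>" .
  qed
  also have "\<dots> = (L2_norm M f * L2_norm M g)\<^sup>2" by (simp add: power_mult_distrib L2_norm_sq)
  finally show ?thesis
    using L2_norm_nonneg[of M f] L2_norm_nonneg[of M g] by (metis abs_le_square_iff abs_of_nonneg mult_nonneg_nonneg)
qed

lemma L2_norm_triangle:
  assumes "f \<in> L2 M" "g \<in> L2 M"
  shows "L2_norm M (\<lambda>x. f x + g x) \<le> L2_norm M f + L2_norm M g"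
proof (rule power2_le_imp_le)
  have "(L2_norm M (\<lambda>x. f x + g x))\<^sup>2 = (\<integral>x. (f x)\<^sup>2 + 2 * (f x * g x) + (g x)\<^sup>2 \<partial>M)"
    unfolding L2_norm_sq
    by (rule Bochner_Integration.integral_cong) (auto simp: algebra_simps power2_eq_square)
  also have "\<dots> = (\<integral>x. (f x)\<^sup>2 \<partial>M) + 2 * (\<integral>x. f x * g x \<partial>M) + (\<integral>x. (g x)\<^sup>2 \<partial>M)"
    using assms L2_integrable_mult[OF assms] by (simp add: L2_def)
  also have "\<dots> \<le> (L2_norm M f)\<^sup>2 + 2 * (L2_norm M f * L2_norm M g) + (L2_norm M g)\<^sup>2"
    using L2_Cauchy_Schwarz[OF assms] by (simp add: L2_norm_sq)
  finally show "(L2_norm M (\<lambda>x. f x + g x))\<^sup>2 \<le> (L2_norm M f + L2_norm M g)\<^sup>2"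
    by (simp add: power2_sum)
qed (simp add: L2_norm_nonneg)

lemma L2_tendsto_mult:
  assumes f: "\<And>n. fs n \<in> L2 M" "f \<in> L2 M" "(\<lambda>n. L2_norm M (\<lambda>x. fs n x - f x)) \<longlonglongrightarrow> 0"
    and g: "\<And>n. gs n \<in> L2 M" "g \<in> L2 M" "(\<lambda>n. L2_norm M (\<lambda>x. gs n x - g x)) \<longlonglongrightarrow> 0"
  shows "(\<lambda>n. \<integral>x. fs n x * gs n x \<partial>M) \<longlonglongrightarrow> (\<integral>x. f x * g x \<partial>M)"
proof -
  let ?a = "\<lambda>n. L2_norm M (\<lambda>x. fs n x - f x)" and ?b = "\<lambda>n. L2_norm M (\<lambda>x. gs n x - g x)"
  have "(\<lambda>n. (\<integral>x. fs n x * gs n x \<partial>M) - (\<integral>x. f x * g x \<partial>M)) \<longlonglongrightarrow> 0"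
  proof (rule Lim_null_comparison[OF always_eventually])
    show "\<forall>n. norm ((\<integral>x. fs n x * gs n x \<partial>M) - (\<integral>x. f x * g x \<partial>M))
        \<le> ?a n * ?b n + ?a n * L2_norm M g + L2_norm M f * ?b n"
    proof
      fix n
      have "(\<integral>x. fs n x * gs n x \<partial>M) - (\<integral>x. f x * g x \<partial>M)
          = (\<integral>x. (fs n x - f x) * (gs n x - g x) \<partial>M) + (\<integral>x. (fs n x - f x) * g x \<partial>M)
            + (\<integral>x. f x * (gs n x - g x) \<partial>M)"
        using L2_integrable_mult[OF f(1) g(1), of n n] L2_integrable_mult[OF f(2) g(1), of n]
          L2_integrable_mult[OF f(1) g(2), of n] L2_integrable_mult[OF f(2) g(2)]
        by (simp add: algebra_simps)
      then show "norm ((\<integral>x. fs n x * gs n x \<partial>M) - (\<integral>x. f x * g x \<partial>M))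
          \<le> ?a n * ?b n + ?a n * L2_norm M g + L2_norm M f * ?b n"
        using L2_Cauchy_Schwarz[OF L2_diff[OF f(1,2)] L2_diff[OF g(1,2)], of n n]
          L2_Cauchy_Schwarz[OF L2_diff[OF f(1,2)] g(2), of n]
          L2_Cauchy_Schwarz[OF f(2) L2_diff[OF g(1,2)], of n]
        by simp
    qed
    show "(\<lambda>n. ?a n * ?b n + ?a n * L2_norm M g + L2_norm M f * ?b n) \<longlonglongrightarrow> 0"
      by (rule tendsto_eq_intros f(3) g(3) refl | simp)+
  qed
  then show ?thesis by (simp add: LIM_zero_iff)
qed

lemma L2_tendsto_mult_bounded:
  assumes f: "\<And>n. fs n \<in> L2 M" "f \<in> L2 M" "(\<lambda>n. L2_norm M (\<lambda>x. fs n x - f x)) \<longlonglongrightarrow> 0"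
    and g: "g \<in> borel_measurable M" "AE x in M. \<bar>g x\<bar> \<le> c"
  shows "(\<lambda>n. L2_norm M (\<lambda>x. fs n x * g x - f x * g x)) \<longlonglongrightarrow> 0"
proof (rule Lim_null_comparison[OF always_eventually])
  show "\<forall>n. norm (L2_norm M (\<lambda>x. fs n x * g x - f x * g x)) \<le> \<bar>c\<bar> * L2_norm M (\<lambda>x. fs n x - f x)"
  proof
    fix n
    have "(\<integral>x. (fs n x * g x - f x * g x)\<^sup>2 \<partial>M) \<le> (\<integral>x. c\<^sup>2 * (fs n x - f x)\<^sup>2 \<partial>M)"
    proof (rule integral_mono_AE)
      have "(\<lambda>x. (fs n x - f x) * g x) \<in> L2 M" by (rule L2_mult_bounded[OF L2_diff[OF f(1,2)] g])
      then show "integrable M (\<lambda>x. (fs n x * g x - f x * g x)\<^sup>2)" by (simp add: L2_def left_diff_distrib)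
      show "integrable M (\<lambda>x. c\<^sup>2 * (fs n x - f x)\<^sup>2)" using L2_diff[OF f(1,2), of n] by (simp add: L2_def)
      show "AE x in M. (fs n x * g x - f x * g x)\<^sup>2 \<le> c\<^sup>2 * (fs n x - f x)\<^sup>2"
        using g(2)
      proof eventually_elim
        case (elim x)
        then have "(g x)\<^sup>2 \<le> c\<^sup>2" by (metis abs_ge_zero power2_abs power_mono)
        then have "(fs n x - f x)\<^sup>2 * (g x)\<^sup>2 \<le> (fs n x - f x)\<^sup>2 * c\<^sup>2"
          by (simp add: mult_left_mono)
        then show ?case
          by (simp only: left_diff_distrib[symmetric] power_mult_distrib mult.commute[of "c\<^sup>2"])
      qed
    qed
    also have "\<dots> = (\<bar>c\<bar> * L2_norm M (\<lambda>x. fs n x - f x))\<^sup>2"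
      by (simp add: power_mult_distrib L2_norm_sq)
    finally have "(L2_norm M (\<lambda>x. fs n x * g x - f x * g x))\<^sup>2 \<le> \<dots>" by (simp add: L2_norm_sq)
    then have "L2_norm M (\<lambda>x. fs n x * g x - f x * g x) \<le> \<bar>c\<bar> * L2_norm M (\<lambda>x. fs n x - f x)"
      by (rule power2_le_imp_le) (simp add: L2_norm_nonneg)
    then show "norm (L2_norm M (\<lambda>x. fs n x * g x - f x * g x)) \<le> \<bar>c\<bar> * L2_norm M (\<lambda>x. fs n x - f x)"
      by (simp add: L2_norm_nonneg)
  qed
  show "(\<lambda>n. \<bar>c\<bar> * L2_norm M (\<lambda>x. fs n x - f x)) \<longlonglongrightarrow> 0"
    by (rule tendsto_eq_intros f(3) refl | simp)+
qed

lemma L2_const: "finite_measure M \<Longrightarrow> (\<lambda>x. c) \<in> L2 M"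
  by (simp add: L2_def finite_measure.integrable_const)

lemma L2_integrable:
  assumes "finite_measure M" "f \<in> L2 M"
  shows "integrable M f"
  using L2_integrable_mult[OF assms(2) L2_const[OF assms(1), of 1]] by simp

text \<open>Cauchy-Schwarz against the constant \<open>1\<close> turns convergence in
  \<open>L2\<close> into convergence in mean, which yields the subsequence.\<close>

lemma (in finite_measure) L2_tendsto_AE_subseq:
  assumes f: "\<And>n. fs n \<in> L2 M" "f \<in> L2 M" "(\<lambda>n. L2_norm M (\<lambda>x. fs n x - f x)) \<longlonglongrightarrow> 0"
  shows "\<exists>r::nat\<Rightarrow>nat. strict_mono r \<and> (AE x in M. (\<lambda>n. fs (r n) x) \<longlonglongrightarrow> f x)"
proof -
  have d: "(\<lambda>x. fs n x - f x) \<in> L2 M" for n by (rule L2_diff[OF f(1,2)])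
  then have d': "(\<lambda>x. \<bar>fs n x - f x\<bar>) \<in> L2 M" for n
    using borel_measurable_abs[OF L2_measurable[OF d]] by (simp add: L2_def)
  have fm: "finite_measure M" by (rule finite_measure_axioms)
  have i: "integrable M (\<lambda>x. fs n x - f x)" for n by (rule L2_integrable[OF fm d])
  have "(\<lambda>n. \<integral>x. norm (fs n x - f x) \<partial>M) \<longlonglongrightarrow> 0"
  proof (rule Lim_null_comparison[OF always_eventually])
    show "\<forall>n. norm (\<integral>x. norm (fs n x - f x) \<partial>M)
        \<le> L2_norm M (\<lambda>x. fs n x - f x) * L2_norm M (\<lambda>x. 1)"
    proof
      fix n
      show "norm (\<integral>x. norm (fs n x - f x) \<partial>M) \<le> L2_norm M (\<lambda>x. fs n x - f x) * L2_norm M (\<lambda>x. 1)"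
        using L2_Cauchy_Schwarz[OF d' L2_const[OF fm, of 1], of n] by (simp add: L2_norm_def)
    qed
    show "(\<lambda>n. L2_norm M (\<lambda>x. fs n x - f x) * L2_norm M (\<lambda>x. 1)) \<longlonglongrightarrow> 0"
      by (rule tendsto_eq_intros f(3) refl | simp)+
  qed
  from tendsto_L1_AE_subseq[OF i this] obtain r :: "nat \<Rightarrow> nat"
    where r: "strict_mono r" "AE x in M. (\<lambda>n. fs (r n) x - f x) \<longlonglongrightarrow> 0" by auto
  from r(2) have "AE x in M. (\<lambda>n. fs (r n) x) \<longlonglongrightarrow> f x"
    by eventually_elim (simp add: LIM_zero_iff)
  with r(1) show ?thesis by blast
qed

section \<open>Limits in mean\<close>

text \<open>The negative part of \<open>u\<close> is at most its distance to any nonnegative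
  \<open>us n\<close>, so its integral vanishes in the limit.\<close>

lemma L1_limit_nonneg:
  fixes u :: "'a \<Rightarrow> real"
  assumes u: "integrable M u" "\<And>n. integrable M (us n)" "(\<lambda>n. \<integral>x. \<bar>us n x - u x\<bar> \<partial>M) \<longlonglongrightarrow> 0"
    and nonneg: "\<And>n. AE x in M. 0 \<le> us n x"
  shows "AE x in M. 0 \<le> u x"
proof -
  have "(\<integral>x. max (- u x) 0 \<partial>M) \<le> (\<integral>x. \<bar>us n x - u x\<bar> \<partial>M)" for n
  proof (rule integral_mono_AE)
    show "AE x in M. max (- u x) 0 \<le> \<bar>us n x - u x\<bar>"
      using nonneg[of n] by eventually_elim auto
  qed (use u in auto)
  then have "(\<integral>x. max (- u x) 0 \<partial>M) \<le> 0"
    by (intro tendsto_lowerbound[OF u(3)]) auto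
  moreover have "0 \<le> (\<integral>x. max (- u x) 0 \<partial>M)" by simp
  ultimately have "(\<integral>x. max (- u x) 0 \<partial>M) = 0" by simp
  then have "AE x in M. max (- u x) 0 = 0"
    by (subst (asm) integral_nonneg_eq_0_iff_AE) (use u in auto)
  then show ?thesis by eventually_elim auto
qed

text \<open>This is how almost everywhere identities for \<open>\<Gamma>\<close> travel from
  \<open>A0\<close> to the form domain: both sides are limits in mean along approximating sequences
  on which they already agree.\<close>

lemma L1_limit_unique:
  fixes u v :: "'a \<Rightarrow> real"
  assumes u: "integrable M u" "\<And>n. integrable M (us n)" "(\<lambda>n. \<integral>x. \<bar>us n x - u x\<bar> \<partial>M) \<longlonglongrightarrow> 0"
    and v: "integrable M v" "\<And>n. integrable M (vs n)" "(\<lambda>n. \<integral>x. \<bar>vs n x - v x\<bar> \<partial>M) \<longlonglongrightarrow> 0"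
    and eq: "\<And>n. AE x in M. us n x = vs n x"
  shows "AE x in M. u x = v x"
proof -
  have "(\<integral>x. \<bar>u x - v x\<bar> \<partial>M) \<le> (\<integral>x. \<bar>us n x - u x\<bar> \<partial>M) + (\<integral>x. \<bar>vs n x - v x\<bar> \<partial>M)" for n
  proof -
    have "(\<integral>x. \<bar>u x - v x\<bar> \<partial>M) \<le> (\<integral>x. \<bar>us n x - u x\<bar> + \<bar>vs n x - v x\<bar> \<partial>M)"
    proof (rule integral_mono_AE)
      show "AE x in M. \<bar>u x - v x\<bar> \<le> \<bar>us n x - u x\<bar> + \<bar>vs n x - v x\<bar>"
        using eq[of n] by eventually_elim auto
    qed (use u v in auto)
    then show ?thesis using u v by simp
  qed
  moreover have "(\<lambda>n. (\<integral>x. \<bar>us n x - u x\<bar> \<partial>M) + (\<integral>x. \<bar>vs n x - v x\<bar> \<partial>M)) \<longlonglongrightarrow> 0"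
    using tendsto_add[OF u(3) v(3)] by simp
  ultimately have "(\<integral>x. \<bar>u x - v x\<bar> \<partial>M) \<le> 0"
    by (intro tendsto_lowerbound[where F = sequentially]) auto
  moreover have "0 \<le> (\<integral>x. \<bar>u x - v x\<bar> \<partial>M)" by simp
  ultimately have "(\<integral>x. \<bar>u x - v x\<bar> \<partial>M) = 0" by simp
  then have "AE x in M. \<bar>u x - v x\<bar> = 0"
    by (subst (asm) integral_nonneg_eq_0_iff_AE) (use u v in auto)
  then show ?thesis by eventually_elim auto
qed

lemma L1_limit_integral:
  fixes u :: "'a \<Rightarrow> real"
  assumes u: "integrable M u" "\<And>n. integrable M (us n)" "(\<lambda>n. \<integral>x. \<bar>us n x - u x\<bar> \<partial>M) \<longlonglongrightarrow> 0"
  shows "(\<lambda>n. \<integral>x. us n x \<partial>M) \<longlonglongrightarrow> (\<integral>x. u x \<partial>M)"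
proof -
  have "(\<lambda>n. (\<integral>x. us n x \<partial>M) - (\<integral>x. u x \<partial>M)) \<longlonglongrightarrow> 0"
  proof (rule Lim_null_comparison[OF always_eventually u(3)], rule allI)
    fix n
    have "(\<integral>x. us n x \<partial>M) - (\<integral>x. u x \<partial>M) = (\<integral>x. us n x - u x \<partial>M)" using u by simp
    then show "norm ((\<integral>x. us n x \<partial>M) - (\<integral>x. u x \<partial>M)) \<le> (\<integral>x. \<bar>us n x - u x\<bar> \<partial>M)"
      by simp
  qed
  then show ?thesis by (simp add: LIM_zero_iff)
qed

lemma L1_limit_lincomb:
  fixes u v :: "'a \<Rightarrow> real"
  assumes u: "integrable M u" "\<And>n. integrable M (us n)" "(\<lambda>n. \<integral>x. \<bar>us n x - u x\<bar> \<partial>M) \<longlonglongrightarrow> 0"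
    and v: "integrable M v" "\<And>n. integrable M (vs n)" "(\<lambda>n. \<integral>x. \<bar>vs n x - v x\<bar> \<partial>M) \<longlonglongrightarrow> 0"
  shows "(\<lambda>n. \<integral>x. \<bar>(c * us n x + d * vs n x) - (c * u x + d * v x)\<bar> \<partial>M) \<longlonglongrightarrow> 0"
proof (rule Lim_null_comparison[OF always_eventually])
  show "\<forall>n. norm (\<integral>x. \<bar>(c * us n x + d * vs n x) - (c * u x + d * v x)\<bar> \<partial>M)
     \<le> \<bar>c\<bar> * (\<integral>x. \<bar>us n x - u x\<bar> \<partial>M) + \<bar>d\<bar> * (\<integral>x. \<bar>vs n x - v x\<bar> \<partial>M)"
  proof
    fix n
    have "(\<integral>x. \<bar>(c * us n x + d * vs n x) - (c * u x + d * v x)\<bar> \<partial>M)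
      \<le> (\<integral>x. \<bar>c\<bar> * \<bar>us n x - u x\<bar> + \<bar>d\<bar> * \<bar>vs n x - v x\<bar> \<partial>M)"
    proof (rule integral_mono)
      fix x
      have "(c * us n x + d * vs n x) - (c * u x + d * v x) = c * (us n x - u x) + d * (vs n x - v x)"
        by (simp add: algebra_simps)
      then show "\<bar>(c * us n x + d * vs n x) - (c * u x + d * v x)\<bar> \<le> \<bar>c\<bar> * \<bar>us n x - u x\<bar> + \<bar>d\<bar> * \<bar>vs n x - v x\<bar>"
        by (metis abs_mult abs_triangle_ineq)
    qed (use u v in auto)
    then show "norm (\<integral>x. \<bar>(c * us n x + d * vs n x) - (c * u x + d * v x)\<bar> \<partial>M)
       \<le> \<bar>c\<bar> * (\<integral>x. \<bar>us n x - u x\<bar> \<partial>M) + \<bar>d\<bar> * (\<integral>x. \<bar>vs n x - v x\<bar> \<partial>M)"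
      using u v by simp
  qed
  show "(\<lambda>n. \<bar>c\<bar> * (\<integral>x. \<bar>us n x - u x\<bar> \<partial>M) + \<bar>d\<bar> * (\<integral>x. \<bar>vs n x - v x\<bar> \<partial>M)) \<longlonglongrightarrow> 0"
    by (rule tendsto_eq_intros u(3) v(3) refl | simp)+
qed

text \<open>The two kinds of convergence are separated: \<open>gs n * (us n - u)\<close> is small by
  the uniform bound on \<open>gs n\<close>, and \<open>gs n * u\<close> converges by domination with
  \<open>\<bar>c\<bar> * \<bar>u\<bar>\<close>.\<close>

lemma L1_limit_mult_bounded:
  fixes u :: "'a \<Rightarrow> real"
  assumes u: "integrable M u" "\<And>n. integrable M (us n)" "(\<lambda>n. \<integral>x. \<bar>us n x - u x\<bar> \<partial>M) \<longlonglongrightarrow> 0"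
    and g: "\<And>n. gs n \<in> borel_measurable M" "g \<in> borel_measurable M"
      "\<And>n. AE x in M. \<bar>gs n x\<bar> \<le> c" "AE x in M. (\<lambda>n. gs n x) \<longlonglongrightarrow> g x"
  shows "(\<lambda>n. \<integral>x. gs n x * us n x \<partial>M) \<longlonglongrightarrow> (\<integral>x. g x * u x \<partial>M)"
proof -
  have int: "integrable M (\<lambda>x. gs n x * w x)" if "integrable M w" for w n
  proof (rule Bochner_Integration.integrable_bound)
    show "integrable M (\<lambda>x. c * w x)" using that by simp
    show "(\<lambda>x. gs n x * w x) \<in> borel_measurable M" using that g by simp
    show "AE x in M. norm (gs n x * w x) \<le> norm (c * w x)"
      using g(3)[of n] by eventually_elim (simp add: abs_mult mult_right_mono)
  qed
  have "(\<lambda>n. \<integral>x. gs n x * (us n x - u x) \<partial>M) \<longlonglongrightarrow> 0"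
  proof (rule Lim_null_comparison[OF always_eventually])
    show "\<forall>n. norm (\<integral>x. gs n x * (us n x - u x) \<partial>M) \<le> \<bar>c\<bar> * (\<integral>x. \<bar>us n x - u x\<bar> \<partial>M)"
    proof
      fix n
      have "norm (\<integral>x. gs n x * (us n x - u x) \<partial>M) \<le> (\<integral>x. norm (gs n x * (us n x - u x)) \<partial>M)"
        by (rule integral_norm_bound)
      also have "\<dots> \<le> (\<integral>x. \<bar>c\<bar> * \<bar>us n x - u x\<bar> \<partial>M)"
      proof (rule integral_mono_AE)
        show "AE x in M. norm (gs n x * (us n x - u x)) \<le> \<bar>c\<bar> * \<bar>us n x - u x\<bar>"
          using g(3)[of n] by eventually_elim (simp add: abs_mult mult_right_mono)
      qed (use u int in auto)
      finally show "norm (\<integral>x. gs n x * (us n x - u x) \<partial>M) \<le> \<bar>c\<bar> * (\<integral>x. \<bar>us n x - u x\<bar> \<partial>M)" by simp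
    qed
    show "(\<lambda>n. \<bar>c\<bar> * (\<integral>x. \<bar>us n x - u x\<bar> \<partial>M)) \<longlonglongrightarrow> 0"
      by (rule tendsto_eq_intros u(3) refl | simp)+
  qed
  moreover have "(\<lambda>n. \<integral>x. gs n x * u x \<partial>M) \<longlonglongrightarrow> (\<integral>x. g x * u x \<partial>M)"
  proof (rule integral_dominated_convergence[where w = "\<lambda>x. \<bar>c\<bar> * \<bar>u x\<bar>"])
    show "AE x in M. (\<lambda>n. gs n x * u x) \<longlonglongrightarrow> g x * u x"
      using g(4) by eventually_elim (intro tendsto_intros)
    show "AE x in M. norm (gs n x * u x) \<le> \<bar>c\<bar> * \<bar>u x\<bar>" for n
      using g(3)[of n] by eventually_elim (simp add: abs_mult mult_right_mono)
  qed (use u g in auto)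
  ultimately have "(\<lambda>n. (\<integral>x. gs n x * (us n x - u x) \<partial>M) + (\<integral>x. gs n x * u x \<partial>M)) \<longlonglongrightarrow> 0 + (\<integral>x. g x * u x \<partial>M)"
    by (rule tendsto_add)
  then show ?thesis using int u by (simp add: right_diff_distrib)
qed

section \<open>Smooth functions of one variable\<close>

text \<open>The derivatives of all orders are supplied as a sequence \<open>D\<close>. Every
  admissible index is \<open>0\<close>, so an iterated partial derivative depends only on the length
  of the index list and is computed by induction on it.\<close>

lemma smooth_fun_1I:
  fixes D :: "nat \<Rightarrow> real \<Rightarrow> real"
  assumes D: "\<And>k x. (D k has_real_derivative D (Suc k) x) (at x)"
  shows "smooth_fun 1 (\<lambda>v. D 0 (v 0))"
    and "partial_deriv 0 (\<lambda>v. D 0 (v 0)) = (\<lambda>v. D 1 (v 0))"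
proof -
  have pd: "partial_deriv 0 (\<lambda>v. D k (v 0)) = (\<lambda>v. D (Suc k) (v 0))" for k
    by (rule ext) (simp add: partial_deriv_def DERIV_imp_deriv[OF D])
  show "partial_deriv 0 (\<lambda>v. D 0 (v 0)) = (\<lambda>v. D 1 (v 0))" by (simp add: pd)
  have iter: "set is \<subseteq> {..<1} \<Longrightarrow> foldr partial_deriv is (\<lambda>v. D 0 (v 0)) = (\<lambda>v. D (length is) (v 0))"
    for "is" :: "nat list"
    by (induction "is") (simp_all add: pd)
  have cont: "continuous_on UNIV (\<lambda>v :: nat \<Rightarrow> real. D k (v 0))" for k
  proof (rule continuous_on_compose2[where t = UNIV and g = "D k"])
    show "continuous_on UNIV (D k)"
      using D[THEN DERIV_isCont] by (auto simp: continuous_on_eq_continuous_at)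
  qed (auto intro: continuous_on_product_coordinates)
  have diff: "(\<lambda>t. D k t) differentiable at x" for k x
    using D real_differentiable_def by blast
  show "smooth_fun 1 (\<lambda>v. D 0 (v 0))"
    unfolding smooth_fun_def by (auto simp: iter cont diff)
qed

lemma smooth_fun_square:
  "smooth_fun 1 (\<lambda>v. (v 0)\<^sup>2)"
  "partial_deriv 0 (\<lambda>v. (v 0)\<^sup>2) = (\<lambda>v. 2 * v 0)"
proof -
  let ?D = "\<lambda>k x. if k = 0 then x\<^sup>2 else if k = 1 then 2 * x else if k = (2::nat) then 2 else (0::real)"
  have "((?D k) has_real_derivative ?D (Suc k) x) (at x)" for k x
    by (cases "k = 0 \<or> k = 1 \<or> k = 2") (auto intro!: derivative_eq_intros)
  note s = smooth_fun_1I[of ?D, OF this]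
  show "smooth_fun 1 (\<lambda>v. (v 0)\<^sup>2)" using s(1) by simp
  show "partial_deriv 0 (\<lambda>v. (v 0)\<^sup>2) = (\<lambda>v. 2 * v 0)" using s(2) by simp
qed

text \<open>Differentiating a sine shifts its phase by a quarter period, which gives a single closed
  form for all orders, in the shape that \<open>smooth_fun_1I\<close> takes as input.\<close>

lemma has_derivative_sin_shift:
  "((\<lambda>x. \<alpha> ^ k * sin (\<alpha> * x + real k * (pi / 2)))
      has_real_derivative \<alpha> ^ Suc k * sin (\<alpha> * x + real (Suc k) * (pi / 2))) (at x)"
proof -
  have "sin (\<alpha> * x + real (Suc k) * (pi / 2)) = sin ((\<alpha> * x + real k * (pi / 2)) + pi / 2)"
    by (simp add: algebra_simps add_divide_distrib)
  also have "\<dots> = cos (\<alpha> * x + real k * (pi / 2))" by (simp only: sin_add) simp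
  finally have e: "sin (\<alpha> * x + real (Suc k) * (pi / 2)) = cos (\<alpha> * x + real k * (pi / 2))" .
  show ?thesis unfolding e by (auto intro!: derivative_eq_intros)
qed

lemma smooth_fun_sin: "smooth_fun 1 (\<lambda>v. sin (v 0))"
  using smooth_fun_1I(1)[of "\<lambda>k x. 1 ^ k * sin (1 * x + real k * (pi / 2))", OF has_derivative_sin_shift]
  by simp

text \<open>Linearising the cube makes all its derivatives combinations of phase-shifted
  sines.\<close>

lemma sin_cubed: "(sin x) ^ 3 = (3 * sin x - sin (3 * x)) / (4 :: real)"
proof -
  have "sin (3 * x) = sin (2 * x + x)" by simp
  also have "\<dots> = 2 * sin x * (cos x)\<^sup>2 + (1 - 2 * (sin x)\<^sup>2) * sin x"
    by (simp only: sin_add sin_double cos_double_sin power2_eq_square mult.assoc)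
  also have "\<dots> = 3 * sin x - 4 * sin x ^ 3"
    unfolding cos_squared_eq by algebra
  finally show ?thesis by simp
qed

text \<open>This is a bounded smooth substitute for the cube: it vanishes at \<open>0\<close>, so
  composition with it preserves \<open>A0\<close>, and it tends to the cube as \<open>c\<close>
  grows. The frequencies \<open>1 / c\<close> and \<open>3 / c\<close> in the proof come from
  \<open>sin_cubed\<close>.\<close>

lemma smooth_fun_sin_cubed:
  fixes c :: real
  assumes "c \<noteq> 0"
  shows "smooth_fun 1 (\<lambda>v. c ^ 3 * sin (v 0 / c) ^ 3)"
    and "partial_deriv 0 (\<lambda>v. c ^ 3 * sin (v 0 / c) ^ 3) = (\<lambda>v. 3 * c\<^sup>2 * sin (v 0 / c) ^ 2 * cos (v 0 / c))"
proof -
  let ?s = "\<lambda>\<alpha> k x. \<alpha> ^ k * sin (\<alpha> * x + real k * (pi / 2))"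
  let ?D = "\<lambda>k x. 3 * c ^ 3 / 4 * ?s (1 / c) k x - c ^ 3 / 4 * ?s (3 / c) k x"
  have "((?D k) has_real_derivative ?D (Suc k) x) (at x)" for k x
    by (intro DERIV_diff DERIV_cmult has_derivative_sin_shift)
  note s = smooth_fun_1I[of ?D, OF this]
  have e: "?D 0 x = c ^ 3 * sin (x / c) ^ 3" for x by (simp add: sin_cubed field_simps)
  show sm: "smooth_fun 1 (\<lambda>v. c ^ 3 * sin (v 0 / c) ^ 3)" using s(1) unfolding e .
  show "partial_deriv 0 (\<lambda>v. c ^ 3 * sin (v 0 / c) ^ 3) = (\<lambda>v. 3 * c\<^sup>2 * sin (v 0 / c) ^ 2 * cos (v 0 / c))"
  proof
    fix v :: "nat \<Rightarrow> real"
    have "((\<lambda>t. c ^ 3 * sin (t / c) ^ 3) has_real_derivative 3 * c\<^sup>2 * sin (x / c) ^ 2 * cos (x / c)) (at x)" for x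
      using assms by (auto intro!: derivative_eq_intros simp: field_simps power2_eq_square power3_eq_cube)
    then show "partial_deriv 0 (\<lambda>v. c ^ 3 * sin (v 0 / c) ^ 3) v = 3 * c\<^sup>2 * sin (v 0 / c) ^ 2 * cos (v 0 / c)"
      by (simp add: partial_deriv_def DERIV_imp_deriv)
  qed
qed

section \<open>Carre du champ and generator on their domains\<close>

context markov_setting
begin

abbreviation "form_dom \<equiv> dom_form M A0 \<Gamma>"
abbreviation "gen_dom \<equiv> dom_gen M A0 \<Gamma>"
abbreviation "form \<equiv> dform M \<Gamma>"
abbreviation "approx \<equiv> form_approx M A0 \<Gamma>"

lemma A0_A: "F \<in> A0 \<Longrightarrow> F \<in> A"
  using A0_subset by blast

lemma A0_measurable: "F \<in> A0 \<Longrightarrow> F \<in> borel_measurable M"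
  using A_measurable A0_A by blast

lemma A0_mult: "F \<in> A0 \<Longrightarrow> G \<in> A0 \<Longrightarrow> (\<lambda>x. F x * G x) \<in> A0"
  using A0_algebra by (simp add: fun_subalgebra_def)

lemma A0_lincomb: "F \<in> A0 \<Longrightarrow> G \<in> A0 \<Longrightarrow> (\<lambda>x. c * F x + d * G x) \<in> A0"
  using A0_algebra by (simp add: fun_subalgebra_def)

lemma A0_cmult: "F \<in> A0 \<Longrightarrow> (\<lambda>x. c * F x) \<in> A0"
  using A0_algebra by (simp add: fun_subalgebra_def)

lemma A0_diff: "F \<in> A0 \<Longrightarrow> G \<in> A0 \<Longrightarrow> (\<lambda>x. F x - G x) \<in> A0"
  using A0_lincomb[of F G 1 "- 1"] by simp

lemma A0_mult_L2:
  assumes "f \<in> L2 M" "F \<in> A0"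
  shows "(\<lambda>x. f x * F x) \<in> L2 M"
proof -
  obtain c where "AE x in M. \<bar>F x\<bar> \<le> c" using A0_bounded[OF assms(2)] by blast
  then show ?thesis by (rule L2_mult_bounded[OF assms(1) A0_measurable[OF assms(2)]])
qed

lemma A0_L2: "F \<in> A0 \<Longrightarrow> F \<in> L2 M"
  using A0_mult_L2[OF L2_const[OF finite_measure_axioms, of 1]] by simp

lemma A0_integrable: "F \<in> A0 \<Longrightarrow> integrable M F"
  by (rule L2_integrable[OF finite_measure_axioms A0_L2])

lemma A0_compose:
  assumes "F \<in> A0" "smooth_fun 1 (\<lambda>v. f (v 0))" "f 0 = 0"
  shows "(\<lambda>x. f (F x)) \<in> A0"
  using A0_smooth[of 1 "\<lambda>v. f (v 0)" "\<lambda>_. F"] assms by simp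

lemma \<Gamma>_compose:
  assumes "F \<in> A0" "G \<in> A0" "smooth_fun 1 (\<lambda>v. f (v 0))"
    and "partial_deriv 0 (\<lambda>v. f (v 0)) = (\<lambda>v. f' (v 0))"
  shows "AE x in M. \<Gamma> (\<lambda>y. f (F y)) G x = f' (F x) * \<Gamma> F G x"
  using diffusion_\<Gamma>[of 1 "\<lambda>v. f (v 0)" "\<lambda>_. F" G] assms A0_A by simp

text \<open>By polarization, \<open>F G\<close> is a quarter of
  \<open>(F + G)^2 - (F - G)^2\<close>, so the product rule reduces to the chain rule for the square
  in one variable.\<close>

lemma \<Gamma>_mult:
  assumes F: "F \<in> A0" and G: "G \<in> A0" and H: "H \<in> A0"
  shows "AE x in M. \<Gamma> (\<lambda>y. F y * G y) H x = F x * \<Gamma> G H x + G x * \<Gamma> F H x"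
proof -
  define S where "S = (\<lambda>y. 1 * F y + 1 * G y)"
  define T where "T = (\<lambda>y. 1 * F y + (- 1) * G y)"
  have S: "S \<in> A0" and T: "T \<in> A0" unfolding S_def T_def by (rule A0_lincomb[OF F G])+
  have S2: "(\<lambda>y. (S y)\<^sup>2) \<in> A0" and T2: "(\<lambda>y. (T y)\<^sup>2) \<in> A0"
    using A0_mult[OF S S] A0_mult[OF T T] by (simp_all add: power2_eq_square)
  have e: "(\<lambda>y. F y * G y) = (\<lambda>y. (1/4) * (S y)\<^sup>2 + (- 1/4) * (T y)\<^sup>2)"
    by (rule ext) (simp add: S_def T_def power2_eq_square algebra_simps)
  have "AE x in M. \<Gamma> (\<lambda>y. F y * G y) H x
      = (1/4) * \<Gamma> (\<lambda>y. (S y)\<^sup>2) H x + (- 1/4) * \<Gamma> (\<lambda>y. (T y)\<^sup>2) H x"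
    unfolding e by (rule \<Gamma>_linear[OF S2 T2 H])
  moreover have "AE x in M. \<Gamma> (\<lambda>y. (S y)\<^sup>2) H x = 2 * S x * \<Gamma> S H x"
    by (rule \<Gamma>_compose[OF S H smooth_fun_square])
  moreover have "AE x in M. \<Gamma> (\<lambda>y. (T y)\<^sup>2) H x = 2 * T x * \<Gamma> T H x"
    by (rule \<Gamma>_compose[OF T H smooth_fun_square])
  moreover have "AE x in M. \<Gamma> S H x = 1 * \<Gamma> F H x + 1 * \<Gamma> G H x"
    unfolding S_def by (rule \<Gamma>_linear[OF F G H])
  moreover have "AE x in M. \<Gamma> T H x = 1 * \<Gamma> F H x + (- 1) * \<Gamma> G H x"
    unfolding T_def by (rule \<Gamma>_linear[OF F G H])
  ultimately show ?thesis
  proof eventually_elim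
    case (elim x)
    then show ?case by (simp add: S_def T_def) (simp add: field_simps)
  qed
qed

text \<open>The set \<open>V\<close> is left abstract because the same expansion serves
  \<open>A0\<close> first and the form domain later.\<close>

lemma \<Gamma>_lincomb_diag:
  assumes closed: "\<And>F G c d. F \<in> V \<Longrightarrow> G \<in> V \<Longrightarrow> (\<lambda>y. c * F y + d * G y) \<in> V"
    and lin: "\<And>F G H c d. F \<in> V \<Longrightarrow> G \<in> V \<Longrightarrow> H \<in> V
        \<Longrightarrow> AE x in M. \<Gamma> (\<lambda>y. c * F y + d * G y) H x = c * \<Gamma> F H x + d * \<Gamma> G H x"
    and sym: "\<And>F G. F \<in> V \<Longrightarrow> G \<in> V \<Longrightarrow> AE x in M. \<Gamma> F G x = \<Gamma> G F x"
    and F: "F \<in> V" and G: "G \<in> V"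
  shows "AE x in M. \<Gamma> (\<lambda>y. c * F y + d * G y) (\<lambda>y. c * F y + d * G y) x
      = c\<^sup>2 * \<Gamma> F F x + 2 * c * d * \<Gamma> F G x + d\<^sup>2 * \<Gamma> G G x"
proof -
  note H = closed[OF F G, of c d]
  show ?thesis
    using lin[OF F G H, of c d] sym[OF F H] sym[OF G H]
      lin[OF F G F, of c d] lin[OF F G G, of c d] sym[OF F G]
    by eventually_elim (simp add: algebra_simps power2_eq_square)
qed

text \<open>Parallelogram identity: adding the expansions for \<open>d\<close> and
  \<open>- d\<close> cancels the mixed term, and the summand added on the left is
  nonnegative.\<close>

lemma form_lincomb_le_A0:
  assumes F: "F \<in> A0" and G: "G \<in> A0"
  shows "form (\<lambda>y. c * F y + d * G y) (\<lambda>y. c * F y + d * G y) \<le> 2 * c\<^sup>2 * form F F + 2 * d\<^sup>2 * form G G"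
proof -
  have diag: "AE x in M. \<Gamma> (\<lambda>y. c * F y + d * G y) (\<lambda>y. c * F y + d * G y) x
      = c\<^sup>2 * \<Gamma> F F x + 2 * c * d * \<Gamma> F G x + d\<^sup>2 * \<Gamma> G G x" for d
    by (rule \<Gamma>_lincomb_diag[where V = A0]) (auto intro: A0_lincomb \<Gamma>_linear \<Gamma>_sym F G)
  have int: "integrable M (\<Gamma> F G)" if "F \<in> A0" "G \<in> A0" for F G
    using that by (simp add: A0_integrable \<Gamma>_A0)
  have "form (\<lambda>y. c * F y + d * G y) (\<lambda>y. c * F y + d * G y)
      \<le> (\<integral>x. 2 * c\<^sup>2 * \<Gamma> F F x + 2 * d\<^sup>2 * \<Gamma> G G x \<partial>M)"
    unfolding dform_def
  proof (rule integral_mono_AE)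
    show "AE x in M. \<Gamma> (\<lambda>y. c * F y + d * G y) (\<lambda>y. c * F y + d * G y) x
        \<le> 2 * c\<^sup>2 * \<Gamma> F F x + 2 * d\<^sup>2 * \<Gamma> G G x"
      using diag[of d] diag[of "- d"] \<Gamma>_nonneg_A0[OF A0_lincomb[OF F G, of c "- d"]]
    proof eventually_elim
      case (elim x)
      then show ?case by (simp add: algebra_simps)
    qed
  qed (auto intro!: int A0_lincomb F G)
  also have "\<dots> = 2 * c\<^sup>2 * form F F + 2 * d\<^sup>2 * form G G"
    using int[OF F F] int[OF G G] by (simp add: dform_def)
  finally show ?thesis .
qed

section \<open>Extension of the carre du champ to the form domain\<close>

lemma approx_A0: "approx Fs F \<Longrightarrow> Fs n \<in> A0"
  by (simp add: form_approx_def)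

lemma approx_L2: "approx Fs F \<Longrightarrow> (\<lambda>n. L2_norm M (\<lambda>x. Fs n x - F x)) \<longlonglongrightarrow> 0"
  by (simp add: form_approx_def)

lemma approx_const:
  assumes "F \<in> A0"
  shows "approx (\<lambda>_. F) F"
proof -
  have z: "(\<lambda>x. 0) \<in> A0" using A0_algebra by (simp add: fun_subalgebra_def)
  have "AE x in M. \<Gamma> (\<lambda>x. 0) (\<lambda>x. 0) x = 0"
    using \<Gamma>_linear[OF z z z, of 0 0] by simp
  then have "form (\<lambda>x. 0) (\<lambda>x. 0) = 0" unfolding dform_def by (rule integral_eq_zero_AE)
  then show ?thesis using assms by (simp add: form_approx_def L2_norm_def)
qed

lemma A0_form_dom: "F \<in> A0 \<Longrightarrow> F \<in> form_dom"
  using approx_const A0_L2 by (auto simp: dom_form_def)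

lemma form_dom_L2: "F \<in> form_dom \<Longrightarrow> F \<in> L2 M"
  by (simp add: dom_form_def)

lemma form_dom_approx: "F \<in> form_dom \<Longrightarrow> \<exists>Fs. approx Fs F"
  by (simp add: dom_form_def)

lemma approx_subseq:
  assumes Fs: "approx Fs F" and r: "strict_mono r"
  shows "approx (\<lambda>n. Fs (r n)) F"
  unfolding form_approx_def
proof (intro conjI allI impI)
  show "Fs (r n) \<in> A0" for n by (rule approx_A0[OF Fs])
  show "(\<lambda>n. L2_norm M (\<lambda>x. Fs (r n) x - F x)) \<longlonglongrightarrow> 0"
    using LIMSEQ_subseq_LIMSEQ[OF approx_L2[OF Fs] r] by (simp add: o_def)
  fix \<epsilon> :: real assume "0 < \<epsilon>"
  then obtain N where "\<forall>i\<ge>N. \<forall>j\<ge>N. form (\<lambda>x. Fs i x - Fs j x) (\<lambda>x. Fs i x - Fs j x) < \<epsilon>"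
    using Fs unfolding form_approx_def by blast
  then show "\<exists>N. \<forall>i\<ge>N. \<forall>j\<ge>N. form (\<lambda>x. Fs (r i) x - Fs (r j) x) (\<lambda>x. Fs (r i) x - Fs (r j) x) < \<epsilon>"
    using seq_suble[OF r] by (meson order_trans)
qed

text \<open>Convergence in \<open>L2\<close> says nothing about \<open>f' (Fs n x)\<close> for a
  continuous \<open>f'\<close>; convergence almost everywhere along a subsequence does, and the
  subsequence is still Cauchy for the form.\<close>

lemma form_dom_approx_AE:
  assumes "F \<in> form_dom"
  obtains Fs where "approx Fs F" "AE x in M. (\<lambda>n. Fs n x) \<longlonglongrightarrow> F x"
proof -
  obtain Fs where Fs: "approx Fs F" using form_dom_approx[OF assms] by blast
  obtain r :: "nat \<Rightarrow> nat" where r: "strict_mono r" "AE x in M. (\<lambda>n. Fs (r n) x) \<longlonglongrightarrow> F x"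
    using L2_tendsto_AE_subseq[OF A0_L2[OF approx_A0[OF Fs]] form_dom_L2[OF assms] approx_L2[OF Fs]]
    by blast
  show ?thesis by (rule that[OF approx_subseq[OF Fs r(1)] r(2)])
qed

lemma approx_lincomb:
  assumes F: "approx Fs F" "F \<in> L2 M" and G: "approx Gs G" "G \<in> L2 M"
  shows "approx (\<lambda>n x. c * Fs n x + d * Gs n x) (\<lambda>x. c * F x + d * G x)"
  unfolding form_approx_def
proof (intro conjI allI impI)
  show "(\<lambda>x. c * Fs n x + d * Gs n x) \<in> A0" for n
    by (rule A0_lincomb[OF approx_A0[OF F(1)] approx_A0[OF G(1)]])
  have d: "(\<lambda>x. Fs n x - F x) \<in> L2 M" "(\<lambda>x. Gs n x - G x) \<in> L2 M" for n
    using A0_L2[OF approx_A0[OF F(1)]] A0_L2[OF approx_A0[OF G(1)]] F(2) G(2) by (auto intro: L2_diff)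
  show "(\<lambda>n. L2_norm M (\<lambda>x. c * Fs n x + d * Gs n x - (c * F x + d * G x))) \<longlonglongrightarrow> 0"
  proof (rule Lim_null_comparison[OF always_eventually])
    show "\<forall>n. norm (L2_norm M (\<lambda>x. c * Fs n x + d * Gs n x - (c * F x + d * G x)))
        \<le> \<bar>c\<bar> * L2_norm M (\<lambda>x. Fs n x - F x) + \<bar>d\<bar> * L2_norm M (\<lambda>x. Gs n x - G x)"
    proof
      fix n
      have "(\<lambda>x. c * Fs n x + d * Gs n x - (c * F x + d * G x))
          = (\<lambda>x. c * (Fs n x - F x) + d * (Gs n x - G x))" by (rule ext) (simp add: algebra_simps)
      then show "norm (L2_norm M (\<lambda>x. c * Fs n x + d * Gs n x - (c * F x + d * G x)))
        \<le> \<bar>c\<bar> * L2_norm M (\<lambda>x. Fs n x - F x) + \<bar>d\<bar> * L2_norm M (\<lambda>x. Gs n x - G x)"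
        using L2_norm_triangle[OF L2_cmult[OF d(1)] L2_cmult[OF d(2)], of c n d n]
        by (simp add: L2_norm_cmult L2_norm_nonneg)
    qed
    show "(\<lambda>n. \<bar>c\<bar> * L2_norm M (\<lambda>x. Fs n x - F x) + \<bar>d\<bar> * L2_norm M (\<lambda>x. Gs n x - G x)) \<longlonglongrightarrow> 0"
      using tendsto_add[OF tendsto_mult_left[OF approx_L2[OF F(1)], of "\<bar>c\<bar>"]
          tendsto_mult_left[OF approx_L2[OF G(1)], of "\<bar>d\<bar>"]] by simp
  qed
  fix \<epsilon> :: real assume \<epsilon>: "0 < \<epsilon>"
  \<comment> \<open>The summand \<open>1\<close> keeps the denominator positive when
    \<open>c = d = 0\<close> and makes the final estimate strict.\<close>
  define \<delta> where "\<delta> = \<epsilon> / (2 * c\<^sup>2 + 2 * d\<^sup>2 + 1)"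
  have s: "0 < 2 * c\<^sup>2 + 2 * d\<^sup>2 + 1" by (simp add: add_nonneg_pos)
  then have \<delta>: "0 < \<delta>" using \<epsilon> by (simp add: \<delta>_def)
  obtain N1 where N1: "\<forall>i\<ge>N1. \<forall>j\<ge>N1. form (\<lambda>x. Fs i x - Fs j x) (\<lambda>x. Fs i x - Fs j x) < \<delta>"
    using F(1) \<delta> unfolding form_approx_def by blast
  obtain N2 where N2: "\<forall>i\<ge>N2. \<forall>j\<ge>N2. form (\<lambda>x. Gs i x - Gs j x) (\<lambda>x. Gs i x - Gs j x) < \<delta>"
    using G(1) \<delta> unfolding form_approx_def by blast
  show "\<exists>N. \<forall>i\<ge>N. \<forall>j\<ge>N. form (\<lambda>x. c * Fs i x + d * Gs i x - (c * Fs j x + d * Gs j x))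
      (\<lambda>x. c * Fs i x + d * Gs i x - (c * Fs j x + d * Gs j x)) < \<epsilon>"
  proof (intro exI[of _ "max N1 N2"] allI impI)
    fix i j assume ij: "max N1 N2 \<le> i" "max N1 N2 \<le> j"
    let ?f = "\<lambda>x. Fs i x - Fs j x" and ?g = "\<lambda>x. Gs i x - Gs j x"
    have e: "(\<lambda>x. c * Fs i x + d * Gs i x - (c * Fs j x + d * Gs j x)) = (\<lambda>x. c * ?f x + d * ?g x)"
      by (rule ext) (simp add: algebra_simps)
    have "form (\<lambda>x. c * ?f x + d * ?g x) (\<lambda>x. c * ?f x + d * ?g x) \<le> 2 * c\<^sup>2 * form ?f ?f + 2 * d\<^sup>2 * form ?g ?g"
      by (intro form_lincomb_le_A0 A0_diff approx_A0[OF F(1)] approx_A0[OF G(1)])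
    also have "\<dots> \<le> 2 * c\<^sup>2 * \<delta> + 2 * d\<^sup>2 * \<delta>"
      using N1 N2 ij by (intro add_mono mult_left_mono) (auto intro: less_imp_le)
    also have "\<dots> < (2 * c\<^sup>2 + 2 * d\<^sup>2 + 1) * \<delta>" using \<delta> by (simp add: algebra_simps)
    also have "\<dots> = \<epsilon>" using s by (simp add: \<delta>_def)
    finally show "form (\<lambda>x. c * Fs i x + d * Gs i x - (c * Fs j x + d * Gs j x))
      (\<lambda>x. c * Fs i x + d * Gs i x - (c * Fs j x + d * Gs j x)) < \<epsilon>" unfolding e .
  qed
qed

lemma form_dom_lincomb:
  assumes "F \<in> form_dom" "G \<in> form_dom"
  shows "(\<lambda>x. c * F x + d * G x) \<in> form_dom"
proof -
  obtain Fs Gs where "approx Fs F" "approx Gs G"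
    using form_dom_approx[OF assms(1)] form_dom_approx[OF assms(2)] by blast
  then have "approx (\<lambda>n x. c * Fs n x + d * Gs n x) (\<lambda>x. c * F x + d * G x)"
    using form_dom_L2 assms by (intro approx_lincomb)
  then show ?thesis
    using L2_lincomb[OF form_dom_L2[OF assms(1)] form_dom_L2[OF assms(2)], of c d]
    unfolding dom_form_def by blast
qed

lemma \<Gamma>_approx_integrable:
  assumes "approx Fs F" "approx Gs G"
  shows "integrable M (\<Gamma> (Fs n) (Gs n))"
  using assms by (intro A0_integrable \<Gamma>_A0 approx_A0)

lemma \<Gamma>_linear_form_dom:
  assumes F: "F \<in> form_dom" and G: "G \<in> form_dom" and H: "H \<in> form_dom"
  shows "AE x in M. \<Gamma> (\<lambda>y. c * F y + d * G y) H x = c * \<Gamma> F H x + d * \<Gamma> G H x"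
proof -
  obtain Fs where af: "approx Fs F" using form_dom_approx[OF F] by blast
  obtain Gs where ag: "approx Gs G" using form_dom_approx[OF G] by blast
  obtain Hs where ah: "approx Hs H" using form_dom_approx[OF H] by blast
  note a = af ag ah
  note FG = form_dom_lincomb[OF F G, of c d]
  note afg = approx_lincomb[OF a(1) form_dom_L2[OF F] a(2) form_dom_L2[OF G], of c d]
  note fh = \<Gamma>_integrable[OF F H] \<Gamma>_approx_integrable[OF a(1,3)] \<Gamma>_continuous[OF F H a(1,3)]
  note gh = \<Gamma>_integrable[OF G H] \<Gamma>_approx_integrable[OF a(2,3)] \<Gamma>_continuous[OF G H a(2,3)]
  have eq: "AE x in M. \<Gamma> (\<lambda>x. c * Fs n x + d * Gs n x) (Hs n) x
      = c * \<Gamma> (Fs n) (Hs n) x + d * \<Gamma> (Gs n) (Hs n) x" for n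
    by (rule \<Gamma>_linear[OF approx_A0[OF a(1)] approx_A0[OF a(2)] approx_A0[OF a(3)]])
  have "integrable M (\<lambda>x. c * \<Gamma> F H x + d * \<Gamma> G H x)"
    using fh(1) gh(1) by simp
  moreover have "integrable M (\<lambda>x. c * \<Gamma> (Fs n) (Hs n) x + d * \<Gamma> (Gs n) (Hs n) x)" for n
    using fh(2) gh(2) by simp
  ultimately show ?thesis
    by (rule L1_limit_unique[OF \<Gamma>_integrable[OF FG H] \<Gamma>_approx_integrable[OF afg a(3)]
          \<Gamma>_continuous[OF FG H afg a(3)] _ _ L1_limit_lincomb[OF fh gh] eq])
qed

lemma \<Gamma>_sym_form_dom:
  assumes F: "F \<in> form_dom" and G: "G \<in> form_dom"
  shows "AE x in M. \<Gamma> F G x = \<Gamma> G F x"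
proof -
  obtain Fs Gs where a: "approx Fs F" "approx Gs G"
    using form_dom_approx[OF F] form_dom_approx[OF G] by blast
  show ?thesis
    by (rule L1_limit_unique[OF \<Gamma>_integrable[OF F G] \<Gamma>_approx_integrable[OF a] \<Gamma>_continuous[OF F G a]
          \<Gamma>_integrable[OF G F] \<Gamma>_approx_integrable[OF a(2,1)] \<Gamma>_continuous[OF G F a(2,1)]])
      (intro \<Gamma>_sym approx_A0[OF a(1)] approx_A0[OF a(2)])
qed

lemma \<Gamma>_nonneg_form_dom:
  assumes F: "F \<in> form_dom"
  shows "AE x in M. 0 \<le> \<Gamma> F F x"
proof -
  obtain Fs where a: "approx Fs F" using form_dom_approx[OF F] by blast
  show ?thesis
    by (rule L1_limit_nonneg[OF \<Gamma>_integrable[OF F F] \<Gamma>_approx_integrable[OF a a] \<Gamma>_continuous[OF F F a a]])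
      (rule \<Gamma>_nonneg_A0[OF approx_A0[OF a]])
qed

lemma approx_cong_AE:
  assumes "approx Fs F" "AE x in M. F x = F' x"
    "F \<in> borel_measurable M" "F' \<in> borel_measurable M"
  shows "approx Fs F'"
proof -
  have "L2_norm M (\<lambda>x. Fs n x - F' x) = L2_norm M (\<lambda>x. Fs n x - F x)" for n
  proof -
    have [measurable]: "Fs n \<in> borel_measurable M" "F \<in> borel_measurable M" "F' \<in> borel_measurable M"
      using assms A0_measurable[OF approx_A0[OF assms(1)]] by auto
    have "AE x in M. (Fs n x - F' x)\<^sup>2 = (Fs n x - F x)\<^sup>2" using assms(2) by eventually_elim simp
    then have "(\<integral>x. (Fs n x - F' x)\<^sup>2 \<partial>M) = (\<integral>x. (Fs n x - F x)\<^sup>2 \<partial>M)"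
      by (intro integral_cong_AE) auto
    then show ?thesis by (simp add: L2_norm_def)
  qed
  then show ?thesis using assms(1) by (simp add: form_approx_def)
qed

text \<open>Approximation sees a function only up to null sets, so one sequence \<open>Fs\<close>
  serves both representatives, and the two values of \<open>\<Gamma>\<close> are limits in mean of
  the same sequence.\<close>

lemma \<Gamma>_cong_AE:
  assumes F: "F \<in> form_dom" "F' \<in> form_dom" "AE x in M. F x = F' x" and G: "G \<in> form_dom"
  shows "AE x in M. \<Gamma> F G x = \<Gamma> F' G x"
proof -
  obtain Fs Gs where a: "approx Fs F" "approx Gs G"
    using form_dom_approx[OF F(1)] form_dom_approx[OF G] by blast
  have a': "approx Fs F'"
    by (rule approx_cong_AE[OF a(1) F(3) L2_measurable L2_measurable]) (intro form_dom_L2 F)+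
  show ?thesis
    by (rule L1_limit_unique[OF \<Gamma>_integrable[OF F(1) G] \<Gamma>_approx_integrable[OF a] \<Gamma>_continuous[OF F(1) G a]
          \<Gamma>_integrable[OF F(2) G] \<Gamma>_approx_integrable[OF a] \<Gamma>_continuous[OF F(2) G a' a(2)]]) simp
qed

lemma \<Gamma>_diag_form_dom:
  assumes "F \<in> form_dom" "G \<in> form_dom"
  shows "AE x in M. \<Gamma> (\<lambda>y. c * F y + d * G y) (\<lambda>y. c * F y + d * G y) x
      = c\<^sup>2 * \<Gamma> F F x + 2 * c * d * \<Gamma> F G x + d\<^sup>2 * \<Gamma> G G x"
  by (rule \<Gamma>_lincomb_diag[where V = form_dom])
    (auto intro: form_dom_lincomb \<Gamma>_linear_form_dom \<Gamma>_sym_form_dom assms)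

lemma \<Gamma>_Cauchy_Schwarz:
  assumes F: "F \<in> form_dom" and G: "G \<in> form_dom"
  shows "AE x in M. (\<Gamma> F G x)\<^sup>2 \<le> \<Gamma> F F x * \<Gamma> G G x"
proof -
  have "AE x in M. 0 \<le> \<Gamma> F F x + 2 * t * \<Gamma> F G x + t\<^sup>2 * \<Gamma> G G x" for t
    using \<Gamma>_diag_form_dom[OF F G, of 1 t] \<Gamma>_nonneg_form_dom[OF form_dom_lincomb[OF F G, of 1 t]]
    by eventually_elim simp
  \<comment> \<open>The exceptional null set depends on \<open>t\<close>. Only countably many
    \<open>t\<close> can be handled at once, hence the rationals; continuity in \<open>t\<close>
    then gives all real \<open>t\<close> at the remaining points.\<close>
  then have "AE x in M. \<forall>r::rat. 0 \<le> \<Gamma> F F x + 2 * of_rat r * \<Gamma> F G x + (of_rat r)\<^sup>2 * \<Gamma> G G x"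
    by (simp add: AE_all_countable)
  then show ?thesis
  proof eventually_elim
    case (elim x)
    let ?p = "\<lambda>t::real. \<Gamma> F F x + 2 * t * \<Gamma> F G x + t\<^sup>2 * \<Gamma> G G x"
    have "closed {t. 0 \<le> ?p t}" by (intro closed_Collect_le continuous_intros)
    moreover have "\<rat> \<subseteq> {t. 0 \<le> ?p t}" using elim by (auto simp: Rats_def)
    ultimately have "closure \<rat> \<subseteq> {t. 0 \<le> ?p t}" by (rule closure_minimal[rotated])
    then have "0 \<le> ?p t" for t by (auto simp: Rats_closure_real)
    then show ?case by (rule discriminant_bound)
  qed
qed

lemma form_diag:
  assumes F: "F \<in> form_dom" and G: "G \<in> form_dom"
  shows "form (\<lambda>y. c * F y + d * G y) (\<lambda>y. c * F y + d * G y)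
    = c\<^sup>2 * form F F + 2 * c * d * form F G + d\<^sup>2 * form G G"
proof -
  note [simp] = \<Gamma>_integrable[OF F F] \<Gamma>_integrable[OF F G] \<Gamma>_integrable[OF G G]
    \<Gamma>_integrable[OF form_dom_lincomb[OF F G] form_dom_lincomb[OF F G]]
  have "form (\<lambda>y. c * F y + d * G y) (\<lambda>y. c * F y + d * G y)
      = (\<integral>x. c\<^sup>2 * \<Gamma> F F x + 2 * c * d * \<Gamma> F G x + d\<^sup>2 * \<Gamma> G G x \<partial>M)"
    unfolding dform_def
    by (rule integral_cong_AE[OF _ _ \<Gamma>_diag_form_dom[OF F G]]) (auto intro!: borel_measurable_integrable)
  then show ?thesis by (simp add: dform_def)
qed

lemma form_nonneg: "F \<in> form_dom \<Longrightarrow> 0 \<le> form F F"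
  unfolding dform_def by (intro integral_nonneg_AE \<Gamma>_nonneg_form_dom)

lemma form_Cauchy_Schwarz:
  assumes F: "F \<in> form_dom" and G: "G \<in> form_dom"
  shows "(form F G)\<^sup>2 \<le> form F F * form G G"
proof (rule discriminant_bound)
  fix t
  show "0 \<le> form F F + 2 * t * form F G + t\<^sup>2 * form G G"
    using form_diag[OF F G, of 1 t] form_nonneg[OF form_dom_lincomb[OF F G, of 1 t]] by simp
qed

lemma form_diff_left:
  assumes F: "F \<in> form_dom" and G: "G \<in> form_dom" and H: "H \<in> form_dom"
  shows "form (\<lambda>x. F x - G x) H = form F H - form G H"
proof -
  note FG = form_dom_lincomb[OF F G, of 1 "- 1"]
  have "form (\<lambda>x. 1 * F x + (- 1) * G x) H = (\<integral>x. 1 * \<Gamma> F H x + (- 1) * \<Gamma> G H x \<partial>M)"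
    unfolding dform_def
    by (rule integral_cong_AE[OF _ _ \<Gamma>_linear_form_dom[OF F G H]])
      (use \<Gamma>_integrable[OF F H] \<Gamma>_integrable[OF G H] \<Gamma>_integrable[OF FG H] in
        \<open>auto intro!: borel_measurable_integrable\<close>)
  then show ?thesis using \<Gamma>_integrable[OF F H] \<Gamma>_integrable[OF G H] by (simp add: dform_def)
qed

lemma form_tendsto:
  assumes "approx Fs F" "F \<in> form_dom" "approx Gs G" "G \<in> form_dom"
  shows "(\<lambda>n. form (Fs n) (Gs n)) \<longlonglongrightarrow> form F G"
  unfolding dform_def
  by (rule L1_limit_integral[OF \<Gamma>_integrable \<Gamma>_approx_integrable \<Gamma>_continuous]) (use assms in auto)

text \<open>
  The test functions need not converge, so the continuity axiom for \<open>\<Gamma>\<close> does not apply; bounded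
  energy suffices because \<open>Fs\<close> is Cauchy for the form.
\<close>

lemma form_approx_test:
  assumes F: "F \<in> form_dom" and Fs: "approx Fs F"
    and \<psi>: "\<And>n. \<psi> n \<in> A0" "\<And>n. form (\<psi> n) (\<psi> n) \<le> C"
  shows "(\<lambda>n. form (Fs n) (\<psi> n) - form F (\<psi> n)) \<longlonglongrightarrow> 0"
proof (rule LIMSEQ_I)
  fix e :: real assume e: "0 < e"
  \<comment> \<open>Chosen so that \<open>\<delta> * (\<bar>C\<bar> + 1)\<close> is the square of
    \<open>e / 2\<close>; \<open>\<bar>C\<bar> + 1\<close> is a positive bound for the energies of
    the test functions.\<close>
  define \<delta> where "\<delta> = e\<^sup>2 / (4 * (\<bar>C\<bar> + 1))"
  have \<delta>: "0 < \<delta>" using e by (simp add: \<delta>_def add_nonneg_pos)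
  obtain N where N: "\<forall>i\<ge>N. \<forall>j\<ge>N. form (\<lambda>x. Fs i x - Fs j x) (\<lambda>x. Fs i x - Fs j x) < \<delta>"
    using Fs \<delta> unfolding form_approx_def by blast
  note A0' = A0_form_dom[OF approx_A0[OF Fs]] and \<psi>' = A0_form_dom[OF \<psi>(1)]
  \<comment> \<open>For a fixed test function \<open>\<psi> n\<close>, \<open>F\<close> is reached
    as the limit of \<open>Fs j\<close>. Cauchy-Schwarz for the form then gives a bound that depends
    neither on \<open>j\<close> nor on the test function.\<close>
  have half: "\<bar>form (Fs n) (\<psi> n) - form F (\<psi> n)\<bar> \<le> e / 2" if n: "N \<le> n" for n
  proof (rule tendsto_upperbound)
    show "(\<lambda>j. \<bar>form (Fs n) (\<psi> n) - form (Fs j) (\<psi> n)\<bar>) \<longlonglongrightarrow> \<bar>form (Fs n) (\<psi> n) - form F (\<psi> n)\<bar>"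
      by (intro tendsto_intros form_tendsto[OF Fs F approx_const[OF \<psi>(1)] \<psi>'])
    have "\<bar>form (Fs n) (\<psi> n) - form (Fs j) (\<psi> n)\<bar> \<le> e / 2" if j: "N \<le> j" for j
    proof (rule power2_le_imp_le)
      let ?d = "\<lambda>x. Fs n x - Fs j x"
      have d: "?d \<in> form_dom" by (intro A0_form_dom A0_diff approx_A0[OF Fs])
      have "\<bar>form (Fs n) (\<psi> n) - form (Fs j) (\<psi> n)\<bar>\<^sup>2 = (form ?d (\<psi> n))\<^sup>2"
        by (simp add: form_diff_left[OF A0' A0' \<psi>'])
      also have "\<dots> \<le> form ?d ?d * form (\<psi> n) (\<psi> n)" by (rule form_Cauchy_Schwarz[OF d \<psi>'])
      also have "\<dots> \<le> \<delta> * (\<bar>C\<bar> + 1)"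
        using N n j \<psi>(2)[of n] \<delta> form_nonneg[OF \<psi>'] form_nonneg[OF d]
        by (intro mult_mono) (auto intro: less_imp_le)
      also have "\<dots> = (e / 2)\<^sup>2" by (simp add: \<delta>_def field_simps power2_eq_square)
      finally show "\<bar>form (Fs n) (\<psi> n) - form (Fs j) (\<psi> n)\<bar>\<^sup>2 \<le> (e / 2)\<^sup>2" .
    qed (use e in simp)
    then show "\<forall>\<^sub>F j in sequentially. \<bar>form (Fs n) (\<psi> n) - form (Fs j) (\<psi> n)\<bar> \<le> e / 2"
      using eventually_at_top_linorder by blast
  qed simp
  then show "\<exists>N. \<forall>n\<ge>N. norm (form (Fs n) (\<psi> n) - form F (\<psi> n) - 0) < e"
  proof (intro exI[of _ N] allI impI)
    fix n assume "N \<le> n"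
    then show "norm (form (Fs n) (\<psi> n) - form F (\<psi> n) - 0) < e" using half[of n] e by simp
  qed
qed

section \<open>The generator on its domain\<close>

lemma gen_dom_form_dom: "F \<in> gen_dom \<Longrightarrow> F \<in> form_dom"
  by (simp add: dom_gen_def)

lemma gen_dom_L2: "F \<in> gen_dom \<Longrightarrow> F \<in> L2 M"
  by (simp add: gen_dom_form_dom form_dom_L2)

lemma form_by_parts_A0:
  assumes F: "F \<in> A0" and G: "G \<in> form_dom"
  shows "form F G = - (\<integral>x. L F x * G x \<partial>M)"
proof -
  obtain Gs where Gs: "approx Gs G" using form_dom_approx[OF G] by blast
  have "(\<lambda>n. form F (Gs n)) \<longlonglongrightarrow> form F G"
    by (rule form_tendsto[OF approx_const[OF F] A0_form_dom[OF F] Gs G])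
  moreover have "(\<lambda>n. form F (Gs n)) = (\<lambda>n. - (\<integral>x. L F x * Gs n x \<partial>M))"
    using L_by_parts_A0[OF F approx_A0[OF Gs]] by (simp add: dform_def mult.commute)
  moreover have "(\<lambda>n. - (\<integral>x. L F x * Gs n x \<partial>M)) \<longlonglongrightarrow> - (\<integral>x. L F x * G x \<partial>M)"
    by (intro tendsto_minus L2_tendsto_mult A0_L2 L_A0 F approx_A0[OF Gs] form_dom_L2[OF G] approx_L2[OF Gs])
      (simp add: L2_norm_def)
  ultimately show ?thesis using LIMSEQ_unique by metis
qed

lemma A0_gen_dom:
  assumes F: "F \<in> A0"
  shows "F \<in> gen_dom"
proof -
  have "\<bar>form F G\<bar> \<le> L2_norm M (L F) * L2_norm M G" if "G \<in> form_dom" for G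
    using L2_Cauchy_Schwarz[OF A0_L2[OF L_A0[OF F]] form_dom_L2[OF that]]
    by (simp add: form_by_parts_A0[OF F that])
  then show ?thesis using A0_form_dom[OF F] by (auto simp: dom_gen_def)
qed

lemma L_symmetric:
  assumes "F \<in> gen_dom" "G \<in> gen_dom"
  shows "(\<integral>x. F x * L G x \<partial>M) = (\<integral>x. L F x * G x \<partial>M)"
  using L_self_adjoint gen_dom_L2[OF assms(1)] L_L2[OF assms(1)] assms
  unfolding self_adjoint_op_def by blast

text \<open>The maximality half of self-adjointness: the domain of the adjoint is no larger than
  that of \<open>L\<close>. It is how functions not known to be in \<open>A0\<close> are shown to
  lie in the domain, with the value of \<open>L\<close> read off from the pairing.\<close>

lemma gen_domI:
  assumes "F \<in> L2 M" "H \<in> L2 M" "\<And>G. G \<in> gen_dom \<Longrightarrow> (\<integral>x. F x * L G x \<partial>M) = (\<integral>x. H x * G x \<partial>M)"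
  shows "F \<in> gen_dom" "AE x in M. L F x = H x"
  using L_self_adjoint assms unfolding self_adjoint_op_def by blast+

text \<open>Linearity of \<open>L\<close> is postulated on \<open>A0\<close>; on the whole domain it
  comes from self-adjointness, because the relation defining the adjoint is linear.\<close>

lemma gen_dom_lincomb:
  assumes F: "F \<in> gen_dom" and G: "G \<in> gen_dom"
  shows "(\<lambda>x. c * F x + d * G x) \<in> gen_dom"
    and "AE x in M. L (\<lambda>x. c * F x + d * G x) x = c * L F x + d * L G x"
proof -
  have "(\<integral>x. (c * F x + d * G x) * L K x \<partial>M) = (\<integral>x. (c * L F x + d * L G x) * K x \<partial>M)"
    if K: "K \<in> gen_dom" for K
  proof -
    note [simp] = L2_integrable_mult[OF gen_dom_L2[OF F] L_L2[OF K]] L2_integrable_mult[OF gen_dom_L2[OF G] L_L2[OF K]]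
      L2_integrable_mult[OF L_L2[OF F] gen_dom_L2[OF K]] L2_integrable_mult[OF L_L2[OF G] gen_dom_L2[OF K]]
    show ?thesis by (simp add: distrib_right mult.assoc L_symmetric[OF F K] L_symmetric[OF G K])
  qed
  note g = gen_domI[OF L2_lincomb[OF gen_dom_L2[OF F] gen_dom_L2[OF G]] L2_lincomb[OF L_L2[OF F] L_L2[OF G]] this]
  show "(\<lambda>x. c * F x + d * G x) \<in> gen_dom" by (rule g(1))
  show "AE x in M. L (\<lambda>x. c * F x + d * G x) x = c * L F x + d * L G x" by (rule g(2))
qed

lemma const_gen_dom: "(\<lambda>_. c) \<in> gen_dom"
  and L_const: "AE x in M. L (\<lambda>_. c) x = 0"
proof -
  have e: "(\<lambda>_. c) = (\<lambda>x. c * 1 + 0 * 1)" by simp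
  show "(\<lambda>_. c) \<in> gen_dom" unfolding e by (rule gen_dom_lincomb(1)[OF one_in_dom one_in_dom])
  show "AE x in M. L (\<lambda>_. c) x = 0"
    using gen_dom_lincomb(2)[OF one_in_dom one_in_dom, of c 0] L_one by eventually_elim simp
qed

lemma integral_L:
  assumes F: "F \<in> gen_dom"
  shows "(\<integral>x. L F x \<partial>M) = 0"
proof -
  have "(\<integral>x. L F x \<partial>M) = (\<integral>x. F x * L (\<lambda>_. 1) x \<partial>M)"
    using L_symmetric[OF F one_in_dom] by simp
  also have "\<dots> = 0" by (rule integral_eq_zero_AE) (use L_one in auto)
  finally show ?thesis .
qed

text \<open>Constants are not assumed to lie in \<open>A0\<close>, so linearity there says nothing
  about them. Integration by parts shows that a constant has zero energy, and the pointwise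
  Cauchy-Schwarz inequality then removes the mixed term.\<close>

lemma \<Gamma>_const:
  assumes F: "F \<in> form_dom"
  shows "AE x in M. \<Gamma> (\<lambda>_. c) F x = 0"
proof -
  note C = gen_dom_form_dom[OF const_gen_dom, of c]
  have "form (\<lambda>_. c) (\<lambda>_. c) = - (\<integral>x. c * L (\<lambda>_. c) x \<partial>M)"
    using L_by_parts[OF const_gen_dom C] by simp
  also have "\<dots> = 0" using integral_L[OF const_gen_dom, of c] by simp
  finally have "AE x in M. \<Gamma> (\<lambda>_. c) (\<lambda>_. c) x = 0"
    unfolding dform_def
    using integral_nonneg_eq_0_iff_AE[OF \<Gamma>_integrable[OF C C] \<Gamma>_nonneg_form_dom[OF C]] by simp
  with \<Gamma>_Cauchy_Schwarz[OF C F] show ?thesis by eventually_elim simp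
qed

end

section \<open>Weak limits in the domain of the generator\<close>

context markov_setting
begin

lemma A0_dense_L2:
  assumes f: "f \<in> L2 M" and e: "0 < e"
  obtains g where "g \<in> A0" "L2_norm M (\<lambda>x. f x - g x) < e"
proof -
  have p: "\<bar>y\<bar> powr 2 = y\<^sup>2" for y :: real
    using powr_realpow'[of "\<bar>y\<bar>" 2] by simp
  have "f \<in> Lp M 2" using f by (simp add: Lp_def L2_def p)
  then obtain g where g: "g \<in> A0" "(\<integral>x. \<bar>f x - g x\<bar> powr 2 \<partial>M) powr (1 / 2) < e"
    using A0_dense[of 2 f e] e by auto
  then show ?thesis by (intro that[of g]) (simp_all add: p L2_norm_def powr_half_sqrt)
qed

text \<open>Density gives approximants without a common bound. Approximating
  \<open>arcsin (g / c)\<close> in mean and applying \<open>c * sin\<close> restores the bound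
  \<open>c\<close>; the result stays in \<open>A0\<close> because sine is smooth and vanishes at
  \<open>0\<close>.\<close>

lemma bounded_approx:
  assumes g[measurable]: "g \<in> borel_measurable M" and b: "\<And>x. \<bar>g x\<bar> \<le> c" and c: "0 < c"
  obtains \<phi> :: "nat \<Rightarrow> 'a \<Rightarrow> real"
  where "\<And>n. \<phi> n \<in> A0" "\<And>n x. \<bar>\<phi> n x\<bar> \<le> c" "AE x in M. (\<lambda>n. \<phi> n x) \<longlonglongrightarrow> g x"
proof -
  define u where "u = (\<lambda>x. arcsin (g x / c))"
  have r: "- 1 \<le> g x / c \<and> g x / c \<le> 1" for x using b[of x] c by (auto simp: field_simps abs_le_iff)
  have "(\<lambda>x. g x / c) \<in> measurable M (restrict_space borel {-1..1})"
    by (rule measurable_restrict_space2) (use r in \<open>auto\<close>)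
  from measurable_compose[OF this borel_measurable_continuous_on_restrict[OF continuous_on_arcsin']]
  have u[measurable]: "u \<in> borel_measurable M" by (simp add: u_def)
  have "integrable M u"
  proof (rule integrable_const_bound[where B = "pi / 2"])
    have "\<bar>arcsin (g x / c)\<bar> \<le> pi / 2" for x using arcsin[of "g x / c"] r[of x] unfolding abs_le_iff by linarith
    then show "AE x in M. norm (u x) \<le> pi / 2" by (simp add: u_def)
  qed simp
  then have "u \<in> Lp M 1" using u by (simp add: Lp_def)
  then have "\<exists>h\<in>A0. (\<integral>x. \<bar>u x - h x\<bar> \<partial>M) < 1 / real (Suc n)" for n
    using A0_dense[of 1 u "1 / real (Suc n)"] by simp
  then obtain h where h: "\<And>n. h n \<in> A0" "\<And>n. (\<integral>x. \<bar>u x - h n x\<bar> \<partial>M) < 1 / real (Suc n)" by metis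
  have "(\<lambda>n. \<integral>x. norm (h n x - u x) \<partial>M) \<longlonglongrightarrow> 0"
  proof (rule Lim_null_comparison[OF always_eventually LIMSEQ_inverse_real_of_nat], rule allI)
    show "norm (\<integral>x. norm (h n x - u x) \<partial>M) \<le> inverse (real (Suc n))" for n
      using h(2)[of n] by (simp add: abs_minus_commute divide_inverse)
  qed
  moreover have "integrable M (\<lambda>x. h n x - u x)" for n
    using A0_integrable[OF h(1)] \<open>integrable M u\<close> by simp
  ultimately obtain r where r': "strict_mono (r :: nat \<Rightarrow> nat)" "AE x in M. (\<lambda>n. h (r n) x - u x) \<longlonglongrightarrow> 0"
    using tendsto_L1_AE_subseq[of M "\<lambda>n x. h n x - u x"] by blast
  show ?thesis
  proof (rule that[of "\<lambda>n x. c * sin (h (r n) x)"])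
    show "(\<lambda>x. c * sin (h (r n) x)) \<in> A0" for n
      by (intro A0_cmult A0_compose[OF h(1) smooth_fun_sin]) simp
    have "c * \<bar>sin (h (r n) x)\<bar> \<le> c * 1" for n x using c by (intro mult_left_mono) simp_all
    then show "\<bar>c * sin (h (r n) x)\<bar> \<le> c" for n x using c by (simp add: abs_mult)
    show "AE x in M. (\<lambda>n. c * sin (h (r n) x)) \<longlonglongrightarrow> g x"
      using r'(2)
    proof eventually_elim
      case (elim x)
      then have "(\<lambda>n. h (r n) x) \<longlonglongrightarrow> u x" by (simp add: LIM_zero_iff)
      then have "(\<lambda>n. c * sin (h (r n) x)) \<longlonglongrightarrow> c * sin (u x)" by (intro tendsto_intros)
      moreover have "c * sin (u x) = g x" using r[of x] c by (simp add: u_def)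
      ultimately show ?case by simp
    qed
  qed
qed

text \<open>\<open>H\<close> is tested against its own truncations \<open>g N\<close>, reached from
  \<open>A0\<close> by uniformly bounded approximants. As \<open>H * g N\<close> is the square of
  \<open>g N\<close>, the bound on the functional limits the \<open>L2\<close> norm of
  \<open>g N\<close> independently of \<open>N\<close>, and monotone convergence concludes.\<close>

lemma L2_of_bounded_functional:
  assumes H: "integrable M H" and bd: "\<And>\<phi>. \<phi> \<in> A0 \<Longrightarrow> \<bar>\<integral>x. H x * \<phi> x \<partial>M\<bar> \<le> C * L2_norm M \<phi>"
  shows "H \<in> L2 M"
proof -
  have [measurable]: "H \<in> borel_measurable M" using H by simp
  define g where "g N x = (if \<bar>H x\<bar> \<le> real N then H x else 0)" for N :: nat and x
  have [measurable]: "g N \<in> borel_measurable M" for N unfolding g_def by measurable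
  \<comment> \<open>\<open>Suc N\<close> instead of \<open>N\<close>, since
    \<open>bounded_approx\<close> asks for a positive bound even when \<open>N = 0\<close>.\<close>
  have gb: "\<bar>g N x\<bar> \<le> real (Suc N)" for N x by (simp add: g_def)
  have g2: "(g N x)\<^sup>2 \<le> (real (Suc N))\<^sup>2" for N x using gb[of N x] by (metis abs_ge_zero power2_abs power_mono)
  have gi: "integrable M (\<lambda>x. (g N x)\<^sup>2)" for N
    by (rule integrable_const_bound[where B = "(real (Suc N))\<^sup>2"]) (use g2 in auto)
  have bound: "(\<integral>x. (g N x)\<^sup>2 \<partial>M) \<le> C\<^sup>2" for N
  proof -
    obtain \<phi> where \<phi>: "\<And>n. \<phi> n \<in> A0" "\<And>n x. \<bar>\<phi> n x\<bar> \<le> real (Suc N)" "AE x in M. (\<lambda>n. \<phi> n x) \<longlonglongrightarrow> g N x"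
      using bounded_approx[of "g N" "real (Suc N)"] gb by auto
    have [measurable]: "\<phi> n \<in> borel_measurable M" for n by (rule A0_measurable[OF \<phi>(1)])
    have 1: "(\<lambda>n. \<integral>x. H x * \<phi> n x \<partial>M) \<longlonglongrightarrow> (\<integral>x. H x * g N x \<partial>M)"
    proof (rule integral_dominated_convergence[where w = "\<lambda>x. \<bar>H x\<bar> * real (Suc N)"])
      show "AE x in M. (\<lambda>n. H x * \<phi> n x) \<longlonglongrightarrow> H x * g N x"
        using \<phi>(3) by eventually_elim (intro tendsto_intros)
      show "AE x in M. norm (H x * \<phi> n x) \<le> \<bar>H x\<bar> * real (Suc N)" for n
        using \<phi>(2) by (intro AE_I2) (simp add: abs_mult mult_left_mono del: of_nat_Suc)
    qed (use H in auto)
    have 2: "(\<lambda>n. \<integral>x. (\<phi> n x)\<^sup>2 \<partial>M) \<longlonglongrightarrow> (\<integral>x. (g N x)\<^sup>2 \<partial>M)"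
    proof (rule integral_dominated_convergence[where w = "\<lambda>x. (real (Suc N))\<^sup>2"])
      show "AE x in M. (\<lambda>n. (\<phi> n x)\<^sup>2) \<longlonglongrightarrow> (g N x)\<^sup>2"
        using \<phi>(3) by eventually_elim (intro tendsto_intros)
      have "(\<phi> n x)\<^sup>2 \<le> (real (Suc N))\<^sup>2" for n x using \<phi>(2)[of n x] by (metis abs_ge_zero power2_abs power_mono)
      then show "AE x in M. norm ((\<phi> n x)\<^sup>2) \<le> (real (Suc N))\<^sup>2" for n by simp
    qed auto
    have "\<bar>\<integral>x. H x * g N x \<partial>M\<bar> \<le> C * sqrt (\<integral>x. (g N x)\<^sup>2 \<partial>M)"
    proof (rule LIMSEQ_le)
      show "(\<lambda>n. \<bar>\<integral>x. H x * \<phi> n x \<partial>M\<bar>) \<longlonglongrightarrow> \<bar>\<integral>x. H x * g N x \<partial>M\<bar>" by (intro tendsto_intros 1)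
      show "(\<lambda>n. C * sqrt (\<integral>x. (\<phi> n x)\<^sup>2 \<partial>M)) \<longlonglongrightarrow> C * sqrt (\<integral>x. (g N x)\<^sup>2 \<partial>M)" by (intro tendsto_intros 2)
      show "\<exists>N. \<forall>n\<ge>N. \<bar>\<integral>x. H x * \<phi> n x \<partial>M\<bar> \<le> C * sqrt (\<integral>x. (\<phi> n x)\<^sup>2 \<partial>M)"
        using bd[OF \<phi>(1)] by (auto simp: L2_norm_def)
    qed
    moreover have "(\<integral>x. H x * g N x \<partial>M) = (\<integral>x. (g N x)\<^sup>2 \<partial>M)"
      by (rule Bochner_Integration.integral_cong) (auto simp: g_def power2_eq_square)
    ultimately have le: "(sqrt (\<integral>x. (g N x)\<^sup>2 \<partial>M))\<^sup>2 \<le> C * sqrt (\<integral>x. (g N x)\<^sup>2 \<partial>M)" by simp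
    have "s\<^sup>2 \<le> C\<^sup>2" if s: "0 \<le> s" "s\<^sup>2 \<le> C * s" for s
    proof (cases "s = 0")
      case False
      then have "s \<le> C" using s by (simp add: power2_eq_square)
      then show ?thesis using s(1) by (rule power_mono)
    qed simp
    from this[OF _ le] show ?thesis by simp
  qed
  have mono: "(g m x)\<^sup>2 \<le> (g n x)\<^sup>2" if "m \<le> n" for m n x
    using that by (auto simp: g_def)
  obtain l where l: "(\<lambda>N. \<integral>x. (g N x)\<^sup>2 \<partial>M) \<longlonglongrightarrow> l"
  proof (rule incseq_convergent[of "\<lambda>N. \<integral>x. (g N x)\<^sup>2 \<partial>M" "C\<^sup>2"])
    show "incseq (\<lambda>N. \<integral>x. (g N x)\<^sup>2 \<partial>M)"
      by (intro incseq_SucI integral_mono gi mono) simp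
  qed (use bound in auto)
  have "integrable M (\<lambda>x. (H x)\<^sup>2)"
  proof (rule integrable_monotone_convergence[OF gi _ _ l])
    show "AE x in M. mono (\<lambda>n. (g n x)\<^sup>2)" by (intro AE_I2 monoI mono)
    show "AE x in M. (\<lambda>i. (g i x)\<^sup>2) \<longlonglongrightarrow> (H x)\<^sup>2"
    proof (rule AE_I2)
      fix x
      obtain k :: nat where k: "\<bar>H x\<bar> \<le> real k" using real_arch_simple by blast
      have "\<forall>\<^sub>F i in sequentially. (g i x)\<^sup>2 = (H x)\<^sup>2"
        using eventually_ge_at_top[of k] by eventually_elim (use k in \<open>auto simp: g_def\<close>)
      then show "(\<lambda>i. (g i x)\<^sup>2) \<longlonglongrightarrow> (H x)\<^sup>2" by (rule tendsto_eventually)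
    qed
  qed simp
  then show ?thesis by (simp add: L2_def)
qed

text \<open>The uniform norm bound allows \<open>g\<close> to be replaced by a nearby
  \<open>\<phi>\<close> in \<open>A0\<close> at a cost independent of \<open>n\<close>.\<close>

lemma weak_limit_dense:
  assumes T: "\<And>n. T n \<in> L2 M" "\<And>n. L2_norm M (T n) \<le> C" and H: "H \<in> L2 M"
    and lim: "\<And>\<phi>. \<phi> \<in> A0 \<Longrightarrow> (\<lambda>n. \<integral>x. T n x * \<phi> x \<partial>M) \<longlonglongrightarrow> (\<integral>x. H x * \<phi> x \<partial>M)"
    and g: "g \<in> L2 M"
  shows "(\<lambda>n. \<integral>x. T n x * g x \<partial>M) \<longlonglongrightarrow> (\<integral>x. H x * g x \<partial>M)"
proof (rule LIMSEQ_I)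
  fix e :: real assume e: "0 < e"
  have C: "0 \<le> C" using T(2)[of 0] L2_norm_nonneg[of M "T 0"] by linarith
  define s where "s = C + L2_norm M H + 1"
  have s: "0 < s" using C L2_norm_nonneg[of M H] by (simp add: s_def)
  obtain \<phi> where \<phi>: "\<phi> \<in> A0" "L2_norm M (\<lambda>x. g x - \<phi> x) < e / (2 * s)"
    using A0_dense_L2[OF g, of "e / (2 * s)"] e s by auto
  have gp: "(\<lambda>x. g x - \<phi> x) \<in> L2 M" by (intro L2_diff g A0_L2 \<phi>)
  from LIMSEQ_D[OF lim[OF \<phi>(1)], of "e / 2"] e
  obtain N where N: "\<And>n. N \<le> n \<Longrightarrow> norm ((\<integral>x. T n x * \<phi> x \<partial>M) - (\<integral>x. H x * \<phi> x \<partial>M)) < e / 2" by auto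
  show "\<exists>N. \<forall>n\<ge>N. norm ((\<integral>x. T n x * g x \<partial>M) - (\<integral>x. H x * g x \<partial>M)) < e"
  proof (intro exI[of _ N] allI impI)
    fix n assume n: "N \<le> n"
    have split: "(\<integral>x. K x * g x \<partial>M) = (\<integral>x. K x * (g x - \<phi> x) \<partial>M) + (\<integral>x. K x * \<phi> x \<partial>M)" if "K \<in> L2 M" for K
      using L2_integrable_mult[OF that gp] L2_integrable_mult[OF that A0_L2[OF \<phi>(1)]]
      by (subst Bochner_Integration.integral_add[symmetric]) (auto simp: algebra_simps)
    let ?d = "L2_norm M (\<lambda>x. g x - \<phi> x)"
    have "\<bar>\<integral>x. T n x * (g x - \<phi> x) \<partial>M\<bar> \<le> L2_norm M (T n) * ?d" by (rule L2_Cauchy_Schwarz[OF T(1) gp])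
    also have "\<dots> \<le> C * ?d" by (intro mult_right_mono T L2_norm_nonneg)
    finally have 1: "\<bar>\<integral>x. T n x * (g x - \<phi> x) \<partial>M\<bar> \<le> C * ?d" .
    have 2: "\<bar>\<integral>x. H x * (g x - \<phi> x) \<partial>M\<bar> \<le> L2_norm M H * ?d" by (rule L2_Cauchy_Schwarz[OF H gp])
    have "C * ?d + L2_norm M H * ?d \<le> s * ?d"
      using L2_norm_nonneg[of M "\<lambda>x. g x - \<phi> x"] by (simp add: s_def distrib_right)
    also have "\<dots> \<le> s * (e / (2 * s))" using \<phi>(2) s by (intro mult_left_mono) auto
    also have "\<dots> = e / 2" using s by simp
    finally show "norm ((\<integral>x. T n x * g x \<partial>M) - (\<integral>x. H x * g x \<partial>M)) < e"
      using 1 2 N[OF n] unfolding split[OF T(1)] split[OF H] real_norm_def by linarith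
  qed
qed

text \<open>Here \<open>T n\<close> stands for \<open>L (S n)\<close>, with \<open>ST\<close> as its
  weak form. Hypothesis \<open>K\<close> and Cauchy-Schwarz give
  \<open>L2_norm M (T n) \<le> K * L2_norm M (S n)\<close>, a uniform bound since \<open>S n\<close>
  converges. Hence \<open>T n\<close> has a weak limit as soon as it converges on \<open>A0\<close>,
  and \<open>eq\<close> identifies that limit as \<open>H\<close>.\<close>

lemma gen_dom_weak_limit:
  assumes h: "h \<in> L2 M" and H: "integrable M H"
    and eq: "\<And>\<phi>. \<phi> \<in> A0 \<Longrightarrow> (\<integral>x. h x * L \<phi> x \<partial>M) = (\<integral>x. H x * \<phi> x \<partial>M)"
    and S: "\<And>n. S n \<in> L2 M" "(\<lambda>n. L2_norm M (\<lambda>x. S n x - h x)) \<longlonglongrightarrow> 0" and T: "\<And>n. T n \<in> L2 M"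
    and ST: "\<And>n G. G \<in> gen_dom \<Longrightarrow> (\<integral>x. S n x * L G x \<partial>M) = (\<integral>x. T n x * G x \<partial>M)"
    and K: "0 \<le> K" "\<And>n. (\<integral>x. (T n x)\<^sup>2 \<partial>M) \<le> - K * (\<integral>x. S n x * T n x \<partial>M)"
  shows "h \<in> gen_dom" "AE x in M. L h x = H x" "(\<integral>x. (L h x)\<^sup>2 \<partial>M) \<le> - K * (\<integral>x. h x * L h x \<partial>M)"
proof -
  obtain B where B: "\<And>n. L2_norm M (\<lambda>x. S n x - h x) \<le> B"
    using convergent_imp_Bseq[OF convergentI[OF S(2)]] by (auto simp: Bseq_def abs_le_iff)
  define C where "C = K * (B + L2_norm M h)"
  have TC: "L2_norm M (T n) \<le> C" for n
  proof -
    have "L2_norm M (S n) \<le> L2_norm M (\<lambda>x. S n x - h x) + L2_norm M h"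
      using L2_norm_triangle[OF L2_diff[OF S(1) h] h, of n] by simp
    then have "L2_norm M (S n) \<le> B + L2_norm M h" using B[of n] by linarith
    then have SC: "K * L2_norm M (S n) \<le> C" unfolding C_def by (intro mult_left_mono K)
    have "(L2_norm M (T n))\<^sup>2 \<le> K * \<bar>\<integral>x. S n x * T n x \<partial>M\<bar>"
    proof -
      have "- K * (\<integral>x. S n x * T n x \<partial>M) \<le> K * \<bar>\<integral>x. S n x * T n x \<partial>M\<bar>"
        unfolding mult_minus_left mult_minus_right[symmetric] by (intro mult_left_mono K) simp
      then show ?thesis using K(2)[of n] by (simp add: L2_norm_sq)
    qed
    also have "\<dots> \<le> K * (L2_norm M (S n) * L2_norm M (T n))"
      by (intro mult_left_mono K L2_Cauchy_Schwarz S T)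
    finally have le: "L2_norm M (T n) * L2_norm M (T n) \<le> (K * L2_norm M (S n)) * L2_norm M (T n)"
      by (simp add: power2_eq_square mult.assoc)
    have "L2_norm M (T n) \<le> K * L2_norm M (S n)"
    proof (cases "L2_norm M (T n) = 0")
      case True
      then show ?thesis using K(1) L2_norm_nonneg[of M "S n"] by simp
    next
      case False
      then have "0 < L2_norm M (T n)" using L2_norm_nonneg[of M "T n"] by linarith
      with le show ?thesis by (rule mult_right_le_imp_le)
    qed
    with SC show ?thesis by linarith
  qed
  have lim: "(\<lambda>n. \<integral>x. T n x * G x \<partial>M) \<longlonglongrightarrow> (\<integral>x. h x * L G x \<partial>M)" if G: "G \<in> gen_dom" for G
  proof -
    have "(\<lambda>n. \<integral>x. S n x * L G x \<partial>M) \<longlonglongrightarrow> (\<integral>x. h x * L G x \<partial>M)"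
      by (rule L2_tendsto_mult[OF S(1) h S(2)]) (use L_L2[OF G] in \<open>auto simp: L2_norm_def\<close>)
    then show ?thesis by (simp add: ST[OF G])
  qed
  have limA0: "(\<lambda>n. \<integral>x. T n x * \<phi> x \<partial>M) \<longlonglongrightarrow> (\<integral>x. H x * \<phi> x \<partial>M)" if "\<phi> \<in> A0" for \<phi>
    using lim[OF A0_gen_dom[OF that]] eq[OF that] by simp
  \<comment> \<open>So far \<open>H\<close> is only integrable. The bound on \<open>T n\<close>
    passes to the functional that \<open>H\<close> defines on \<open>A0\<close>, and this forces
    square integrability.\<close>
  have HL2: "H \<in> L2 M"
  proof (rule L2_of_bounded_functional[OF H, of C])
    fix \<phi> assume \<phi>: "\<phi> \<in> A0"
    show "\<bar>\<integral>x. H x * \<phi> x \<partial>M\<bar> \<le> C * L2_norm M \<phi>"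
    proof (rule tendsto_upperbound[OF tendsto_rabs[OF limA0[OF \<phi>]]])
      have "\<bar>\<integral>x. T n x * \<phi> x \<partial>M\<bar> \<le> C * L2_norm M \<phi>" for n
        using L2_Cauchy_Schwarz[OF T A0_L2[OF \<phi>], of n] mult_right_mono[OF TC L2_norm_nonneg, of n M \<phi>]
        by linarith
      then show "\<forall>\<^sub>F n in sequentially. \<bar>\<integral>x. T n x * \<phi> x \<partial>M\<bar> \<le> C * L2_norm M \<phi>" by simp
    qed simp
  qed
  have weak: "(\<lambda>n. \<integral>x. T n x * g x \<partial>M) \<longlonglongrightarrow> (\<integral>x. H x * g x \<partial>M)" if "g \<in> L2 M" for g
    by (rule weak_limit_dense[OF T TC HL2 limA0 that])
  have "(\<integral>x. h x * L G x \<partial>M) = (\<integral>x. H x * G x \<partial>M)" if "G \<in> gen_dom" for G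
    by (rule LIMSEQ_unique[OF lim[OF that] weak[OF gen_dom_L2[OF that]]])
  note hH = gen_domI[OF h HL2 this]
  show h': "h \<in> gen_dom" by (rule hH(1))
  show LH: "AE x in M. L h x = H x" by (rule hH(2))
  \<comment> \<open>Lower semicontinuity of the norm under weak convergence: in
    \<open>2 T H - H^2 \<le> T^2\<close> the left-hand side is affine in \<open>T\<close>, so it
    passes to the weak limit.\<close>
  have "2 * (\<integral>x. H x * H x \<partial>M) - (\<integral>x. (H x)\<^sup>2 \<partial>M) \<le> - K * (\<integral>x. H x * h x \<partial>M)"
  proof (rule LIMSEQ_le)
    show "(\<lambda>n. 2 * (\<integral>x. T n x * H x \<partial>M) - (\<integral>x. (H x)\<^sup>2 \<partial>M))
        \<longlonglongrightarrow> 2 * (\<integral>x. H x * H x \<partial>M) - (\<integral>x. (H x)\<^sup>2 \<partial>M)"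
      by (intro tendsto_intros weak HL2)
    \<comment> \<open>\<open>T n\<close> converges only weakly, but \<open>S n\<close> converges in
      norm: replacing \<open>S n\<close> by \<open>h\<close> costs nothing in the limit, and what
      remains is a weak limit against the fixed function \<open>h\<close>.\<close>
    have "(\<lambda>n. \<integral>x. (S n x - h x) * T n x \<partial>M) \<longlonglongrightarrow> 0"
    proof (rule Lim_null_comparison[OF always_eventually])
      show "\<forall>n. norm (\<integral>x. (S n x - h x) * T n x \<partial>M) \<le> L2_norm M (\<lambda>x. S n x - h x) * C"
      proof
        fix n
        show "norm (\<integral>x. (S n x - h x) * T n x \<partial>M) \<le> L2_norm M (\<lambda>x. S n x - h x) * C"
          using L2_Cauchy_Schwarz[OF L2_diff[OF S(1) h] T, of n n]
            mult_left_mono[OF TC[of n] L2_norm_nonneg[of M "\<lambda>x. S n x - h x"]] by simp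
      qed
      show "(\<lambda>n. L2_norm M (\<lambda>x. S n x - h x) * C) \<longlonglongrightarrow> 0"
        using tendsto_mult_right[OF S(2), of C] by simp
    qed
    from tendsto_add[OF this weak[OF h]]
    have "(\<lambda>n. (\<integral>x. (S n x - h x) * T n x \<partial>M) + (\<integral>x. T n x * h x \<partial>M)) \<longlonglongrightarrow> (\<integral>x. H x * h x \<partial>M)" by simp
    moreover have "(\<integral>x. (S n x - h x) * T n x \<partial>M) + (\<integral>x. T n x * h x \<partial>M) = (\<integral>x. S n x * T n x \<partial>M)" for n
      using L2_integrable_mult[OF L2_diff[OF S(1) h] T, of n n] L2_integrable_mult[OF T h, of n]
      by (subst Bochner_Integration.integral_add[symmetric]) (auto simp: algebra_simps)
    ultimately have "(\<lambda>n. \<integral>x. S n x * T n x \<partial>M) \<longlonglongrightarrow> (\<integral>x. H x * h x \<partial>M)" by simp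
    then show "(\<lambda>n. - K * (\<integral>x. S n x * T n x \<partial>M)) \<longlonglongrightarrow> - K * (\<integral>x. H x * h x \<partial>M)"
      by (rule tendsto_mult_left)
    have "2 * (\<integral>x. T n x * H x \<partial>M) - (\<integral>x. (H x)\<^sup>2 \<partial>M) \<le> (\<integral>x. (T n x)\<^sup>2 \<partial>M)" for n
    proof -
      note i = L2_integrable_mult[OF T HL2, of n]
      have i': "integrable M (\<lambda>x. (T n x)\<^sup>2)" "integrable M (\<lambda>x. (H x)\<^sup>2)"
        using T[of n] HL2 by (auto simp: L2_def)
      have "0 \<le> (\<integral>x. (T n x - H x)\<^sup>2 \<partial>M)" by simp
      also have "\<dots> = (\<integral>x. (T n x)\<^sup>2 - 2 * (T n x * H x) + (H x)\<^sup>2 \<partial>M)"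
        by (rule Bochner_Integration.integral_cong) (auto simp: power2_eq_square algebra_simps)
      also have "\<dots> = (\<integral>x. (T n x)\<^sup>2 \<partial>M) - 2 * (\<integral>x. T n x * H x \<partial>M) + (\<integral>x. (H x)\<^sup>2 \<partial>M)"
        using i i' by simp
      finally show ?thesis by simp
    qed
    then show "\<exists>N. \<forall>n\<ge>N. 2 * (\<integral>x. T n x * H x \<partial>M) - (\<integral>x. (H x)\<^sup>2 \<partial>M) \<le> - K * (\<integral>x. S n x * T n x \<partial>M)"
      using K(2) by (meson order_trans)
  qed
  then have le: "(\<integral>x. (H x)\<^sup>2 \<partial>M) \<le> - K * (\<integral>x. h x * H x \<partial>M)"
    by (simp add: power2_eq_square mult.commute)
  have [measurable]: "h \<in> borel_measurable M" "H \<in> borel_measurable M" "L h \<in> borel_measurable M"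
    using L2_measurable h HL2 L_L2[OF h'] by auto
  have "(\<integral>x. (L h x)\<^sup>2 \<partial>M) = (\<integral>x. (H x)\<^sup>2 \<partial>M)" "(\<integral>x. h x * L h x \<partial>M) = (\<integral>x. h x * H x \<partial>M)"
    by (rule integral_cong_AE; use LH in \<open>auto\<close>)+
  with le show "(\<integral>x. (L h x)\<^sup>2 \<partial>M) \<le> - K * (\<integral>x. h x * L h x \<partial>M)" by simp
qed

section \<open>Eigenfunctions\<close>

abbreviation "eigsp \<equiv> eigenspace M A0 \<Gamma> L"
abbreviation "eigvals \<equiv> eigenvalues M A0 \<Gamma> L"

lemma eigenspace_gen_dom: "f \<in> eigsp \<kappa> \<Longrightarrow> f \<in> gen_dom"
  by (simp add: eigenspace_def)

lemma eigenspace_L2: "f \<in> eigsp \<kappa> \<Longrightarrow> f \<in> L2 M"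
  by (simp add: eigenspace_gen_dom gen_dom_L2)

lemma eigenspace_L: "f \<in> eigsp \<kappa> \<Longrightarrow> AE x in M. L f x = - \<kappa> * f x"
  unfolding eigenspace_def by (auto elim: eventually_mono)

lemma eigenspace_integral_L:
  assumes f: "f \<in> eigsp \<kappa>" and g: "g \<in> L2 M"
  shows "(\<integral>x. L f x * g x \<partial>M) = - \<kappa> * (\<integral>x. f x * g x \<partial>M)"
proof -
  have [measurable]: "f \<in> borel_measurable M" "g \<in> borel_measurable M" "L f \<in> borel_measurable M"
    using L2_measurable eigenspace_L2[OF f] g L_L2[OF eigenspace_gen_dom[OF f]] by auto
  have "(\<integral>x. L f x * g x \<partial>M) = (\<integral>x. - \<kappa> * (f x * g x) \<partial>M)"
    by (rule integral_cong_AE) (use eigenspace_L[OF f] in auto)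
  then show ?thesis by simp
qed

lemma eigenspace_integral_L':
  assumes f: "f \<in> eigsp \<kappa>" and g: "g \<in> gen_dom"
  shows "(\<integral>x. f x * L g x \<partial>M) = - \<kappa> * (\<integral>x. f x * g x \<partial>M)"
  using eigenspace_integral_L[OF f gen_dom_L2[OF g]] L_symmetric[OF eigenspace_gen_dom[OF f] g] by simp

lemma eigenspace_orthogonal:
  assumes f: "f \<in> eigsp \<kappa>" and g: "g \<in> eigsp \<kappa>'" and ne: "\<kappa> \<noteq> \<kappa>'"
  shows "(\<integral>x. f x * g x \<partial>M) = 0"
proof -
  have "(\<integral>x. f x * L g x \<partial>M) = - \<kappa>' * (\<integral>x. f x * g x \<partial>M)"
    using eigenspace_integral_L[OF g eigenspace_L2[OF f]] by (simp add: mult.commute)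
  with eigenspace_integral_L'[OF f eigenspace_gen_dom[OF g]]
  have "(\<kappa>' - \<kappa>) * (\<integral>x. f x * g x \<partial>M) = 0" by (simp add: algebra_simps)
  then show ?thesis using ne by simp
qed

lemma eigenspace_add:
  assumes f: "f \<in> eigsp \<kappa>" and g: "g \<in> eigsp \<kappa>"
  shows "(\<lambda>x. f x + c * g x) \<in> eigsp \<kappa>"
proof -
  note d = gen_dom_lincomb[OF eigenspace_gen_dom[OF f] eigenspace_gen_dom[OF g], of 1 c]
  have "AE x in M. L (\<lambda>x. f x + c * g x) x + \<kappa> * (f x + c * g x) = 0"
    using d(2) eigenspace_L[OF f] eigenspace_L[OF g] by eventually_elim (simp add: algebra_simps)
  then show ?thesis using d(1) by (simp add: eigenspace_def)
qed

lemma eigenvalue_nonneg: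
  assumes "- \<kappa> \<in> eigvals"
  shows "0 \<le> \<kappa>"
proof -
  obtain f where f: "f \<in> eigsp \<kappa>" "\<not> (AE x in M. f x = 0)"
    using assms by (auto simp: eigenvalues_def eigenfunction_def)
  note fd = eigenspace_gen_dom[OF f(1)]
  have "0 \<le> form f f" by (rule form_nonneg[OF gen_dom_form_dom[OF fd]])
  also have "\<dots> = \<kappa> * (\<integral>x. f x * f x \<partial>M)"
    using L_by_parts[OF fd gen_dom_form_dom[OF fd]] eigenspace_integral_L'[OF f(1) fd] by simp
  finally have le: "0 \<le> \<kappa> * (\<integral>x. (f x)\<^sup>2 \<partial>M)" by (simp add: power2_eq_square)
  have i: "integrable M (\<lambda>x. (f x)\<^sup>2)" using eigenspace_L2[OF f(1)] by (simp add: L2_def)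
  have "(\<integral>x. (f x)\<^sup>2 \<partial>M) \<noteq> 0"
    using f(2) integral_nonneg_eq_0_iff_AE[OF i] by simp
  moreover have "0 \<le> (\<integral>x. (f x)\<^sup>2 \<partial>M)" by simp
  ultimately have "0 < (\<integral>x. (f x)\<^sup>2 \<partial>M)" by linarith
  then show ?thesis using le by (simp add: zero_le_mult_iff)
qed

text \<open>Orthogonality kills the off-diagonal terms. Two coefficient families are allowed so that
  one identity yields both \<open>\<integral> T^2\<close> and \<open>\<integral> S T\<close> in
  \<open>eigensum\<close>.\<close>

lemma eigensum_inner:
  assumes J: "finite J" and f: "\<And>\<kappa>. \<kappa> \<in> J \<Longrightarrow> f \<kappa> \<in> eigsp \<kappa>"
  shows "(\<integral>x. (\<Sum>\<kappa>\<in>J. c \<kappa> * f \<kappa> x) * (\<Sum>\<kappa>\<in>J. d \<kappa> * f \<kappa> x) \<partial>M) = (\<Sum>\<kappa>\<in>J. c \<kappa> * d \<kappa> * (\<integral>x. (f \<kappa> x)\<^sup>2 \<partial>M))"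
proof -
  have i: "integrable M (\<lambda>x. f \<kappa> x * f \<kappa>' x)" if "\<kappa> \<in> J" "\<kappa>' \<in> J" for \<kappa> \<kappa>'
    by (intro L2_integrable_mult eigenspace_L2[OF f] that)
  have "(\<integral>x. (\<Sum>\<kappa>\<in>J. c \<kappa> * f \<kappa> x) * (\<Sum>\<kappa>\<in>J. d \<kappa> * f \<kappa> x) \<partial>M)
      = (\<integral>x. (\<Sum>\<kappa>\<in>J. \<Sum>\<kappa>'\<in>J. c \<kappa> * d \<kappa>' * (f \<kappa> x * f \<kappa>' x)) \<partial>M)"
    by (simp add: sum_product mult.assoc mult.left_commute)
  also have "\<dots> = (\<Sum>\<kappa>\<in>J. \<Sum>\<kappa>'\<in>J. c \<kappa> * d \<kappa>' * (\<integral>x. f \<kappa> x * f \<kappa>' x \<partial>M))"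
    using i by (simp add: Bochner_Integration.integral_sum)
  also have "\<dots> = (\<Sum>\<kappa>\<in>J. \<Sum>\<kappa>'\<in>J. if \<kappa>' = \<kappa> then c \<kappa> * d \<kappa> * (\<integral>x. (f \<kappa> x)\<^sup>2 \<partial>M) else 0)"
    by (intro sum.cong refl) (auto simp: power2_eq_square eigenspace_orthogonal[OF f f])
  also have "\<dots> = (\<Sum>\<kappa>\<in>J. c \<kappa> * d \<kappa> * (\<integral>x. (f \<kappa> x)\<^sup>2 \<partial>M))"
    using J by simp
  finally show ?thesis .
qed

text \<open>\<open>T\<close> is the explicit candidate for \<open>L S\<close>. The last inequality
  holds term by term, because \<open>0 \<le> \<kappa> \<le> K\<close> gives
  \<open>\<kappa>^2 \<le> K \<kappa>\<close>; this is the only place where the upper bound on the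
  spectrum of the square acts.\<close>

lemma eigensum:
  fixes J :: "real set"
  assumes J: "finite J" and f: "\<And>\<kappa>. \<kappa> \<in> J \<Longrightarrow> f \<kappa> \<in> eigsp \<kappa>"
    and K: "\<And>\<kappa>. \<kappa> \<in> J \<Longrightarrow> 0 \<le> \<kappa>" "\<And>\<kappa>. \<kappa> \<in> J \<Longrightarrow> \<kappa> \<le> K"
  defines "S \<equiv> \<lambda>x. \<Sum>\<kappa>\<in>J. f \<kappa> x" and "T \<equiv> \<lambda>x. \<Sum>\<kappa>\<in>J. - \<kappa> * f \<kappa> x"
  shows "S \<in> L2 M" "T \<in> L2 M"
    and "\<And>G. G \<in> gen_dom \<Longrightarrow> (\<integral>x. S x * L G x \<partial>M) = (\<integral>x. T x * G x \<partial>M)"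
    and "(\<integral>x. (T x)\<^sup>2 \<partial>M) \<le> - K * (\<integral>x. S x * T x \<partial>M)"
proof -
  show "S \<in> L2 M" unfolding S_def by (rule L2_sum[OF J eigenspace_L2[OF f]])
  show "T \<in> L2 M" unfolding T_def by (rule L2_sum[OF J L2_cmult[OF eigenspace_L2[OF f]]])
  show "(\<integral>x. S x * L G x \<partial>M) = (\<integral>x. T x * G x \<partial>M)" if G: "G \<in> gen_dom" for G
  proof -
    have i: "integrable M (\<lambda>x. f \<kappa> x * L G x)" "integrable M (\<lambda>x. f \<kappa> x * G x)" if "\<kappa> \<in> J" for \<kappa>
      by (intro L2_integrable_mult eigenspace_L2[OF f] L_L2 gen_dom_L2 G that)+
    have "(\<integral>x. S x * L G x \<partial>M) = (\<Sum>\<kappa>\<in>J. \<integral>x. f \<kappa> x * L G x \<partial>M)"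
      unfolding S_def sum_distrib_right by (rule Bochner_Integration.integral_sum[OF i(1)])
    also have "\<dots> = (\<Sum>\<kappa>\<in>J. \<integral>x. - \<kappa> * (f \<kappa> x * G x) \<partial>M)"
      by (intro sum.cong refl) (simp add: eigenspace_integral_L'[OF f G])
    also have "\<dots> = (\<integral>x. (\<Sum>\<kappa>\<in>J. - \<kappa> * (f \<kappa> x * G x)) \<partial>M)"
      by (rule Bochner_Integration.integral_sum[symmetric]) (intro integrable_mult_right i)
    also have "\<dots> = (\<integral>x. T x * G x \<partial>M)" by (simp add: T_def sum_distrib_right mult.assoc)
    finally show ?thesis .
  qed
  have TT: "(\<integral>x. (T x)\<^sup>2 \<partial>M) = (\<Sum>\<kappa>\<in>J. \<kappa> * \<kappa> * (\<integral>x. (f \<kappa> x)\<^sup>2 \<partial>M))"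
    using eigensum_inner[OF J f, of "\<lambda>\<kappa>. - \<kappa>" "\<lambda>\<kappa>. - \<kappa>"] by (simp add: T_def power2_eq_square)
  have STi: "(\<integral>x. S x * T x \<partial>M) = (\<Sum>\<kappa>\<in>J. - \<kappa> * (\<integral>x. (f \<kappa> x)\<^sup>2 \<partial>M))"
    using eigensum_inner[OF J f, of "\<lambda>_. 1" "\<lambda>\<kappa>. - \<kappa>"] by (simp add: S_def T_def)
  show "(\<integral>x. (T x)\<^sup>2 \<partial>M) \<le> - K * (\<integral>x. S x * T x \<partial>M)"
    unfolding TT STi sum_distrib_left
    by (intro sum_mono) (simp add: K mult_right_mono mult.assoc[symmetric])
qed

text \<open>A multiple of the eigenfunction \<open>F\<close> is absorbed into the component with its
  own index \<open>j\<close>, so \<open>h + c F\<close> obeys the same spectral bound as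
  \<open>h\<close>. Sequences replace the net of finite index sets.\<close>

lemma hilbert_sum_approx:
  fixes K :: real
  assumes h: "h \<in> hilbert_sum M I eigsp" and j: "j \<in> I" and F: "F \<in> eigsp j"
    and I: "\<And>\<kappa>. \<kappa> \<in> I \<Longrightarrow> - \<kappa> \<in> eigvals" "\<And>\<kappa>. \<kappa> \<in> I \<Longrightarrow> \<kappa> \<le> K"
  obtains S T :: "nat \<Rightarrow> 'a \<Rightarrow> real" where "\<And>n. S n \<in> L2 M" "\<And>n. T n \<in> L2 M"
    "(\<lambda>n. L2_norm M (\<lambda>x. S n x - (h x + c * F x))) \<longlonglongrightarrow> 0"
    "\<And>n G. G \<in> gen_dom \<Longrightarrow> (\<integral>x. S n x * L G x \<partial>M) = (\<integral>x. T n x * G x \<partial>M)"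
    "\<And>n. (\<integral>x. (T n x)\<^sup>2 \<partial>M) \<le> - K * (\<integral>x. S n x * T n x \<partial>M)"
proof -
  obtain f where f: "\<And>\<kappa>. \<kappa> \<in> I \<Longrightarrow> f \<kappa> \<in> eigsp \<kappa>"
    and lim: "((\<lambda>J. L2_norm M (\<lambda>x. h x - (\<Sum>\<kappa>\<in>J. f \<kappa> x))) \<longlongrightarrow> 0) (finite_subsets_at_top I)"
    using h unfolding hilbert_sum_def by blast
  have "\<exists>J. finite J \<and> J \<subseteq> I \<and> j \<in> J \<and> L2_norm M (\<lambda>x. h x - (\<Sum>\<kappa>\<in>J. f \<kappa> x)) < inverse (real (Suc n))" for n
  proof -
    have "\<forall>\<^sub>F J in finite_subsets_at_top I. L2_norm M (\<lambda>x. h x - (\<Sum>\<kappa>\<in>J. f \<kappa> x)) < inverse (real (Suc n))"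
      by (rule order_tendstoD(2)[OF lim]) simp
    then obtain J0 where J0: "finite J0" "J0 \<subseteq> I"
      "\<forall>J. finite J \<and> J0 \<subseteq> J \<and> J \<subseteq> I \<longrightarrow> L2_norm M (\<lambda>x. h x - (\<Sum>\<kappa>\<in>J. f \<kappa> x)) < inverse (real (Suc n))"
      unfolding eventually_finite_subsets_at_top by (elim exE conjE)
    \<comment> \<open>Convergence along finite subsets controls every finite set that contains
      \<open>J0\<close>, so \<open>j\<close> may be added to it.\<close>
    have "L2_norm M (\<lambda>x. h x - (\<Sum>\<kappa>\<in>insert j J0. f \<kappa> x)) < inverse (real (Suc n))"
      by (rule J0(3)[rule_format]) (use J0(1,2) j in blast)
    then show ?thesis using J0(1,2) j by blast
  qed
  then have "\<forall>n. \<exists>J. finite J \<and> J \<subseteq> I \<and> j \<in> J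
      \<and> L2_norm M (\<lambda>x. h x - (\<Sum>\<kappa>\<in>J. f \<kappa> x)) < inverse (real (Suc n))" by (rule allI)
  from choice[OF this] obtain J where J': "\<forall>n. finite (J n) \<and> J n \<subseteq> I \<and> j \<in> J n
      \<and> L2_norm M (\<lambda>x. h x - (\<Sum>\<kappa>\<in>J n. f \<kappa> x)) < inverse (real (Suc n))" by (elim exE)
  then have J: "\<And>n. finite (J n)" "\<And>n. J n \<subseteq> I" "\<And>n. j \<in> J n"
    "\<And>n. L2_norm M (\<lambda>x. h x - (\<Sum>\<kappa>\<in>J n. f \<kappa> x)) < inverse (real (Suc n))" by blast+
  \<comment> \<open>Only the component at \<open>j\<close> changes. Since \<open>j\<close> belongs
    to every \<open>J n\<close>, each partial sum gains exactly \<open>c * F x\<close>.\<close>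
  define f' where "f' \<kappa> = (if \<kappa> = j then (\<lambda>x. f j x + c * F x) else f \<kappa>)" for \<kappa>
  have f': "f' \<kappa> \<in> eigsp \<kappa>" if "\<kappa> \<in> J n" for \<kappa> n
    using that J(2)[of n] f eigenspace_add[OF f[OF j] F] by (auto simp: f'_def)
  have K0: "0 \<le> \<kappa>" "\<kappa> \<le> K" if "\<kappa> \<in> J n" for \<kappa> n
    using that J(2)[of n] I eigenvalue_nonneg by auto
  note e = eigensum[OF J(1) f' K0(1) K0(2)]
  show ?thesis
  proof (rule that[of "\<lambda>n x. \<Sum>\<kappa>\<in>J n. f' \<kappa> x" "\<lambda>n x. \<Sum>\<kappa>\<in>J n. - \<kappa> * f' \<kappa> x"])
    have sum_eq: "(\<Sum>\<kappa>\<in>J n. f' \<kappa> x) = (\<Sum>\<kappa>\<in>J n. f \<kappa> x) + c * F x" for n x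
    proof -
      have "(\<Sum>\<kappa>\<in>J n. f' \<kappa> x) = (\<Sum>\<kappa>\<in>J n. f \<kappa> x + (if \<kappa> = j then c * F x else 0))"
        by (rule sum.cong) (auto simp: f'_def)
      also have "\<dots> = (\<Sum>\<kappa>\<in>J n. f \<kappa> x) + c * F x" using J(1,3) by (simp add: sum.distrib)
      finally show ?thesis .
    qed
    show "(\<lambda>n. L2_norm M (\<lambda>x. (\<Sum>\<kappa>\<in>J n. f' \<kappa> x) - (h x + c * F x))) \<longlonglongrightarrow> 0"
    proof (rule Lim_null_comparison[OF always_eventually LIMSEQ_inverse_real_of_nat], rule allI)
      fix n
      have "L2_norm M (\<lambda>x. (\<Sum>\<kappa>\<in>J n. f' \<kappa> x) - (h x + c * F x)) = L2_norm M (\<lambda>x. h x - (\<Sum>\<kappa>\<in>J n. f \<kappa> x))"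
        by (subst L2_norm_minus_commute) (simp add: sum_eq)
      then show "norm (L2_norm M (\<lambda>x. (\<Sum>\<kappa>\<in>J n. f' \<kappa> x) - (h x + c * F x))) \<le> inverse (real (Suc n))"
        using J(4)[of n] by (simp add: L2_norm_nonneg)
    qed
  qed (use e in auto)
qed

end

section \<open>Identities for the carre du champ of an eigenfunction\<close>

text \<open>With \<open>X = \<Gamma> F \<phi> x\<close> this absorbs the mixed term of
  \<open>\<Gamma>(F \<phi>, F \<phi>)\<close> into the two diagonal terms.\<close>

lemma weighted_AM_GM:
  fixes a b X P R :: real
  assumes "X\<^sup>2 \<le> P * R" "0 \<le> P" "0 \<le> R"
  shows "2 * a * b * X \<le> a\<^sup>2 * P + b\<^sup>2 * R"
proof (rule power2_le_imp_le)
  have "(2 * a * b * X)\<^sup>2 = (4 * a\<^sup>2 * b\<^sup>2) * X\<^sup>2" by (simp add: power_mult_distrib)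
  also have "\<dots> \<le> (4 * a\<^sup>2 * b\<^sup>2) * (P * R)" by (intro mult_left_mono assms) simp
  also have "\<dots> = (a\<^sup>2 * P + b\<^sup>2 * R)\<^sup>2 - (a\<^sup>2 * P - b\<^sup>2 * R)\<^sup>2" by algebra
  also have "\<dots> \<le> (a\<^sup>2 * P + b\<^sup>2 * R)\<^sup>2" by simp
  finally show "(2 * a * b * X)\<^sup>2 \<le> (a\<^sup>2 * P + b\<^sup>2 * R)\<^sup>2" .
  show "0 \<le> a\<^sup>2 * P + b\<^sup>2 * R" using assms by simp
qed

lemma L2_cong_AE:
  assumes "f \<in> L2 M" "g \<in> borel_measurable M" "AE x in M. f x = g x"
  shows "g \<in> L2 M"
proof -
  have m: "f \<in> borel_measurable M" and i: "integrable M (\<lambda>x. (f x)\<^sup>2)" using assms(1) by (auto simp: L2_def)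
  have "integrable M (\<lambda>x. (g x)\<^sup>2)"
    by (rule integrable_cong_AE_imp[OF i]) (use assms(2,3) in auto)
  then show ?thesis using assms(2) by (simp add: L2_def)
qed

context markov_setting
begin

lemma approx_form_bounded:
  assumes Fs: "approx Fs F" and F: "F \<in> form_dom"
  obtains B where "\<And>n. form (Fs n) (Fs n) \<le> B" "\<And>n. (\<integral>x. (Fs n x)\<^sup>2 \<partial>M) \<le> B"
proof -
  obtain B1 where B1: "\<And>n. norm (form (Fs n) (Fs n)) \<le> B1"
    using convergent_imp_Bseq[OF convergentI[OF form_tendsto[OF Fs F Fs F]]] by (auto simp: Bseq_def)
  note l = A0_L2[OF approx_A0[OF Fs]] form_dom_L2[OF F] approx_L2[OF Fs]
  have "(\<lambda>n. \<integral>x. Fs n x * Fs n x \<partial>M) \<longlonglongrightarrow> (\<integral>x. F x * F x \<partial>M)"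
    by (rule L2_tendsto_mult[OF l l])
  from convergent_imp_Bseq[OF convergentI[OF this]]
  obtain B2 where B2: "\<And>n. norm (\<integral>x. Fs n x * Fs n x \<partial>M) \<le> B2" by (auto simp: Bseq_def)
  have "form (Fs n) (Fs n) \<le> max B1 B2" for n using B1[of n] by (simp add: abs_le_iff le_max_iff_disj)
  moreover have "(\<integral>x. (Fs n x)\<^sup>2 \<partial>M) \<le> max B1 B2" for n
    using B2[of n] by (simp add: abs_le_iff le_max_iff_disj power2_eq_square)
  ultimately show ?thesis by (rule that)
qed

text \<open>The bound involves \<open>F\<close> only through its energy and its \<open>L2\<close>
  norm, so the products \<open>Fs n * \<phi>\<close> have uniformly bounded energy, as
  \<open>form_approx_test\<close> demands.\<close>

lemma form_mult_le:
  assumes F: "F \<in> A0" and \<phi>: "\<phi> \<in> A0"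
    and c: "AE x in M. \<bar>\<phi> x\<bar> \<le> c" and d: "AE x in M. \<bar>\<Gamma> \<phi> \<phi> x\<bar> \<le> d"
  shows "form (\<lambda>x. F x * \<phi> x) (\<lambda>x. F x * \<phi> x) \<le> 2 * c\<^sup>2 * form F F + 2 * d * (\<integral>x. (F x)\<^sup>2 \<partial>M)"
proof -
  have F\<phi>: "(\<lambda>x. F x * \<phi> x) \<in> A0" by (rule A0_mult[OF F \<phi>])
  note i = A0_integrable[OF \<Gamma>_A0[OF F F]] L2_integrable_mult[OF A0_L2[OF F] A0_L2[OF F]]
  have "form (\<lambda>x. F x * \<phi> x) (\<lambda>x. F x * \<phi> x) \<le> (\<integral>x. 2 * c\<^sup>2 * \<Gamma> F F x + 2 * d * (F x * F x) \<partial>M)"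
    unfolding dform_def
  proof (rule integral_mono_AE)
    show "integrable M (\<Gamma> (\<lambda>x. F x * \<phi> x) (\<lambda>x. F x * \<phi> x))" by (intro A0_integrable \<Gamma>_A0 F\<phi>)
    show "integrable M (\<lambda>x. 2 * c\<^sup>2 * \<Gamma> F F x + 2 * d * (F x * F x))" using i by simp
    show "AE x in M. \<Gamma> (\<lambda>x. F x * \<phi> x) (\<lambda>x. F x * \<phi> x) x \<le> 2 * c\<^sup>2 * \<Gamma> F F x + 2 * d * (F x * F x)"
      using \<Gamma>_mult[OF F \<phi> F\<phi>] \<Gamma>_sym[OF \<phi> F\<phi>] \<Gamma>_sym[OF F F\<phi>] \<Gamma>_mult[OF F \<phi> F] \<Gamma>_mult[OF F \<phi> \<phi>]
        \<Gamma>_sym[OF F \<phi>] \<Gamma>_Cauchy_Schwarz[OF A0_form_dom[OF F] A0_form_dom[OF \<phi>]]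
        \<Gamma>_nonneg_A0[OF F] \<Gamma>_nonneg_A0[OF \<phi>] c d
    proof eventually_elim
      case (elim x)
      have eq: "\<Gamma> (\<lambda>x. F x * \<phi> x) (\<lambda>x. F x * \<phi> x) x
          = (\<phi> x)\<^sup>2 * \<Gamma> F F x + 2 * \<phi> x * F x * \<Gamma> F \<phi> x + (F x)\<^sup>2 * \<Gamma> \<phi> \<phi> x"
        unfolding elim(1) elim(2) elim(3) elim(4) elim(5) elim(6)[symmetric] by algebra
      have cs: "2 * \<phi> x * F x * \<Gamma> F \<phi> x \<le> (\<phi> x)\<^sup>2 * \<Gamma> F F x + (F x)\<^sup>2 * \<Gamma> \<phi> \<phi> x"
        by (rule weighted_AM_GM[OF elim(7,8,9)])
      have "(\<phi> x)\<^sup>2 \<le> c\<^sup>2" using elim(10) by (metis abs_ge_zero power2_abs power_mono)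
      then have 1: "(\<phi> x)\<^sup>2 * \<Gamma> F F x \<le> c\<^sup>2 * \<Gamma> F F x" by (rule mult_right_mono[OF _ elim(8)])
      have "\<Gamma> \<phi> \<phi> x \<le> d" using elim(11) by simp
      then have 2: "(F x)\<^sup>2 * \<Gamma> \<phi> \<phi> x \<le> (F x)\<^sup>2 * d" by (rule mult_left_mono) simp
      have "\<Gamma> (\<lambda>x. F x * \<phi> x) (\<lambda>x. F x * \<phi> x) x \<le> 2 * (c\<^sup>2 * \<Gamma> F F x) + 2 * ((F x)\<^sup>2 * d)"
        unfolding eq using cs 1 2 by linarith
      then show ?case by (simp add: power2_eq_square mult_ac)
    qed
  qed
  also have "\<dots> = 2 * c\<^sup>2 * form F F + 2 * d * (\<integral>x. (F x)\<^sup>2 \<partial>M)"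
    using i by (simp add: dform_def power2_eq_square)
  finally show ?thesis .
qed

text \<open>
  The weak form of \<open>L (F\<^sup>2) = 2 F L F + 2 \<Gamma>(F, F)\<close>, which makes sense without knowing that \<open>F\<^sup>2\<close> lies
  in the domain of \<open>L\<close>.
\<close>

lemma \<Gamma>_square_weak:
  assumes F: "F \<in> gen_dom" and \<phi>: "\<phi> \<in> A0"
  shows "(\<integral>x. \<phi> x * \<Gamma> F F x \<partial>M) = - (\<integral>x. (F x * \<phi> x) * L F x \<partial>M) + (\<integral>x. F x * (F x * L \<phi> x) \<partial>M) / 2"
proof -
  note Ff = gen_dom_form_dom[OF F] and F2 = gen_dom_L2[OF F]
  obtain Fs where Fs: "approx Fs F" using form_dom_approx[OF Ff] by blast
  note Fs0 = approx_A0[OF Fs] and l2 = A0_L2[OF approx_A0[OF Fs]] F2 approx_L2[OF Fs]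
  obtain c where c: "AE x in M. \<bar>\<phi> x\<bar> \<le> c" using A0_bounded[OF \<phi>] by blast
  obtain d where d: "AE x in M. \<bar>\<Gamma> \<phi> \<phi> x\<bar> \<le> d" using A0_bounded[OF \<Gamma>_A0[OF \<phi> \<phi>]] by blast
  obtain e where e: "AE x in M. \<bar>L \<phi> x\<bar> \<le> e" using A0_bounded[OF L_A0[OF \<phi>]] by blast
  obtain B where B: "\<And>n. form (Fs n) (Fs n) \<le> B" "\<And>n. (\<integral>x. (Fs n x)\<^sup>2 \<partial>M) \<le> B"
    using approx_form_bounded[OF Fs Ff] by blast
  let ?\<psi> = "\<lambda>n x. Fs n x * \<phi> x"
  have \<psi>: "?\<psi> n \<in> A0" for n by (rule A0_mult[OF Fs0 \<phi>])
  have "form (?\<psi> n) (?\<psi> n) \<le> 2 * c\<^sup>2 * B + 2 * \<bar>d\<bar> * B" for n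
  proof -
    have d': "AE x in M. \<bar>\<Gamma> \<phi> \<phi> x\<bar> \<le> \<bar>d\<bar>" using d by eventually_elim simp
    have "form (?\<psi> n) (?\<psi> n) \<le> 2 * c\<^sup>2 * form (Fs n) (Fs n) + 2 * \<bar>d\<bar> * (\<integral>x. (Fs n x)\<^sup>2 \<partial>M)"
      by (rule form_mult_le[OF Fs0 \<phi> c d'])
    also have "\<dots> \<le> 2 * c\<^sup>2 * B + 2 * \<bar>d\<bar> * B" by (intro add_mono mult_left_mono B) simp_all
    finally show ?thesis .
  qed
  \<comment> \<open>The products \<open>Fs n * \<phi>\<close> converge in \<open>L2\<close>, but in
    the form only a bound on their energy is available.\<close>
  from form_approx_test[OF Ff Fs \<psi> this]
  have 1: "(\<lambda>n. form (Fs n) (?\<psi> n) - form F (?\<psi> n)) \<longlonglongrightarrow> 0" .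
  have "(\<lambda>n. \<integral>x. ?\<psi> n x * L F x \<partial>M) \<longlonglongrightarrow> (\<integral>x. (F x * \<phi> x) * L F x \<partial>M)"
    by (rule L2_tendsto_mult[OF A0_L2[OF \<psi>] A0_mult_L2[OF F2 \<phi>]
          L2_tendsto_mult_bounded[OF l2 A0_measurable[OF \<phi>] c] L_L2[OF F] L_L2[OF F]]) (simp add: L2_norm_def)
  moreover have "form F (?\<psi> n) = - (\<integral>x. ?\<psi> n x * L F x \<partial>M)" for n
    using L_by_parts[OF F A0_form_dom[OF \<psi>[of n]]] by simp
  ultimately have 2: "(\<lambda>n. form F (?\<psi> n)) \<longlonglongrightarrow> - (\<integral>x. (F x * \<phi> x) * L F x \<partial>M)"
    using tendsto_minus by force
  have 3: "(\<lambda>n. \<integral>x. Fs n x * (Fs n x * L \<phi> x) \<partial>M) \<longlonglongrightarrow> (\<integral>x. F x * (F x * L \<phi> x) \<partial>M)"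
    by (rule L2_tendsto_mult[OF l2 A0_mult_L2[OF l2(1) L_A0[OF \<phi>]] A0_mult_L2[OF F2 L_A0[OF \<phi>]]
          L2_tendsto_mult_bounded[OF l2 A0_measurable[OF L_A0[OF \<phi>]] e]])
  have 4: "(\<lambda>n. \<integral>x. \<phi> x * \<Gamma> (Fs n) (Fs n) x \<partial>M) \<longlonglongrightarrow> (\<integral>x. \<phi> x * \<Gamma> F F x \<partial>M)"
    by (rule L1_limit_mult_bounded[OF \<Gamma>_integrable[OF Ff Ff] \<Gamma>_approx_integrable[OF Fs Fs]
          \<Gamma>_continuous[OF Ff Ff Fs Fs] A0_measurable[OF \<phi>] A0_measurable[OF \<phi>] c]) simp
  \<comment> \<open>Inside \<open>A0\<close> the product rule gives \<open>\<phi> \<Gamma>(f, f) =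
    \<Gamma>(f, f \<phi>) - \<Gamma>(\<phi>, f^2) / 2\<close>. Integrating the last term by parts
    puts \<open>L\<close> on \<open>\<phi>\<close>, so no derivative of \<open>f^2\<close> is
    left.\<close>
  have 5: "(\<integral>x. \<phi> x * \<Gamma> (Fs n) (Fs n) x \<partial>M)
      = form (Fs n) (?\<psi> n) + (\<integral>x. Fs n x * (Fs n x * L \<phi> x) \<partial>M) / 2" for n
  proof -
    note sq = A0_mult[OF Fs0[of n] Fs0[of n]]
    have "AE x in M. \<phi> x * \<Gamma> (Fs n) (Fs n) x
        = \<Gamma> (Fs n) (?\<psi> n) x - \<Gamma> \<phi> (\<lambda>x. Fs n x * Fs n x) x / 2"
      using \<Gamma>_mult[OF Fs0[of n] \<phi> Fs0[of n]] \<Gamma>_sym[OF \<psi>[of n] Fs0[of n]] \<Gamma>_sym[OF \<phi> Fs0[of n]]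
        \<Gamma>_mult[OF Fs0[of n] Fs0[of n] \<phi>] \<Gamma>_sym[OF sq \<phi>]
    proof eventually_elim
      case (elim x)
      then show ?case by (simp add: algebra_simps)
    qed
    then have "(\<integral>x. \<phi> x * \<Gamma> (Fs n) (Fs n) x \<partial>M)
        = (\<integral>x. \<Gamma> (Fs n) (?\<psi> n) x - \<Gamma> \<phi> (\<lambda>x. Fs n x * Fs n x) x / 2 \<partial>M)"
      by (intro integral_cong_AE borel_measurable_times borel_measurable_diff borel_measurable_divide
          borel_measurable_const A0_measurable \<Gamma>_A0 \<phi> Fs0 \<psi> sq)
    also have "\<dots> = form (Fs n) (?\<psi> n) - form \<phi> (\<lambda>x. Fs n x * Fs n x) / 2"
      unfolding dform_def
      using A0_integrable[OF \<Gamma>_A0[OF Fs0 \<psi>], of n n] A0_integrable[OF \<Gamma>_A0[OF \<phi> sq]] by simp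
    also have "form \<phi> (\<lambda>x. Fs n x * Fs n x) = - (\<integral>x. Fs n x * (Fs n x * L \<phi> x) \<partial>M)"
      using L_by_parts_A0[OF \<phi> sq] by (simp add: dform_def mult.assoc)
    finally show ?thesis by simp
  qed
  have "(\<lambda>n. (form (Fs n) (?\<psi> n) - form F (?\<psi> n)) + form F (?\<psi> n)
        + (\<integral>x. Fs n x * (Fs n x * L \<phi> x) \<partial>M) / 2)
      \<longlonglongrightarrow> 0 + - (\<integral>x. (F x * \<phi> x) * L F x \<partial>M) + (\<integral>x. F x * (F x * L \<phi> x) \<partial>M) / 2"
    by (intro tendsto_add tendsto_divide 1 2 3 tendsto_const) simp
  then have "(\<lambda>n. \<integral>x. \<phi> x * \<Gamma> (Fs n) (Fs n) x \<partial>M)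
      \<longlonglongrightarrow> - (\<integral>x. (F x * \<phi> x) * L F x \<partial>M) + (\<integral>x. F x * (F x * L \<phi> x) \<partial>M) / 2"
    by (simp add: 5)
  from LIMSEQ_unique[OF 4 this] show ?thesis .
qed

text \<open>A bounded derivative makes \<open>f\<close> Lipschitz, so \<open>f (Fs n)\<close>
  converges in \<open>L2\<close> and has bounded energy. The derivatives \<open>f' (Fs n)\<close>
  stay bounded and converge almost everywhere, which suffices against the convergence in mean of
  \<open>\<Gamma> (Fs n) (Fs n)\<close>.\<close>

lemma integral_deriv_\<Gamma>:
  fixes f f' :: "real \<Rightarrow> real"
  assumes F: "F \<in> gen_dom"
    and sm: "smooth_fun 1 (\<lambda>v. f (v 0))" "partial_deriv 0 (\<lambda>v. f (v 0)) = (\<lambda>v. f' (v 0))"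
    and f0: "f 0 = 0" and deriv: "\<And>x. (f has_real_derivative f' x) (at x)"
    and bd: "\<And>x. \<bar>f' x\<bar> \<le> C" and cont: "continuous_on UNIV f'"
  shows "(\<integral>x. f' (F x) * \<Gamma> F F x \<partial>M) = - (\<integral>x. f (F x) * L F x \<partial>M)"
proof -
  note Ff = gen_dom_form_dom[OF F] and F2 = gen_dom_L2[OF F]
  obtain Fs where Fs: "approx Fs F" and ae: "AE x in M. (\<lambda>n. Fs n x) \<longlonglongrightarrow> F x"
    using form_dom_approx_AE[OF Ff] by blast
  note Fs0 = approx_A0[OF Fs] and l2 = A0_L2[OF approx_A0[OF Fs]] F2 approx_L2[OF Fs]
  obtain B where B: "\<And>n. form (Fs n) (Fs n) \<le> B" using approx_form_bounded[OF Fs Ff] by blast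
  have C: "0 \<le> C" using bd[of 0] abs_ge_zero order_trans by blast
  have lip: "\<bar>f a - f b\<bar> \<le> C * \<bar>a - b\<bar>" for a b
    using field_differentiable_bound[of UNIV f f' C a b] deriv bd by simp
  have [measurable]: "f' \<in> borel_measurable borel" by (rule borel_measurable_continuous_onI[OF cont])
  have "continuous_on UNIV f" using deriv[THEN DERIV_isCont] by (simp add: continuous_on_eq_continuous_at)
  then have [measurable]: "f \<in> borel_measurable borel" by (rule borel_measurable_continuous_onI)
  have [measurable]: "F \<in> borel_measurable M" by (rule L2_measurable[OF F2])
  have mFs[measurable]: "Fs n \<in> borel_measurable M" for n by (rule A0_measurable[OF Fs0])
  let ?\<psi> = "\<lambda>n x. f (Fs n x)"
  have \<psi>: "?\<psi> n \<in> A0" for n by (rule A0_compose[where f = f, OF Fs0 sm(1) f0])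
  note comp = \<Gamma>_compose[where f = f and f' = f', OF Fs0 _ sm]
  have "form (?\<psi> n) (?\<psi> n) \<le> C\<^sup>2 * B" for n
  proof -
    have "form (?\<psi> n) (?\<psi> n) \<le> (\<integral>x. C\<^sup>2 * \<Gamma> (Fs n) (Fs n) x \<partial>M)"
      unfolding dform_def
    proof (rule integral_mono_AE)
      show "integrable M (\<Gamma> (?\<psi> n) (?\<psi> n))" by (intro A0_integrable \<Gamma>_A0 \<psi>)
      show "integrable M (\<lambda>x. C\<^sup>2 * \<Gamma> (Fs n) (Fs n) x)"
        by (intro integrable_mult_right A0_integrable \<Gamma>_A0 Fs0)
      show "AE x in M. \<Gamma> (?\<psi> n) (?\<psi> n) x \<le> C\<^sup>2 * \<Gamma> (Fs n) (Fs n) x"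
        using comp[OF \<psi>, of n n] \<Gamma>_sym[OF Fs0 \<psi>, of n n] comp[OF Fs0, of n n] \<Gamma>_nonneg_A0[OF Fs0, of n]
      proof eventually_elim
        case (elim x)
        have "\<Gamma> (?\<psi> n) (?\<psi> n) x = (f' (Fs n x))\<^sup>2 * \<Gamma> (Fs n) (Fs n) x"
          unfolding elim(1) elim(2) elim(3) by (simp add: power2_eq_square)
        also have "(f' (Fs n x))\<^sup>2 \<le> C\<^sup>2" using bd by (metis abs_ge_zero power2_abs power_mono)
        then have "(f' (Fs n x))\<^sup>2 * \<Gamma> (Fs n) (Fs n) x \<le> C\<^sup>2 * \<Gamma> (Fs n) (Fs n) x"
          by (rule mult_right_mono[OF _ elim(4)])
        finally show ?case .
      qed
    qed
    also have "\<dots> = C\<^sup>2 * form (Fs n) (Fs n)" by (simp add: dform_def)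
    also have "\<dots> \<le> C\<^sup>2 * B" by (intro mult_left_mono B) simp
    finally show ?thesis .
  qed
  from form_approx_test[OF Ff Fs \<psi> this]
  have 1: "(\<lambda>n. form (Fs n) (?\<psi> n) - form F (?\<psi> n)) \<longlonglongrightarrow> 0" .
  have fF2: "(\<lambda>x. f (F x)) \<in> L2 M"
  proof -
    have "integrable M (\<lambda>x. (f (F x))\<^sup>2)"
    proof (rule Bochner_Integration.integrable_bound)
      show "integrable M (\<lambda>x. C\<^sup>2 * (F x)\<^sup>2)" using F2 by (simp add: L2_def)
      have "(f a)\<^sup>2 \<le> C\<^sup>2 * a\<^sup>2" for a
      proof -
        have "\<bar>f a\<bar>\<^sup>2 \<le> (C * \<bar>a\<bar>)\<^sup>2" using lip[of a 0] f0 by (intro power_mono) simp_all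
        then show ?thesis by (simp add: power_mult_distrib)
      qed
      then show "AE x in M. norm ((f (F x))\<^sup>2) \<le> norm (C\<^sup>2 * (F x)\<^sup>2)" by simp
    qed simp
    then show ?thesis by (simp add: L2_def)
  qed
  have f2: "(\<lambda>n. L2_norm M (\<lambda>x. f (Fs n x) - f (F x))) \<longlonglongrightarrow> 0"
  proof (rule Lim_null_comparison[OF always_eventually], rule allI)
    fix n
    have "(\<integral>x. (f (Fs n x) - f (F x))\<^sup>2 \<partial>M) \<le> (\<integral>x. (C * (Fs n x - F x))\<^sup>2 \<partial>M)"
    proof (rule integral_mono)
      show "integrable M (\<lambda>x. (f (Fs n x) - f (F x))\<^sup>2)"
        using L2_diff[OF A0_L2[OF \<psi>] fF2] by (simp add: L2_def)
      show "integrable M (\<lambda>x. (C * (Fs n x - F x))\<^sup>2)"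
        using L2_cmult[OF L2_diff[OF l2(1,2)]] by (simp add: L2_def)
      fix x
      have "\<bar>f (Fs n x) - f (F x)\<bar>\<^sup>2 \<le> (C * \<bar>Fs n x - F x\<bar>)\<^sup>2" by (intro power_mono lip) simp
      then show "(f (Fs n x) - f (F x))\<^sup>2 \<le> (C * (Fs n x - F x))\<^sup>2" by (simp add: power_mult_distrib)
    qed
    then have "L2_norm M (\<lambda>x. f (Fs n x) - f (F x)) \<le> L2_norm M (\<lambda>x. C * (Fs n x - F x))"
      by (simp add: L2_norm_def)
    then show "norm (L2_norm M (\<lambda>x. f (Fs n x) - f (F x))) \<le> C * L2_norm M (\<lambda>x. Fs n x - F x)"
      using C by (simp add: L2_norm_nonneg L2_norm_cmult)
  next
    show "(\<lambda>n. C * L2_norm M (\<lambda>x. Fs n x - F x)) \<longlonglongrightarrow> 0"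
      using tendsto_mult_left[OF l2(3), of C] by simp
  qed
  have "(\<lambda>n. \<integral>x. ?\<psi> n x * L F x \<partial>M) \<longlonglongrightarrow> (\<integral>x. f (F x) * L F x \<partial>M)"
    by (rule L2_tendsto_mult[OF A0_L2[OF \<psi>] fF2 f2 L_L2[OF F] L_L2[OF F]]) (simp add: L2_norm_def)
  moreover have "form F (?\<psi> n) = - (\<integral>x. ?\<psi> n x * L F x \<partial>M)" for n
    using L_by_parts[OF F A0_form_dom[OF \<psi>[of n]]] by simp
  ultimately have 2: "(\<lambda>n. form F (?\<psi> n)) \<longlonglongrightarrow> - (\<integral>x. f (F x) * L F x \<partial>M)"
    using tendsto_minus by force
  have 3: "(\<lambda>n. \<integral>x. f' (Fs n x) * \<Gamma> (Fs n) (Fs n) x \<partial>M) \<longlonglongrightarrow> (\<integral>x. f' (F x) * \<Gamma> F F x \<partial>M)"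
  proof (rule L1_limit_mult_bounded[OF \<Gamma>_integrable[OF Ff Ff] \<Gamma>_approx_integrable[OF Fs Fs]
          \<Gamma>_continuous[OF Ff Ff Fs Fs]])
    show "AE x in M. \<bar>f' (Fs n x)\<bar> \<le> C" for n by (simp add: bd)
    show "AE x in M. (\<lambda>n. f' (Fs n x)) \<longlonglongrightarrow> f' (F x)"
      using ae
    proof eventually_elim
      case (elim x)
      then show ?case by (rule continuous_on_tendsto_compose[OF cont]) simp_all
    qed
  qed simp_all
  have 4: "form (Fs n) (?\<psi> n) = (\<integral>x. f' (Fs n x) * \<Gamma> (Fs n) (Fs n) x \<partial>M)" for n
    unfolding dform_def
  proof (rule integral_cong_AE)
    show "AE x in M. \<Gamma> (Fs n) (?\<psi> n) x = f' (Fs n x) * \<Gamma> (Fs n) (Fs n) x"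
      using \<Gamma>_sym[OF Fs0 \<psi>, of n n] comp[OF Fs0, of n n] by eventually_elim simp
    show "\<Gamma> (Fs n) (?\<psi> n) \<in> borel_measurable M" by (intro A0_measurable \<Gamma>_A0 Fs0 \<psi>)
    show "(\<lambda>x. f' (Fs n x) * \<Gamma> (Fs n) (Fs n) x) \<in> borel_measurable M"
      using A0_measurable[OF \<Gamma>_A0[OF Fs0 Fs0]] by simp
  qed
  have "(\<lambda>n. (form (Fs n) (?\<psi> n) - form F (?\<psi> n)) + form F (?\<psi> n)) \<longlonglongrightarrow> 0 + - (\<integral>x. f (F x) * L F x \<partial>M)"
    by (intro tendsto_add 1 2)
  then have "(\<lambda>n. \<integral>x. f' (Fs n x) * \<Gamma> (Fs n) (Fs n) x \<partial>M) \<longlonglongrightarrow> - (\<integral>x. f (F x) * L F x \<partial>M)" by (simp add: 4)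
  from LIMSEQ_unique[OF 3 this] show ?thesis .
qed

end

text \<open>The sequence is the difference quotient at \<open>0\<close> of \<open>sin (x t)\<close>,
  taken at \<open>t = 1 / (n + 1)\<close>.\<close>

lemma tendsto_scaled_sin: "(\<lambda>n. real (Suc n) * sin (x / real (Suc n))) \<longlonglongrightarrow> x"
proof -
  have "((\<lambda>t. sin (x * t)) has_real_derivative x) (at 0)"
    by (auto intro!: derivative_eq_intros)
  then have "((\<lambda>t. sin (x * t) / t) \<longlongrightarrow> x) (at 0)"
    by (simp add: has_field_derivative_iff)
  moreover have "filterlim (\<lambda>n. inverse (real (Suc n))) (at 0) sequentially"
    by (auto simp: filterlim_at LIMSEQ_inverse_real_of_nat simp del: of_nat_Suc)
  ultimately have "(\<lambda>n. sin (x * inverse (real (Suc n))) / inverse (real (Suc n))) \<longlonglongrightarrow> x"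
    by (rule filterlim_compose)
  then show ?thesis by (simp add: field_simps del: of_nat_Suc)
qed

context markov_setting
begin

text \<open>
  Integration by parts for \<open>F\<^sup>3\<close> against \<open>F\<close>; since \<open>F\<^sup>3\<close> need not be square integrable it is
  replaced by \<open>c\<^sup>3 sin\<^sup>3 (F / c)\<close>, which it dominates, and \<open>c \<rightarrow> \<infinity>\<close>.
\<close>

lemma integral_square_\<Gamma>:
  assumes F: "F \<in> eigsp lam" and F4: "integrable M (\<lambda>x. F x ^ 4)" and \<Gamma>F: "\<Gamma> F F \<in> L2 M"
  shows "(\<integral>x. (F x)\<^sup>2 * \<Gamma> F F x \<partial>M) = lam / 3 * (\<integral>x. F x ^ 4 \<partial>M)"
proof -
  note Fg = eigenspace_gen_dom[OF F] and F2 = eigenspace_L2[OF F]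
  have [measurable]: "F \<in> borel_measurable M" "\<Gamma> F F \<in> borel_measurable M"
    using L2_measurable F2 \<Gamma>F by auto
  define c where "c n = real (Suc n)" for n
  have c: "0 < c n" for n by (simp add: c_def)
  define s where "s n y = c n * sin (y / c n)" for n and y :: real
  have s_lim: "(\<lambda>n. s n y) \<longlonglongrightarrow> y" for y unfolding s_def c_def by (rule tendsto_scaled_sin)
  have s_le: "\<bar>s n y\<bar> \<le> \<bar>y\<bar>" for n y
  proof -
    have "\<bar>s n y\<bar> = c n * \<bar>sin (y / c n)\<bar>" using c[of n] by (simp add: s_def abs_mult)
    also have "\<dots> \<le> c n * \<bar>y / c n\<bar>" by (intro mult_left_mono abs_sin_x_le_abs_x) (use c[of n] in simp)
    also have "\<dots> = \<bar>y\<bar>" using c[of n] by simp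
    finally show ?thesis .
  qed
  have [measurable]: "s n \<in> borel_measurable borel" for n unfolding s_def by measurable
  have eq: "(\<integral>x. 3 * (s n (F x))\<^sup>2 * cos (F x / c n) * \<Gamma> F F x \<partial>M) = lam * (\<integral>x. s n (F x) ^ 3 * F x \<partial>M)" for n
  proof -
    let ?f = "\<lambda>y. c n ^ 3 * sin (y / c n) ^ 3" and ?f' = "\<lambda>y. 3 * (c n)\<^sup>2 * sin (y / c n) ^ 2 * cos (y / c n)"
    have cn: "c n \<noteq> 0" using c[of n] by simp
    have "(\<integral>x. ?f' (F x) * \<Gamma> F F x \<partial>M) = - (\<integral>x. ?f (F x) * L F x \<partial>M)"
    proof (rule integral_deriv_\<Gamma>[where f = ?f and f' = ?f' and C = "3 * (c n)\<^sup>2", OF Fg])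
      show "smooth_fun 1 (\<lambda>v. ?f (v 0))" by (rule smooth_fun_sin_cubed(1)[OF cn])
      show "partial_deriv 0 (\<lambda>v. ?f (v 0)) = (\<lambda>v. ?f' (v 0))" by (rule smooth_fun_sin_cubed(2)[OF cn])
      show "(?f has_real_derivative ?f' y) (at y)" for y
        using cn by (auto intro!: derivative_eq_intros simp: field_simps power2_eq_square power3_eq_cube)
      have "\<bar>sin y ^ 2 * cos y\<bar> \<le> 1" for y :: real
        unfolding abs_mult power_abs by (intro mult_le_one power_le_one) auto
      then have "3 * (c n)\<^sup>2 * \<bar>sin y ^ 2 * cos y\<bar> \<le> 3 * (c n)\<^sup>2 * 1" for y
        by (intro mult_left_mono) simp_all
      then show "\<bar>?f' y\<bar> \<le> 3 * (c n)\<^sup>2" for y by (simp add: abs_mult mult.assoc)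
      show "continuous_on UNIV ?f'" using cn by (intro continuous_intros) simp_all
    qed simp
    also have "(\<integral>x. ?f (F x) * L F x \<partial>M) = - lam * (\<integral>x. F x * ?f (F x) \<partial>M)"
    proof -
      have "\<bar>c n ^ 3 * sin y ^ 3\<bar> \<le> c n ^ 3" for y
      proof -
        have "\<bar>sin y\<bar> ^ 3 \<le> 1" by (rule power_le_one) simp_all
        then have "c n ^ 3 * \<bar>sin y\<bar> ^ 3 \<le> c n ^ 3 * 1" using c[of n] by (intro mult_left_mono) simp_all
        then show ?thesis using c[of n] by (simp add: abs_mult power_abs)
      qed
      then have "AE x in M. \<bar>?f (F x)\<bar> \<le> c n ^ 3" by simp
      then have "(\<lambda>x. ?f (F x)) \<in> L2 M"
        using L2_mult_bounded[OF L2_const[OF finite_measure_axioms, of 1], of "\<lambda>x. ?f (F x)" "c n ^ 3"] by simp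
      from eigenspace_integral_L[OF F this] show ?thesis by (simp add: mult.commute)
    qed
    finally show ?thesis by (simp add: s_def power_mult_distrib mult_ac)
  qed
  have lim1: "(\<lambda>n. \<integral>x. 3 * (s n (F x))\<^sup>2 * cos (F x / c n) * \<Gamma> F F x \<partial>M) \<longlonglongrightarrow> (\<integral>x. 3 * (F x)\<^sup>2 * 1 * \<Gamma> F F x \<partial>M)"
  proof (rule integral_dominated_convergence[where w = "\<lambda>x. 3 * \<bar>(F x)\<^sup>2 * \<Gamma> F F x\<bar>"])
    \<comment> \<open>The majorant is integrable as a product of two square integrable functions;
      this is what the assumptions on \<open>F x ^ 4\<close> and on \<open>\<Gamma> F F\<close>
      provide.\<close>
    have "(\<lambda>x. (F x)\<^sup>2) \<in> L2 M" using F4 by (simp add: L2_def)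
    from L2_integrable_mult[OF this \<Gamma>F] show "integrable M (\<lambda>x. 3 * \<bar>(F x)\<^sup>2 * \<Gamma> F F x\<bar>)" by simp
    have "(\<lambda>n. y / c n) \<longlonglongrightarrow> 0" for y
    proof -
      have "(\<lambda>n. y * inverse (real (Suc n))) \<longlonglongrightarrow> y * 0"
        by (intro tendsto_mult_left LIMSEQ_inverse_real_of_nat)
      then show ?thesis by (simp add: c_def divide_inverse)
    qed
    then have "(\<lambda>n. cos (y / c n)) \<longlonglongrightarrow> cos 0" for y by (intro tendsto_cos)
    then have "(\<lambda>n. 3 * (s n y)\<^sup>2 * cos (y / c n) * g) \<longlonglongrightarrow> 3 * y\<^sup>2 * 1 * g" for y g
      by (intro tendsto_intros s_lim) simp
    then show "AE x in M. (\<lambda>n. 3 * (s n (F x))\<^sup>2 * cos (F x / c n) * \<Gamma> F F x) \<longlonglongrightarrow> 3 * (F x)\<^sup>2 * 1 * \<Gamma> F F x" by simp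
    have "norm (3 * (s n y)\<^sup>2 * cos (y / c n) * g) \<le> 3 * \<bar>y\<^sup>2 * g\<bar>" for n y g
    proof -
      have "(s n y)\<^sup>2 \<le> y\<^sup>2" using s_le[of n y] by (simp add: abs_le_square_iff)
      then have "(s n y)\<^sup>2 * \<bar>cos (y / c n)\<bar> \<le> y\<^sup>2 * 1" by (intro mult_mono) simp_all
      then have "(s n y)\<^sup>2 * \<bar>cos (y / c n)\<bar> * \<bar>g\<bar> \<le> y\<^sup>2 * 1 * \<bar>g\<bar>" by (rule mult_right_mono) simp
      then show ?thesis by (simp add: abs_mult)
    qed
    then show "AE x in M. norm (3 * (s n (F x))\<^sup>2 * cos (F x / c n) * \<Gamma> F F x) \<le> 3 * \<bar>(F x)\<^sup>2 * \<Gamma> F F x\<bar>" for n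
      by simp
  qed simp_all
  have lim2: "(\<lambda>n. \<integral>x. s n (F x) ^ 3 * F x \<partial>M) \<longlonglongrightarrow> (\<integral>x. F x ^ 3 * F x \<partial>M)"
  proof (rule integral_dominated_convergence[where w = "\<lambda>x. F x ^ 4"])
    have "(\<lambda>n. s n y ^ 3 * y) \<longlonglongrightarrow> y ^ 3 * y" for y by (intro tendsto_intros s_lim)
    then show "AE x in M. (\<lambda>n. s n (F x) ^ 3 * F x) \<longlonglongrightarrow> F x ^ 3 * F x" by simp
    have "norm (s n y ^ 3 * y) \<le> y ^ 4" for n y
    proof -
      have "\<bar>s n y\<bar> ^ 3 * \<bar>y\<bar> \<le> \<bar>y\<bar> ^ 3 * \<bar>y\<bar>" by (intro mult_right_mono power_mono s_le) simp_all
      also have "\<dots> = \<bar>y\<bar> ^ 4" by (simp add: power_Suc2[symmetric])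
      also have "\<dots> = y ^ 4" by (simp add: power_even_abs)
      finally show ?thesis by (simp add: abs_mult power_abs)
    qed
    then show "AE x in M. norm (s n (F x) ^ 3 * F x) \<le> F x ^ 4" for n by simp
  qed (use F4 in simp_all)
  have "(\<integral>x. 3 * (F x)\<^sup>2 * 1 * \<Gamma> F F x \<partial>M) = lam * (\<integral>x. F x ^ 3 * F x \<partial>M)"
    by (rule LIMSEQ_unique[OF lim1]) (simp only: eq tendsto_mult_left[OF lim2])
  moreover have "(\<integral>x. F x ^ 3 * F x \<partial>M) = (\<integral>x. F x ^ 4 \<partial>M)"
    by (rule Bochner_Integration.integral_cong) (simp_all add: power_Suc2[symmetric])
  moreover have "(\<integral>x. 3 * (F x)\<^sup>2 * 1 * \<Gamma> F F x \<partial>M) = 3 * (\<integral>x. (F x)\<^sup>2 * \<Gamma> F F x \<partial>M)"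
    by (simp add: mult.assoc)
  ultimately show ?thesis by simp
qed

section \<open>Chaotic eigenfunctions: the shifted square and the pseudo-inverse\<close>

lemma eigenfunction_centered:
  assumes "F \<in> eigsp lam" "lam \<noteq> 0"
  shows "(\<integral>x. F x \<partial>M) = 0"
  using eigenspace_integral_L[OF assms(1) L2_const[OF finite_measure_axioms, of 1]]
    integral_L[OF eigenspace_gen_dom[OF assms(1)]] assms(2) by simp

lemma chaotic_square:
  fixes c :: real
  assumes chaotic: "chaotic_with M A0 \<Gamma> L F lam \<eta>" and lam: "0 < lam" and F: "eigenfunction M A0 \<Gamma> L F lam"
    and F4: "integrable M (\<lambda>x. F x ^ 4)"
  defines "h \<equiv> \<lambda>x. (F x)\<^sup>2 + c * F x"
  shows "h \<in> gen_dom" "AE x in M. L h x = 2 * \<Gamma> F F x - 2 * lam * (F x)\<^sup>2 - c * lam * F x"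
    and "(\<integral>x. (L h x)\<^sup>2 \<partial>M) \<le> - (\<eta> * lam) * (\<integral>x. h x * L h x \<partial>M)"
proof -
  let ?I = "{\<kappa>. - \<kappa> \<in> eigvals \<and> \<kappa> \<le> \<eta> * lam}"
  have Fe: "F \<in> eigsp lam" using F by (simp add: eigenfunction_def)
  note Fg = eigenspace_gen_dom[OF Fe] and F2 = eigenspace_L2[OF Fe]
  have \<eta>: "1 < \<eta>" and hs: "(\<lambda>x. (F x)\<^sup>2) \<in> hilbert_sum M ?I eigsp"
    using chaotic by (auto simp: chaotic_with_def)
  have lamI: "lam \<in> ?I" using F \<eta> lam by (auto simp: eigenvalues_def)
  have [measurable]: "F \<in> borel_measurable M" by (rule L2_measurable[OF F2])
  have Fsq: "(\<lambda>x. (F x)\<^sup>2) \<in> L2 M" using F4 by (simp add: L2_def)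
  have hL2: "h \<in> L2 M" unfolding h_def by (intro L2_add Fsq L2_cmult F2)
  \<comment> \<open>The value that the diffusion formula
    \<open>L F^2 = 2 F L F + 2 \<Gamma>(F, F)\<close> and \<open>L F = - lam F\<close> predict for
    \<open>L h\<close>.\<close>
  define H where "H x = 2 * \<Gamma> F F x - 2 * lam * (F x)\<^sup>2 - c * lam * F x" for x
  note \<Gamma>i = \<Gamma>_integrable[OF gen_dom_form_dom[OF Fg] gen_dom_form_dom[OF Fg]]
  have Hi: "integrable M H"
    unfolding H_def using \<Gamma>i L2_integrable[OF finite_measure_axioms Fsq] L2_integrable[OF finite_measure_axioms F2] by simp
  have eq: "(\<integral>x. h x * L \<phi> x \<partial>M) = (\<integral>x. H x * \<phi> x \<partial>M)" if \<phi>: "\<phi> \<in> A0" for \<phi>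
  proof -
    obtain d where d: "AE x in M. \<bar>\<phi> x\<bar> \<le> d" using A0_bounded[OF \<phi>] by blast
    have i0: "integrable M (\<lambda>x. \<phi> x * \<Gamma> F F x)"
    proof (rule Bochner_Integration.integrable_bound)
      show "integrable M (\<lambda>x. d * \<Gamma> F F x)" using \<Gamma>i by simp
      show "(\<lambda>x. \<phi> x * \<Gamma> F F x) \<in> borel_measurable M" using A0_measurable[OF \<phi>] \<Gamma>i by simp
      show "AE x in M. norm (\<phi> x * \<Gamma> F F x) \<le> norm (d * \<Gamma> F F x)"
        using d by eventually_elim (simp add: abs_mult mult_right_mono)
    qed
    note F\<phi> = A0_mult_L2[OF F2 \<phi>] and FL\<phi> = A0_mult_L2[OF F2 L_A0[OF \<phi>]]
    have i1: "integrable M (\<lambda>x. F x * (F x * \<phi> x))" by (rule L2_integrable_mult[OF F2 F\<phi>])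
    have i2: "integrable M (\<lambda>x. F x * (F x * L \<phi> x))" by (rule L2_integrable_mult[OF F2 FL\<phi>])
    have i3: "integrable M (\<lambda>x. F x * \<phi> x)" by (rule L2_integrable[OF finite_measure_axioms F\<phi>])
    have i4: "integrable M (\<lambda>x. F x * L \<phi> x)" by (rule L2_integrable[OF finite_measure_axioms FL\<phi>])
    have "(\<integral>x. (F x * \<phi> x) * L F x \<partial>M) = - lam * (\<integral>x. F x * (F x * \<phi> x) \<partial>M)"
      using eigenspace_integral_L[OF Fe F\<phi>] by (simp add: mult.commute)
    with \<Gamma>_square_weak[OF Fg \<phi>]
    have "(\<integral>x. F x * (F x * L \<phi> x) \<partial>M) = 2 * (\<integral>x. \<phi> x * \<Gamma> F F x \<partial>M) - 2 * lam * (\<integral>x. F x * (F x * \<phi> x) \<partial>M)"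
      by simp
    moreover have "(\<integral>x. F x * L \<phi> x \<partial>M) = - lam * (\<integral>x. F x * \<phi> x \<partial>M)"
      by (rule eigenspace_integral_L'[OF Fe A0_gen_dom[OF \<phi>]])
    moreover have "(\<integral>x. h x * L \<phi> x \<partial>M) = (\<integral>x. F x * (F x * L \<phi> x) \<partial>M) + c * (\<integral>x. F x * L \<phi> x \<partial>M)"
      using i2 i4 by (simp add: h_def distrib_right power2_eq_square mult.assoc)
    moreover have "(\<integral>x. H x * \<phi> x \<partial>M)
        = (\<integral>x. 2 * (\<phi> x * \<Gamma> F F x) - 2 * lam * (F x * (F x * \<phi> x)) - c * lam * (F x * \<phi> x) \<partial>M)"
      by (rule Bochner_Integration.integral_cong) (simp_all add: H_def power2_eq_square algebra_simps)
    then have "(\<integral>x. H x * \<phi> x \<partial>M)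
        = 2 * (\<integral>x. \<phi> x * \<Gamma> F F x \<partial>M) - 2 * lam * (\<integral>x. F x * (F x * \<phi> x) \<partial>M) - c * lam * (\<integral>x. F x * \<phi> x \<partial>M)"
      using i0 i1 i3 by simp
    ultimately show ?thesis by simp
  qed
  obtain S T :: "nat \<Rightarrow> 'a \<Rightarrow> real" where ST: "\<And>n. S n \<in> L2 M" "\<And>n. T n \<in> L2 M"
    "(\<lambda>n. L2_norm M (\<lambda>x. S n x - ((F x)\<^sup>2 + c * F x))) \<longlonglongrightarrow> 0"
    "\<And>n G. G \<in> gen_dom \<Longrightarrow> (\<integral>x. S n x * L G x \<partial>M) = (\<integral>x. T n x * G x \<partial>M)"
    "\<And>n. (\<integral>x. (T n x)\<^sup>2 \<partial>M) \<le> - (\<eta> * lam) * (\<integral>x. S n x * T n x \<partial>M)"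
    by (rule hilbert_sum_approx[OF hs lamI Fe, where K = "\<eta> * lam" and c = c]) auto
  have K: "0 \<le> \<eta> * lam" using \<eta> lam by simp
  have Sh: "(\<lambda>n. L2_norm M (\<lambda>x. S n x - h x)) \<longlonglongrightarrow> 0" using ST(3) by (simp only: h_def)
  note w = gen_dom_weak_limit[OF hL2 Hi eq ST(1) Sh ST(2) ST(4) K ST(5)]
  show "h \<in> gen_dom" by (rule w(1))
  show "AE x in M. L h x = 2 * \<Gamma> F F x - 2 * lam * (F x)\<^sup>2 - c * lam * F x" using w(2) by (simp add: H_def)
  show "(\<integral>x. (L h x)\<^sup>2 \<partial>M) \<le> - (\<eta> * lam) * (\<integral>x. h x * L h x \<partial>M)" by (rule w(3))
qed

text \<open>The two parts of \<open>h\<close> are treated differently: against \<open>F^2\<close>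
  the formula for \<open>L h\<close> reduces to \<open>integral_square_\<Gamma>\<close>, while
  against \<open>F\<close> symmetry moves \<open>L\<close> onto the eigenfunction. For centered
  \<open>F\<close> the result is \<open>- lam / 6 \<integral> (2 F + c)^3 F\<close>.\<close>

lemma integral_square_L_square:
  fixes c :: real
  assumes F: "F \<in> eigsp lam" and F4: "integrable M (\<lambda>x. F x ^ 4)"
  defines "h \<equiv> \<lambda>x. (F x)\<^sup>2 + c * F x"
  assumes h: "h \<in> gen_dom" and Lh: "AE x in M. L h x = 2 * \<Gamma> F F x - 2 * lam * (F x)\<^sup>2 - c * lam * F x"
  shows "(\<integral>x. h x * L h x \<partial>M)
    = - lam * (4 / 3 * (\<integral>x. F x ^ 4 \<partial>M) + 2 * c * (\<integral>x. F x ^ 3 \<partial>M) + c\<^sup>2 * (\<integral>x. (F x)\<^sup>2 \<partial>M))"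
proof -
  note Fg = eigenspace_gen_dom[OF F] and F2 = eigenspace_L2[OF F]
  have Fsq: "(\<lambda>x. (F x)\<^sup>2) \<in> L2 M" using F4 L2_measurable[OF F2] by (simp add: L2_def)
  have [measurable]: "F \<in> borel_measurable M" "L h \<in> borel_measurable M" "\<Gamma> F F \<in> borel_measurable M"
    using L2_measurable[OF F2] L2_measurable[OF L_L2[OF h]]
      \<Gamma>_integrable[OF gen_dom_form_dom[OF Fg] gen_dom_form_dom[OF Fg]] by auto
  \<comment> \<open>\<open>\<Gamma> F F\<close> is known a priori only to be integrable; solving the
    formula for \<open>L h\<close> for it yields square integrability.\<close>
  have "(\<lambda>x. 1 / 2 * L h x + (lam * (F x)\<^sup>2 + c * lam / 2 * F x)) \<in> L2 M"
    by (intro L2_add L2_cmult L_L2 h Fsq F2)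
  then have \<Gamma>2: "\<Gamma> F F \<in> L2 M"
  proof (rule L2_cong_AE)
    show "AE x in M. 1 / 2 * L h x + (lam * (F x)\<^sup>2 + c * lam / 2 * F x) = \<Gamma> F F x"
      using Lh by eventually_elim (simp add: field_simps)
  qed simp
  have i3: "integrable M (\<lambda>x. F x ^ 3)"
    using L2_integrable_mult[OF Fsq F2] by (simp add: power2_eq_square power3_eq_cube mult.assoc)
  have i2: "integrable M (\<lambda>x. (F x)\<^sup>2)" using F2 by (simp add: L2_def)
  note i\<Gamma> = L2_integrable_mult[OF Fsq \<Gamma>2]
  have "(\<integral>x. (F x)\<^sup>2 * L h x \<partial>M) = (\<integral>x. 2 * ((F x)\<^sup>2 * \<Gamma> F F x) - 2 * lam * F x ^ 4 - c * lam * F x ^ 3 \<partial>M)"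
  proof (rule integral_cong_AE)
    show "AE x in M. (F x)\<^sup>2 * L h x = 2 * ((F x)\<^sup>2 * \<Gamma> F F x) - 2 * lam * F x ^ 4 - c * lam * F x ^ 3"
      using Lh
    proof eventually_elim
      case (elim x)
      show ?case unfolding elim by algebra
    qed
  qed simp_all
  also have "\<dots> = 2 * (\<integral>x. (F x)\<^sup>2 * \<Gamma> F F x \<partial>M) - 2 * lam * (\<integral>x. F x ^ 4 \<partial>M) - c * lam * (\<integral>x. F x ^ 3 \<partial>M)"
    using i\<Gamma> F4 i3 by simp
  finally have 1: "(\<integral>x. (F x)\<^sup>2 * L h x \<partial>M) = - (4 / 3) * lam * (\<integral>x. F x ^ 4 \<partial>M) - c * lam * (\<integral>x. F x ^ 3 \<partial>M)"
    unfolding integral_square_\<Gamma>[OF F F4 \<Gamma>2] by simp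
  have "(\<integral>x. F x * L h x \<partial>M) = - lam * (\<integral>x. F x * h x \<partial>M)" by (rule eigenspace_integral_L'[OF F h])
  also have "(\<integral>x. F x * h x \<partial>M) = (\<integral>x. F x ^ 3 + c * (F x)\<^sup>2 \<partial>M)"
    by (rule Bochner_Integration.integral_cong) (simp_all add: h_def power2_eq_square power3_eq_cube algebra_simps)
  also have "\<dots> = (\<integral>x. F x ^ 3 \<partial>M) + c * (\<integral>x. (F x)\<^sup>2 \<partial>M)" using i3 i2 by simp
  finally have 2: "(\<integral>x. F x * L h x \<partial>M) = - lam * ((\<integral>x. F x ^ 3 \<partial>M) + c * (\<integral>x. (F x)\<^sup>2 \<partial>M))" .
  have "(\<integral>x. h x * L h x \<partial>M) = (\<integral>x. (F x)\<^sup>2 * L h x + c * (F x * L h x) \<partial>M)"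
    by (rule Bochner_Integration.integral_cong) (simp_all add: h_def algebra_simps)
  also have "\<dots> = (\<integral>x. (F x)\<^sup>2 * L h x \<partial>M) + c * (\<integral>x. F x * L h x \<partial>M)"
    using L2_integrable_mult[OF Fsq L_L2[OF h]] L2_integrable_mult[OF F2 L_L2[OF h]] by simp
  finally show ?thesis unfolding 1 2 by (simp add: algebra_simps power2_eq_square)
qed

text \<open>The definition chooses by \<open>SOME\<close>, so a witness and uniqueness are both
  required. The witness is \<open>- F / lam\<close> with \<open>K = m\<close> and
  \<open>R = F\<close>. For any other choice \<open>R - F\<close> is constant and centered, hence
  null, and so is \<open>Y + F / lam\<close>, which lies in the kernel of \<open>L\<close>.\<close>

lemma pseudo_inverse_eigenfunction:
  assumes F: "F \<in> eigsp lam" and lam: "lam \<noteq> 0"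
  shows "pseudo_inverse M A0 \<Gamma> L (\<lambda>x. F x + m) \<in> gen_dom"
    and "AE x in M. pseudo_inverse M A0 \<Gamma> L (\<lambda>x. F x + m) x = - 1 / lam * F x"
proof -
  define P where "P Y \<longleftrightarrow> Y \<in> gen_range M A0 \<Gamma> L \<inter> gen_dom \<and>
        (\<exists>K R. K \<in> eigsp 0 \<and> R \<in> gen_range M A0 \<Gamma> L \<inter> gen_dom \<and>
               (AE x in M. F x + m = K x + R x) \<and> (AE x in M. L Y x = R x))" for Y
  note Fg = eigenspace_gen_dom[OF F]
  have scale: "(\<lambda>x. c * F x) \<in> gen_dom" "AE x in M. L (\<lambda>x. c * F x) x = c * (- lam * F x)" for c
  proof -
    show "(\<lambda>x. c * F x) \<in> gen_dom" using gen_dom_lincomb(1)[OF Fg Fg, of c 0] by simp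
    have "AE x in M. L (\<lambda>x. c * F x) x = c * L F x" using gen_dom_lincomb(2)[OF Fg Fg, of c 0] by simp
    then show "AE x in M. L (\<lambda>x. c * F x) x = c * (- lam * F x)"
      using eigenspace_L[OF F] by eventually_elim simp
  qed
  have range: "(\<lambda>x. c * F x) \<in> gen_range M A0 \<Gamma> L" for c
  proof -
    have "AE x in M. L (\<lambda>x. - c / lam * F x) x = c * F x"
      using scale(2)[of "- c / lam"] by eventually_elim (use lam in simp)
    then show ?thesis
      using scale(1)[of "- c / lam"] gen_dom_L2[OF scale(1)[of c]] by (auto simp: gen_range_def)
  qed
  have "(\<lambda>x. - 1 / lam * F x) \<in> gen_range M A0 \<Gamma> L \<inter> gen_dom" using range scale(1) by blast
  moreover have "(\<lambda>_. m) \<in> eigsp 0" using const_gen_dom L_const by (simp add: eigenspace_def)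
  moreover have "F \<in> gen_range M A0 \<Gamma> L \<inter> gen_dom" using range[of 1] Fg by simp
  moreover have "AE x in M. F x + m = m + F x" by simp
  moreover have "AE x in M. L (\<lambda>x. - 1 / lam * F x) x = F x"
    using scale(2)[of "- 1 / lam"] by eventually_elim (use lam in simp)
  ultimately have "P (\<lambda>x. - 1 / lam * F x)" unfolding P_def by blast
  define Y where "Y = pseudo_inverse M A0 \<Gamma> L (\<lambda>x. F x + m)"
  have "Y = (SOME Y. P Y)" by (simp only: Y_def pseudo_inverse_def P_def)
  with \<open>P (\<lambda>x. - 1 / lam * F x)\<close> have "P Y" by (simp only: someI[of P])
  then obtain K R where Y: "Y \<in> gen_range M A0 \<Gamma> L" "Y \<in> gen_dom" and K: "K \<in> eigsp 0"
    and R: "R \<in> gen_range M A0 \<Gamma> L" "R \<in> gen_dom"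
    and KR: "AE x in M. F x + m = K x + R x" and LY: "AE x in M. L Y x = R x"
    unfolding P_def by blast
  have range_centered: "(\<integral>x. Z x \<partial>M) = 0" if Z: "Z \<in> gen_range M A0 \<Gamma> L" for Z
  proof -
    obtain W where W: "W \<in> gen_dom" "AE x in M. L W x = Z x" "Z \<in> L2 M" using Z by (auto simp: gen_range_def)
    have "(\<integral>x. Z x \<partial>M) = (\<integral>x. L W x \<partial>M)"
      by (rule integral_cong_AE) (use W L2_measurable L_L2[OF W(1)] in \<open>auto elim: eventually_mono\<close>)
    then show ?thesis using integral_L[OF W(1)] by simp
  qed
  have const_centered: "k = 0" if "f \<in> L2 M" "AE x in M. f x = k" "(\<integral>x. f x \<partial>M) = 0" for f k
  proof -
    have "(\<integral>x. f x \<partial>M) = (\<integral>x. k \<partial>M)"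
      by (rule integral_cong_AE) (use that L2_measurable in auto)
    then show ?thesis using that(3) by (simp add: prob_space)
  qed
  have fm: "finite_measure M" by (rule finite_measure_axioms)
  note i = L2_integrable[OF fm gen_dom_L2]
  have "AE x in M. L K x = 0" using eigenspace_L[OF K] by simp
  then obtain k where k: "AE x in M. K x = k"
    using L_ker_const[OF eigenspace_gen_dom[OF K]] by (auto simp: ae_const_def)
  have RF: "AE x in M. R x = F x"
  proof -
    have ae: "AE x in M. R x - F x = m - k" using KR k by eventually_elim simp
    have "(\<integral>x. R x - F x \<partial>M) = 0"
      using i[OF R(2)] i[OF Fg] range_centered[OF R(1)] eigenfunction_centered[OF F lam] by simp
    then have "m - k = 0"
      by (rule const_centered[OF L2_diff[OF gen_dom_L2[OF R(2)] gen_dom_L2[OF Fg]] ae])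
    with ae show ?thesis by simp
  qed
  have YF: "AE x in M. Y x = - 1 / lam * F x"
  proof -
    let ?D = "\<lambda>x. 1 * Y x + (1 / lam) * F x"
    note D = gen_dom_lincomb[OF Y(2) Fg, of 1 "1 / lam"]
    have "AE x in M. L ?D x = 0"
      using D(2) LY RF eigenspace_L[OF F] by eventually_elim (use lam in simp)
    then obtain d where d: "AE x in M. ?D x = d" using L_ker_const[OF D(1)] by (auto simp: ae_const_def)
    have "(\<integral>x. ?D x \<partial>M) = 0"
      using i[OF Y(2)] i[OF Fg] range_centered[OF Y(1)] eigenfunction_centered[OF F lam] by simp
    then have "d = 0" by (rule const_centered[OF gen_dom_L2[OF D(1)] d])
    show ?thesis using d by eventually_elim (use \<open>d = 0\<close> in simp)
  qed
  show "pseudo_inverse M A0 \<Gamma> L (\<lambda>x. F x + m) \<in> gen_dom" using Y(2) by (simp add: Y_def)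
  show "AE x in M. pseudo_inverse M A0 \<Gamma> L (\<lambda>x. F x + m) x = - 1 / lam * F x" using YF by (simp add: Y_def)
qed

text \<open>The shift by \<open>m\<close> contributes nothing by \<open>\<Gamma>_const\<close>. The
  pseudo-inverse is known only almost everywhere, so it enters \<open>\<Gamma>\<close> through
  \<open>\<Gamma>_cong_AE\<close>.\<close>

lemma \<Gamma>_pseudo_inverse:
  fixes m :: real
  assumes F: "F \<in> eigsp lam" and lam: "lam \<noteq> 0"
  defines "G \<equiv> \<lambda>x. F x + m"
  defines "Z \<equiv> \<lambda>y. - pseudo_inverse M A0 \<Gamma> L G y"
  shows "AE x in M. \<Gamma> G Z x = \<Gamma> F F x / lam" and "integrable M (\<Gamma> G Z)"
proof -
  note Ff = gen_dom_form_dom[OF eigenspace_gen_dom[OF F]]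
  note Cf = gen_dom_form_dom[OF const_gen_dom[of m]]
  note p = pseudo_inverse_eigenfunction[OF F lam, of m, folded G_def]
  note pf = gen_dom_form_dom[OF p(1)]
  have Gf: "G \<in> form_dom" using form_dom_lincomb[OF Ff Cf, of 1 1] by (simp add: G_def)
  have Zf: "Z \<in> form_dom" using form_dom_lincomb[OF pf pf, of "- 1" 0] by (simp add: Z_def)
  show "integrable M (\<Gamma> G Z)" by (rule \<Gamma>_integrable[OF Gf Zf])
  let ?F = "\<lambda>x. 1 / lam * F x + 0 * F x"
  have F'f: "?F \<in> form_dom" by (rule form_dom_lincomb[OF Ff Ff])
  have ZF: "AE x in M. Z x = ?F x" using p(2) by eventually_elim (simp add: Z_def)
  have GF: "AE x in M. \<Gamma> G F x = 1 * \<Gamma> F F x + 1 * \<Gamma> (\<lambda>_. m) F x"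
    using \<Gamma>_linear_form_dom[OF Ff Cf Ff, of 1 1] by (simp add: G_def)
  show "AE x in M. \<Gamma> G Z x = \<Gamma> F F x / lam"
    using \<Gamma>_sym_form_dom[OF Gf Zf] \<Gamma>_cong_AE[OF Zf F'f ZF Gf] \<Gamma>_linear_form_dom[OF Ff Ff Gf, of "1 / lam" 0]
      \<Gamma>_sym_form_dom[OF Ff Gf] GF \<Gamma>_const[OF Ff, of m]
    by eventually_elim simp
qed

end

section \<open>The inequality for a Pearson target\<close>

theorem theorem3p8:
  fixes M :: "'a measure"
    and A A0 :: "('a \<Rightarrow> real) set"
    and \<Gamma> :: "('a \<Rightarrow> real) \<Rightarrow> ('a \<Rightarrow> real) \<Rightarrow> 'a \<Rightarrow> real"
    and L :: "('a \<Rightarrow> real) \<Rightarrow> 'a \<Rightarrow> real"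
    and P :: "'w measure" and \<F> :: "real \<Rightarrow> 'w measure"
    and B X :: "real \<Rightarrow> 'w \<Rightarrow> real"
    and \<nu> :: "real measure"
    and m b0 b1 b2 lam \<eta> :: real
    and F G :: "'a \<Rightarrow> real"
  assumes setting: "markov_setting M A A0 \<Gamma> L"
    and pearson: "pearson_distribution P \<F> B X (1/2) m (quad_b b0 b1 b2) \<nu>"
    and fourth_moment: "integrable \<nu> (\<lambda>x. x ^ 4)" and b2: "b2 < 1/3"
    and chaotic: "chaotic_eigenfunction M A0 \<Gamma> L F lam"
    and grade: "chaos_grade M A0 \<Gamma> L F lam \<eta>"
    and moments: "\<And>k. k \<le> 4 \<Longrightarrow> integrable M (\<lambda>x. F x ^ k)"
    and G: "G = (\<lambda>x. F x + m)"
  shows "integrable M (\<lambda>x. (\<Gamma> G (\<lambda>y. - pseudo_inverse M A0 \<Gamma> L G y) x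
                            - poly (quad_b b0 b1 b2) (G x))\<^sup>2) \<and>
    (\<eta> \<le> 2 * (1 - b2) \<longrightarrow>
       (\<integral>x. (\<Gamma> G (\<lambda>y. - pseudo_inverse M A0 \<Gamma> L G y) x
              - poly (quad_b b0 b1 b2) (G x))\<^sup>2 \<partial>M)
         \<le> 2 * (1 - b2 - \<eta> / 4) * (\<integral>x. poly (poly_U m b0 b1 b2) (G x) \<partial>M)) \<and>
    (\<eta> > 2 * (1 - b2) \<longrightarrow>
       (let \<xi> = \<eta> - 2 * (1 - b2) in
       (\<integral>x. (\<Gamma> G (\<lambda>y. - pseudo_inverse M A0 \<Gamma> L G y) x
              - poly (quad_b b0 b1 b2) (G x))\<^sup>2 \<partial>M)
         \<le> 2 * (1 - b2 - \<eta> / 4) * (\<integral>x. poly (poly_U m b0 b1 b2) (G x) \<partial>M)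
            + \<xi> * (1 - b2) / 2 * (\<integral>x. (poly (poly_Q m b0 b1 b2) (G x))\<^sup>2 \<partial>M)))"
proof -
  interpret markov_setting M A A0 \<Gamma> L by (rule setting)
  have lam: "0 < lam" and Fe: "eigenfunction M A0 \<Gamma> L F lam" using chaotic by (auto simp: chaotic_eigenfunction_def)
  have F: "F \<in> eigsp lam" using Fe by (simp add: eigenfunction_def)
  have ch: "chaotic_with M A0 \<Gamma> L F lam \<eta>" using grade by (simp add: chaos_grade_def)
  note F4 = moments[of 4, simplified] and F3 = moments[of 3, simplified] and Fsq = moments[of 2, simplified]
    and F1 = moments[of 1, simplified]
  have F2: "F \<in> L2 M" by (rule eigenspace_L2[OF F])
  \<comment> \<open>\<open>q1\<close> is the linear coefficient of \<open>Q\<close>, and the Taylor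
    coefficients at \<open>m\<close> are \<open>c = Q'(m)\<close> and \<open>q = Q(m)\<close>, so
    that \<open>Q (F + m) = F^2 + c F + q\<close>.\<close>
  define q1 where "q1 = 2 * (b1 + m) / (2 * b2 - 1)"
  define c where "c = 2 * m + q1"
  define q where "q = m\<^sup>2 + q1 * m + 1 / (b2 - 1) * (b0 + m * (b1 + m) / (2 * b2 - 1))"
  define \<beta> where "\<beta> = 1 - b2"
  have nz: "2 * b2 - 1 \<noteq> 0" "b2 - 1 \<noteq> 0" and \<beta>: "0 < \<beta>" using b2 by (auto simp: \<beta>_def)
  define h where "h = (\<lambda>x. (F x)\<^sup>2 + c * F x)"
  have sq: "h \<in> gen_dom" "AE x in M. L h x = 2 * \<Gamma> F F x - 2 * lam * (F x)\<^sup>2 - c * lam * F x"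
    "(\<integral>x. (L h x)\<^sup>2 \<partial>M) \<le> - (\<eta> * lam) * (\<integral>x. h x * L h x \<partial>M)"
    unfolding h_def by (rule chaotic_square[OF ch lam Fe F4])+
  have hX: "(\<integral>x. h x * L h x \<partial>M)
    = - lam * (4 / 3 * (\<integral>x. F x ^ 4 \<partial>M) + 2 * c * (\<integral>x. F x ^ 3 \<partial>M) + c\<^sup>2 * (\<integral>x. (F x)\<^sup>2 \<partial>M))"
    unfolding h_def by (rule integral_square_L_square[OF F F4 sq(1,2)[unfolded h_def]])
  define Xh where "Xh = (\<integral>x. h x * L h x \<partial>M)"
  define R where "R = (\<integral>x. (h x + q)\<^sup>2 \<partial>M)"
  have R: "0 \<le> R" by (simp add: R_def)
  have hq2: "(\<lambda>x. h x + q) \<in> L2 M"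
    by (intro L2_add gen_dom_L2 sq(1) L2_const finite_measure_axioms)
  have Lh2: "L h \<in> L2 M" by (rule L_L2[OF sq(1)])
  have Q: "poly (poly_Q m b0 b1 b2) (G x) = h x + q" for x
    unfolding poly_Q_def q1_def[symmetric] G h_def c_def q_def
    by (simp add: power2_eq_square algebra_simps)
  have Q': "poly (pderiv (poly_Q m b0 b1 b2)) (G x) = 2 * F x + c" for x
    unfolding poly_Q_def q1_def[symmetric] G c_def by (simp add: pderiv_pCons algebra_simps)
  have U: "poly (poly_U m b0 b1 b2) (G x)
      = \<beta> * (h x + q)\<^sup>2 - 1 / 12 * (8 * F x ^ 4 + 12 * c * F x ^ 3 + 6 * c\<^sup>2 * (F x)\<^sup>2 + c ^ 3 * F x)" for x
  proof -
    have "poly (poly_U m b0 b1 b2) (G x) = \<beta> * (h x + q)\<^sup>2 - 1 / 12 * ((2 * F x + c) ^ 3 * F x)"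
      unfolding poly_U_def by (simp add: Q Q' \<beta>_def) (simp add: G, algebra)
    also have "(2 * F x + c) ^ 3 * F x = 8 * F x ^ 4 + 12 * c * F x ^ 3 + 6 * c\<^sup>2 * (F x)\<^sup>2 + c ^ 3 * F x" by algebra
    finally show ?thesis .
  qed
  have iR: "integrable M (\<lambda>x. (h x + q)\<^sup>2)" using hq2 by (simp add: L2_def)
  have "(\<integral>x. poly (poly_U m b0 b1 b2) (G x) \<partial>M)
    = \<beta> * R - 1 / 12 * (8 * (\<integral>x. F x ^ 4 \<partial>M) + 12 * c * (\<integral>x. F x ^ 3 \<partial>M) + 6 * c\<^sup>2 * (\<integral>x. (F x)\<^sup>2 \<partial>M) + c ^ 3 * (\<integral>x. F x \<partial>M))"
    unfolding U R_def using iR F4 F3 Fsq F1 by simp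
  \<comment> \<open>The first moment vanishes by centering, and the other three occur in exactly the
    proportions \<open>8 : 12 c : 6 c^2\<close> of \<open>Xh\<close>.\<close>
  also have "\<dots> = \<beta> * R + Xh / (2 * lam)"
    using eigenfunction_centered[OF F] lam unfolding Xh_def hX by (simp add: field_simps)
  finally have intU: "(\<integral>x. poly (poly_U m b0 b1 b2) (G x) \<partial>M) = \<beta> * R + Xh / (2 * lam)" .
  define w where "w = (b1 + m) / (2 * b2 - 1)"
  have w: "w * (2 * b2 - 1) = b1 + m" using nz by (simp add: w_def)
  \<comment> \<open>The right-hand sides here and in \<open>coeff'\<close> are
    \<open>- b'(m)\<close> and \<open>- b(m)\<close>: the two conditions under which the linear and
    constant terms of \<open>V\<close> and \<open>W\<close> coincide. The quadratic terms match by
    the choice of \<open>\<beta>\<close>.\<close>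
  have coeff: "c * (1 / 2 - b2) = - (2 * b2 * m + b1)"
  proof -
    have "c = 2 * m + 2 * w" by (simp add: c_def q1_def w_def)
    then have "c * (1 / 2 - b2) = m * (1 - 2 * b2) - w * (2 * b2 - 1)"
      by (simp add: algebra_simps)
    then show ?thesis unfolding w by (simp add: algebra_simps)
  qed
  have coeff': "\<beta> * q = - (b2 * m\<^sup>2 + b1 * m + b0)"
  proof -
    define u where "u = (b0 + m * w) / (b2 - 1)"
    have u: "(b2 - 1) * u = b0 + m * w" using nz by (simp add: u_def)
    have "q = m\<^sup>2 + 2 * w * m + u" by (simp add: q_def q1_def w_def u_def)
    then have "(b2 - 1) * q = (b2 - 1) * (m\<^sup>2 + 2 * w * m) + (b2 - 1) * u" by (simp add: algebra_simps)
    then have "(b2 - 1) * q = (b2 - 1) * (m\<^sup>2 + 2 * w * m) + (b0 + m * w)" unfolding u .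
    then have "\<beta> * q = (1 - b2) * m\<^sup>2 - w * (2 * b2 - 1) * m - b0"
      unfolding \<beta>_def by algebra
    then show ?thesis unfolding w by algebra
  qed
  define W where "W x = \<Gamma> G (\<lambda>y. - pseudo_inverse M A0 \<Gamma> L G y) x - poly (quad_b b0 b1 b2) (G x)" for x
  \<comment> \<open>\<open>V\<close> equals \<open>W\<close> almost everywhere but is built from
    \<open>L h\<close> and \<open>h + q\<close>, which shows that it is square integrable and lets
    its square split into known integrals.\<close>
  define V where "V x = 1 / (2 * lam) * L h x + \<beta> * (h x + q)" for x
  note gp = \<Gamma>_pseudo_inverse[OF F less_imp_neq[OF lam, symmetric], of m, folded G]
  have [measurable]: "F \<in> borel_measurable M" "G \<in> borel_measurable M" "W \<in> borel_measurable M"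
  proof -
    show 1[measurable]: "F \<in> borel_measurable M" by (rule L2_measurable[OF F2])
    show "G \<in> borel_measurable M" unfolding G by simp
    show "W \<in> borel_measurable M" unfolding W_def quad_b_def G using gp(2)[unfolded G] by simp
  qed
  have VL2: "V \<in> L2 M" unfolding V_def by (intro L2_add L2_cmult Lh2 hq2)
  have VW: "AE x in M. V x = W x"
    using gp(1) sq(2)
  proof eventually_elim
    case (elim x)
    have "poly (quad_b b0 b1 b2) (G x) = b2 * (F x)\<^sup>2 + (2 * b2 * m + b1) * F x + (b2 * m\<^sup>2 + b1 * m + b0)"
      unfolding quad_b_def G by (simp add: power2_eq_square algebra_simps)
    also have "\<dots> = b2 * (F x)\<^sup>2 - c * (1 / 2 - b2) * F x - \<beta> * q" unfolding coeff coeff' by (simp add: algebra_simps)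
    finally have "W x = \<Gamma> F F x / lam - (b2 * (F x)\<^sup>2 - c * (1 / 2 - b2) * F x - \<beta> * q)"
      unfolding W_def elim(1) by simp
    moreover have "V x = 1 / (2 * lam) * (2 * \<Gamma> F F x - 2 * lam * (F x)\<^sup>2 - c * lam * F x) + \<beta> * (h x + q)"
      by (simp only: V_def elim(2))
    then have "V x = \<Gamma> F F x / lam - (b2 * (F x)\<^sup>2 - c * (1 / 2 - b2) * F x - \<beta> * q)"
      unfolding h_def \<beta>_def using lam by (simp add: field_simps)
    ultimately show ?case by simp
  qed
  have WL2: "W \<in> L2 M" by (rule L2_cong_AE[OF VL2 _ VW]) simp
  have "(\<integral>x. (W x)\<^sup>2 \<partial>M) = (\<integral>x. (V x)\<^sup>2 \<partial>M)"
    by (rule integral_cong_AE) (use VW L2_measurable[OF VL2] in auto)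
  also have "\<dots> = (\<integral>x. (1 / (2 * lam))\<^sup>2 * (L h x)\<^sup>2 + \<beta> / lam * ((h x + q) * L h x) + \<beta>\<^sup>2 * (h x + q)\<^sup>2 \<partial>M)"
    by (rule Bochner_Integration.integral_cong) (use lam in \<open>simp_all add: V_def field_simps power2_eq_square\<close>)
  also have "\<dots> = (1 / (2 * lam))\<^sup>2 * (\<integral>x. (L h x)\<^sup>2 \<partial>M) + \<beta> / lam * (\<integral>x. (h x + q) * L h x \<partial>M) + \<beta>\<^sup>2 * R"
    unfolding R_def using iR Lh2 L2_integrable_mult[OF hq2 Lh2] by (simp add: L2_def)
  \<comment> \<open>The constant \<open>q\<close> drops out because \<open>L h\<close> has mean
    zero.\<close>
  also have "(\<integral>x. (h x + q) * L h x \<partial>M) = Xh"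
    unfolding Xh_def
    using L2_integrable_mult[OF gen_dom_L2[OF sq(1)] Lh2] L2_integrable[OF finite_measure_axioms Lh2] integral_L[OF sq(1)]
    by (simp add: distrib_right)
  also have "(1 / (2 * lam))\<^sup>2 * (\<integral>x. (L h x)\<^sup>2 \<partial>M) \<le> (1 / (2 * lam))\<^sup>2 * (- (\<eta> * lam) * Xh)"
    unfolding Xh_def by (intro mult_left_mono sq(3)) simp
  also have "(1 / (2 * lam))\<^sup>2 * (- (\<eta> * lam) * Xh) = - \<eta> / 4 * (Xh / lam)"
    using lam by (simp add: field_simps power2_eq_square)
  finally have main: "(\<integral>x. (W x)\<^sup>2 \<partial>M) \<le> - \<eta> / 4 * (Xh / lam) + \<beta> / lam * Xh + \<beta>\<^sup>2 * R" by simp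
  \<comment> \<open>An identity in \<open>\<eta>\<close>: the terms
    \<open>\<eta> \<beta> R / 2\<close> cancel and \<open>2 \<beta>^2 R - \<beta>^2 R\<close>
    remains. So (b) is the estimate just obtained, and in (a) the last summand on the left is
    nonpositive because \<open>R\<close> and \<open>\<beta>\<close> are nonnegative.\<close>
  have rhs: "2 * (1 - b2 - \<eta> / 4) * (\<beta> * R + Xh / (2 * lam)) + (\<eta> - 2 * (1 - b2)) * (1 - b2) / 2 * R
      = - \<eta> / 4 * (Xh / lam) + \<beta> / lam * Xh + \<beta>\<^sup>2 * R"
    unfolding \<beta>_def using lam by (simp add: field_simps power2_eq_square)
  have int: "integrable M (\<lambda>x. (W x)\<^sup>2)" using WL2 by (simp add: L2_def)
  have a: "(\<integral>x. (W x)\<^sup>2 \<partial>M) \<le> 2 * (1 - b2 - \<eta> / 4) * (\<beta> * R + Xh / (2 * lam))" if "\<eta> \<le> 2 * (1 - b2)"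
  proof -
    have "(\<eta> - 2 * (1 - b2)) * ((1 - b2) / 2 * R) \<le> 0"
      using that \<beta> R by (intro mult_nonpos_nonneg) (simp_all add: \<beta>_def)
    then show ?thesis using main rhs by simp
  qed
  have b: "(\<integral>x. (W x)\<^sup>2 \<partial>M) \<le> 2 * (1 - b2 - \<eta> / 4) * (\<beta> * R + Xh / (2 * lam))
      + (\<eta> - 2 * (1 - b2)) * (1 - b2) / 2 * R"
    using main rhs by simp
  show ?thesis
    unfolding W_def[symmetric] intU Q R_def[symmetric] Let_def using int a b by blast
qed

end
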